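(* Let $\alpha\in(0,1)$. Let $\varphi$ be a univalent holomorphic self-map of $\mathbb{D}$ with $\varphi''\in H^{\infty}(\mathbb{D})$ and let $\psi \in \mathrm{Hol}(\mathbb{D})$. (i) Suppose $\sup_{z \in \mathbb{D}}|\psi''(z)|(1-|z|^2)<\infty$. Then $C_{\psi,\varphi}$ is bounded on $\mathcal{D}_{\alpha}$ if and only if $$\sup_{z \in \mathbb{D}}|\psi(z)|\left(\frac{1-|z|^2}{1-|\varphi(z)|^2}\right)^{\frac{\alpha}{2}}<\infty.$$ (ii) Suppose $\lim_{|z|\to 1^-}|\psi''(z)|(1-|z|^2)=0$. Then $C_{\psi,\varphi}$ is compact on $\mathcal{D}_{\alpha}$ if and only if $$\lim_{|z|\to 1^-}|\psi(z)|\left(\frac{1-|z|^2}{1-|\varphi(z)|^2}\right)^{\frac{\alpha}{2}}=0.$$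
   Context: $\mathbb{D}=\{z\in\mathbb{C}:|z|<1\}$; $\mathrm{Hol}(\mathbb{D})$ is the space of complex-valued holomorphic functions on $\mathbb{D}$ and $H^\infty(\mathbb{D})$ the space of bounded ones. A holomorphic self-map of $\mathbb{D}$ is $\varphi\in\mathrm{Hol}(\mathbb{D})$ with $\varphi(\mathbb{D})\subseteq\mathbb{D}$; univalent means injective. For $\psi\in\mathrm{Hol}(\mathbb{D})$ and a holomorphic self-map $\varphi$, the weighted composition operator is $C_{\psi,\varphi}f=\psi\,(f\circ\varphi)$ for $f\in\mathrm{Hol}(\mathbb{D})$. For $\alpha\in\mathbb{R}$, the weighted Dirichlet space $\mathcal{D}_\alpha$ is the Hilbert space of all $f(z)=\sum_{n\ge 0}a_nz^n\in\mathrm{Hol}(\mathbb{D})$ with $\|f\|_{\mathcal{D}_\alpha}^2=\sum_{n\ge 0}(n+1)^{1-\alpha}|a_n|^2<\infty$, with inner product $\langle f,g\rangle_{\mathcal{D}_\alpha}=\sum_{n\ge 0}(n+1)^{1-\alpha}a_n\overline{b_n}$ for $g(z)=\sum_{n\ge0} b_nz^n$. "$C_{\psi,\varphi}$ is bounded (compact) on $\mathcal{D}_\alpha$" means that it maps $\mathcal{D}_\alpha$ into itself and is a bounded (compact) linear operator there. *)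

theory Defs
  imports "HOL-Complex_Analysis.Complex_Analysis" "HOL-Library.Going_To_Filter"
begin

text \<open>
  An element of Hol(D) is represented by a total function that is holomorphic on the open unit
  disc. Its values outside the disc carry no meaning: two functions represent the same element
  iff they agree on the disc, and nothing below depends on the values outside it.
\<close>

abbreviation unit_disc :: "complex set" where
  "unit_disc \<equiv> ball 0 1"

definition Hinf :: "(complex \<Rightarrow> complex) set" where
  "Hinf = {f. f holomorphic_on unit_disc \<and> bounded (f ` unit_disc)}"

definition weighted_comp_op ::
    "(complex \<Rightarrow> complex) \<Rightarrow> (complex \<Rightarrow> complex) \<Rightarrow> (complex \<Rightarrow> complex) \<Rightarrow> (complex \<Rightarrow> complex)" where
  "weighted_comp_op \<psi> \<phi> f = (\<lambda>z. \<psi> z * f (\<phi> z))"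

definition dirichlet_term :: "real \<Rightarrow> (complex \<Rightarrow> complex) \<Rightarrow> nat \<Rightarrow> real" where
  "dirichlet_term \<alpha> f n =
     real (n + 1) powr (1 - \<alpha>) * (cmod (fps_nth (fps_expansion f 0) n))\<^sup>2"

definition dirichlet_space :: "real \<Rightarrow> (complex \<Rightarrow> complex) set" where
  "dirichlet_space \<alpha> = {f. f holomorphic_on unit_disc \<and> summable (dirichlet_term \<alpha> f)}"

definition dirichlet_norm :: "real \<Rightarrow> (complex \<Rightarrow> complex) \<Rightarrow> real" where
  "dirichlet_norm \<alpha> f = sqrt (\<Sum>n. dirichlet_term \<alpha> f n)"

definition linear_on_dirichlet ::
    "real \<Rightarrow> ((complex \<Rightarrow> complex) \<Rightarrow> (complex \<Rightarrow> complex)) \<Rightarrow> bool" where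
  "linear_on_dirichlet \<alpha> T \<longleftrightarrow>
     T ` dirichlet_space \<alpha> \<subseteq> dirichlet_space \<alpha> \<and>
     (\<forall>f\<in>dirichlet_space \<alpha>. \<forall>g\<in>dirichlet_space \<alpha>. \<forall>z\<in>unit_disc.
        T (\<lambda>w. f w + g w) z = T f z + T g z) \<and>
     (\<forall>c. \<forall>f\<in>dirichlet_space \<alpha>. \<forall>z\<in>unit_disc. T (\<lambda>w. c * f w) z = c * T f z)"

definition bounded_on_dirichlet ::
    "real \<Rightarrow> ((complex \<Rightarrow> complex) \<Rightarrow> (complex \<Rightarrow> complex)) \<Rightarrow> bool" where
  "bounded_on_dirichlet \<alpha> T \<longleftrightarrow>
     linear_on_dirichlet \<alpha> T \<and>
     (\<exists>C. \<forall>f\<in>dirichlet_space \<alpha>. dirichlet_norm \<alpha> (T f) \<le> C * dirichlet_norm \<alpha> f)"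

text \<open>
  Compactness: the image of every norm-bounded sequence has a subsequence converging in norm to
  an element of the space. Boundedness of the operator is a consequence.
\<close>

definition compact_on_dirichlet ::
    "real \<Rightarrow> ((complex \<Rightarrow> complex) \<Rightarrow> (complex \<Rightarrow> complex)) \<Rightarrow> bool" where
  "compact_on_dirichlet \<alpha> T \<longleftrightarrow>
     linear_on_dirichlet \<alpha> T \<and>
     (\<forall>f :: nat \<Rightarrow> complex \<Rightarrow> complex.
        range f \<subseteq> dirichlet_space \<alpha> \<and> bdd_above (range (\<lambda>n. dirichlet_norm \<alpha> (f n))) \<longrightarrow>
        (\<exists>r g. strict_mono (r :: nat \<Rightarrow> nat) \<and> g \<in> dirichlet_space \<alpha> \<and>
           (\<lambda>n. dirichlet_norm \<alpha> (\<lambda>z. T (f (r n)) z - g z)) \<longlonglongrightarrow> 0))"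

end

theory Submission
  imports Defs "HOL-Real_Asymp.Real_Asymp"
begin

text \<open>
  Write \<open>T f = \<psi> (f \<circ> \<phi>)\<close> and \<open>q(z) = |\<psi>(z)| ((1 - |z|\<^sup>2) / (1 - |\<phi>(z)|\<^sup>2))\<^bsup>\<alpha>/2\<^esup>\<close>. Two facts about
  \<open>D\<^sub>\<alpha>\<close> carry the proof. First, \<open>\<parallel>f\<parallel>\<^sup>2\<close> is comparable to \<open>|f(0)|\<^sup>2\<close> plus the area integral of
  \<open>|f'|\<^sup>2 (1 - |z|\<^sup>2)\<^sup>\<alpha>\<close> over the disc (lemmas \<open>weighted_area_deriv_le_dirichlet_norm\<close> and
  \<open>dirichlet_norm_le_weighted_area_deriv\<close>). Second, the reproducing kernel at \<open>z\<close> has squared norm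
  \<open>\<Sum>n. (n + 1)\<^bsup>\<alpha>-1\<^esup> |z|\<^bsup>2n\<^esup>\<close>, which is comparable to \<open>(1 - |z|\<^sup>2)\<^bsup>-\<alpha>\<^esup>\<close> (lemma \<open>kernel_sum_bounds\<close>);
  hence \<open>|f(z)|\<^sup>2 (1 - |z|\<^sup>2)\<^sup>\<alpha> \<le> C \<parallel>f\<parallel>\<^sup>2\<close>, and for each fixed \<open>f\<close> the left-hand side tends to 0 at the
  boundary because polynomials are dense.

  Necessity tests \<open>T\<close> on the normalised kernel at \<open>\<phi>(z)\<close>: its image under \<open>T\<close>, evaluated at \<open>z\<close>, has
  modulus comparable to \<open>q(z) (1 - |z|\<^sup>2)\<^bsup>-\<alpha>/2\<^esup>\<close>, while a bounded image can only be of size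
  \<open>(1 - |z|\<^sup>2)\<^bsup>-\<alpha>/2\<^esup>\<close> at \<open>z\<close>. So boundedness of \<open>T\<close> bounds \<open>q\<close>. If \<open>T\<close> is compact and \<open>q\<close> stayed away from
  0 along points tending to the boundary, then the images of the kernels at these points would have a
  norm-convergent subsequence; its limit \<open>g\<close> would have to grow at the full rate along the points,
  contrary to the little-o growth of \<open>g\<close>.

  Sufficiency splits \<open>(T f)' = \<psi>' (f \<circ> \<phi>) + \<psi> (f' \<circ> \<phi>) \<phi>'\<close>. In the first term, the Schwarz--Pick
  inequality \<open>1 - |z|\<^sup>2 \<le> K (1 - |\<phi>(z)|\<^sup>2)\<close> and the growth bound give
  \<open>|f(\<phi>(z))|\<^sup>2 (1 - |z|\<^sup>2)\<^sup>\<alpha> \<le> C \<parallel>f\<parallel>\<^sup>2\<close>, so its energy is at most \<open>C \<parallel>f\<parallel>\<^sup>2\<close> times the area integral of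
  \<open>|\<psi>'|\<^sup>2\<close>. That integral is finite: \<open>|\<psi>''| (1 - |z|\<^sup>2)\<close> is bounded, so \<open>|\<psi>''|\<^sup>2 (1 - |z|\<^sup>2)\<^sup>2\<close> is integrable,
  and in terms of Taylor coefficients this says that \<open>|\<psi>'|\<^sup>2\<close> is integrable. In the second term
  the integrand is \<open>q\<^sup>2\<close> times \<open>|f'(\<phi>(z))|\<^sup>2 (1 - |\<phi>(z)|\<^sup>2)\<^sup>\<alpha> |\<phi>'(z)|\<^sup>2\<close>, and since \<open>\<phi>\<close> is univalent the
  integral of the latter factor is the energy of \<open>f\<close> over \<open>\<phi>(D)\<close>. This proves boundedness. For
  compactness, Montel's theorem extracts from a bounded sequence a subsequence with
  locally uniform limit \<open>g\<close> in \<open>D\<^sub>\<alpha>\<close>; for the differences with \<open>g\<close> both energies tend to 0, by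
  dominated convergence and because \<open>q\<close> is small near the boundary.
\<close>

section \<open>Change of variables under univalent maps\<close>

text \<open>
  The change-of-variables theorem for Lebesgue measure is stated for \<open>real^n\<close>. The complex plane is
  therefore identified with \<open>real^2\<close> by a measure-preserving linear map.
\<close>

definition cart2_complex :: "real^2 \<Rightarrow> complex" where
  "cart2_complex x = Complex (vec_nth x 1) (vec_nth x 2)"

definition complex_cart2 :: "complex \<Rightarrow> real^2" where
  "complex_cart2 z = vector [Re z, Im z]"

lemma cart2_complex_inverse [simp]: "complex_cart2 (cart2_complex x) = x"
  by (simp add: cart2_complex_def complex_cart2_def vec_eq_iff forall_2)

lemma complex_cart2_inverse [simp]: "cart2_complex (complex_cart2 z) = z"
  by (simp add: cart2_complex_def complex_cart2_def)

lemma linear_cart2_complex: "bounded_linear cart2_complex"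
  by (intro linear_conv_bounded_linear[THEN iffD1] linearI)
     (auto simp: cart2_complex_def complex_eq_iff)

lemma linear_complex_cart2: "bounded_linear complex_cart2"
  by (intro linear_conv_bounded_linear[THEN iffD1] linearI)
     (auto simp: complex_cart2_def vec_eq_iff forall_2)

lemma borel_cart2_complex [measurable]: "cart2_complex \<in> borel_measurable borel"
  by (intro borel_measurable_continuous_onI linear_continuous_on linear_cart2_complex)

lemma distr_cart2_complex: "distr lborel borel cart2_complex = lborel"
proof (rule lborel_eqI[symmetric])
  fix l u :: complex assume le: "\<And>b. b \<in> Basis \<Longrightarrow> l \<bullet> b \<le> u \<bullet> b"
  have le': "Re l \<le> Re u" "Im l \<le> Im u"
    using le[of 1] le[of \<i>] by (auto simp: Basis_complex_def)
  have pre: "cart2_complex -` box l u = box (complex_cart2 l) (complex_cart2 u)"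
    by (auto simp: cart2_complex_def complex_cart2_def box_def Basis_complex_def Basis_vec_def
        UNIV_2 inner_axis)
  have "emeasure (distr lborel borel cart2_complex) (box l u) =
      emeasure lborel (box (complex_cart2 l) (complex_cart2 u))"
    by (subst emeasure_distr) (auto simp: pre)
  also have "\<dots> = (\<Prod>b\<in>Basis. (complex_cart2 u - complex_cart2 l) \<bullet> b)"
    by (rule emeasure_lborel_box)
       (use le' in \<open>auto simp: complex_cart2_def Basis_vec_def UNIV_2 inner_axis\<close>)
  also have "(\<Prod>b\<in>Basis. (complex_cart2 u - complex_cart2 l) \<bullet> b) = (\<Prod>b\<in>Basis. (u - l) \<bullet> b)"
  proof -
    have "axis 1 (1::real) \<noteq> (axis 2 1 :: real^2)" by (simp add: axis_eq_axis)
    hence "(\<Prod>b\<in>Basis. (complex_cart2 u - complex_cart2 l) \<bullet> b) = (Re u - Re l) * (Im u - Im l)"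
      by (simp add: Basis_vec_def UNIV_2 inner_axis complex_cart2_def)
    thus ?thesis by (simp add: Basis_complex_def)
  qed
  finally show "emeasure (distr lborel borel cart2_complex) (box l u) = (\<Prod>b\<in>Basis. (u - l) \<bullet> b)" .
qed simp

text \<open>
  By the Cauchy--Riemann equations the real Jacobian determinant of a holomorphic map is \<open>|\<phi>'|\<^sup>2\<close>;
  multiplication by \<open>c\<close> is the differential at a point with \<open>\<phi>' = c\<close>.
\<close>

lemma det_complex_mult:
  "det (matrix (\<lambda>x. complex_cart2 (c * cart2_complex x))) = (cmod c)\<^sup>2"
  by (simp add: det_2 matrix_def complex_cart2_def cart2_complex_def axis_def cmod_power2)
     (simp add: power2_eq_square)

lemma borel_measurable_cont_indicator:
  fixes f :: "complex \<Rightarrow> real"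
  assumes "continuous_on S f" "A \<in> sets borel" "A \<subseteq> S"
  shows "(\<lambda>z. ennreal (f z) * indicator A z) \<in> borel_measurable borel"
proof -
  have "continuous_on A f" using assms continuous_on_subset by blast
  hence "(\<lambda>z. indicator A z *\<^sub>R f z) \<in> borel_measurable borel"
    using assms by (intro borel_measurable_continuous_on_indicator) auto
  hence "(\<lambda>z. ennreal (indicator A z *\<^sub>R f z)) \<in> borel_measurable borel"
    by measurable
  moreover have "(\<lambda>z. ennreal (indicator A z *\<^sub>R f z)) = (\<lambda>z. ennreal (f z) * indicator A z)"
    by (auto simp: indicator_def)
  ultimately show ?thesis by simp
qed

text \<open>
  The change-of-variables theorem for measures, applied to the preimage of \<open>E\<close>. Boundedness of the image
  makes all measures finite, so that the gauge integral of the Jacobian is the measure of the image.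
\<close>

lemma emeasure_univalent_image:
  fixes \<phi> :: "complex \<Rightarrow> complex"
  assumes S: "open S" and hol: "\<phi> holomorphic_on S" and inj: "inj_on \<phi> S"
    and bdd: "bounded (\<phi> ` S)" and E: "E \<in> sets borel"
  shows "(\<integral>\<^sup>+z\<in>S \<inter> \<phi> -` E. ennreal ((cmod (deriv \<phi> z))\<^sup>2) \<partial>lborel) = emeasure lborel (\<phi> ` S \<inter> E)"
proof -
  let ?v = complex_cart2 and ?u = cart2_complex
  define A where "A = S \<inter> \<phi> -` E"
  have cont: "continuous_on S \<phi>" by (rule holomorphic_on_imp_continuous_on[OF hol])
  have [measurable]: "A \<in> sets borel"
  proof -
    have "\<phi> \<in> borel_measurable (restrict_space borel S)"
      using borel_measurable_continuous_on_restrict[OF cont] .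
    hence "\<phi> -` E \<inter> space (restrict_space borel S) \<in> sets (restrict_space borel S)"
      using E by (rule measurable_sets)
    thus ?thesis using S by (simp add: sets_restrict_space_iff space_restrict_space A_def Int_commute)
  qed
  have opn: "open (\<phi> ` S)" by (rule open_mapping_thm3[OF hol S inj])
  have img[measurable]: "\<phi> ` S \<inter> E \<in> sets borel" using opn E by auto
  define F where "F = (\<lambda>x. ?v (\<phi> (?u x)))"
  have A': "?u -` A \<in> sets borel" 
    using measurable_sets[OF borel_cart2_complex, of A] by simp
  have FA: "F ` (?u -` A) = ?u -` (\<phi> ` S \<inter> E)"
  proof safe
    fix x assume "?u x \<in> A" thus "F x \<in> ?u -` (\<phi> ` S \<inter> E)" by (auto simp: F_def A_def)
  next
    fix x w assume "?u x = \<phi> w" "?u x \<in> E" "w \<in> S"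
    hence "F (?v w) = x" "?v w \<in> ?u -` A" by (auto simp: F_def A_def) (metis cart2_complex_inverse)
    thus "x \<in> F ` (?u -` A)" by blast
  qed
  have meas: "?u -` (\<phi> ` S \<inter> E) \<in> sets borel"
    using measurable_sets[OF borel_cart2_complex img] by simp
  have bd: "bounded (?u -` (\<phi> ` S \<inter> E))"
  proof (rule bounded_subset)
    show "bounded (?v ` (\<phi> ` S))" using bdd linear_complex_cart2 bounded_linear_image by blast
    show "?u -` (\<phi> ` S \<inter> E) \<subseteq> ?v ` (\<phi> ` S)" 
      by (auto simp: image_iff) (metis cart2_complex_inverse)
  qed
  have lm: "F ` (?u -` A) \<in> lmeasurable"
    unfolding FA using bd meas by (intro bounded_set_imp_lmeasurable) auto
  have der: "(F has_derivative (\<lambda>y. ?v (deriv \<phi> (?u x) * ?u y))) (at x within ?u -` A)"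
    if "x \<in> ?u -` A" for x
  proof -
    have "(\<phi> has_field_derivative deriv \<phi> (?u x)) (at (?u x))"
      using that hol S by (auto simp: A_def intro: holomorphic_derivI)
    hence 1: "(\<phi> has_derivative (*) (deriv \<phi> (?u x))) (at (?u x))"
      by (simp add: has_field_derivative_def)
    have 2: "(?u has_derivative ?u) (at x)"
      using linear_cart2_complex by (rule bounded_linear_imp_has_derivative)
    have 3: "(?v has_derivative ?v) (at (\<phi> (?u x)))"
      using linear_complex_cart2 by (rule bounded_linear_imp_has_derivative)
    have "(F has_derivative (\<lambda>y. ?v (deriv \<phi> (?u x) * ?u y))) (at x)"
      using has_derivative_compose[OF has_derivative_compose[OF 2 1] 3] unfolding F_def .
    thus ?thesis by (rule has_derivative_at_withinI)
  qed
  have injF: "inj_on F (?u -` A)"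
  proof (rule inj_onI)
    fix x y assume *: "x \<in> ?u -` A" "y \<in> ?u -` A" "F x = F y"
    hence "\<phi> (?u x) = \<phi> (?u y)" unfolding F_def by (metis complex_cart2_inverse)
    hence "?u x = ?u y" using * inj by (auto simp: A_def inj_on_def)
    thus "x = y" by (metis cart2_complex_inverse)
  qed
  have "((\<lambda>x. \<bar>det (matrix (\<lambda>y. ?v (deriv \<phi> (?u x) * ?u y)))\<bar>) has_integral measure lebesgue (F ` (?u -` A)))
          (?u -` A)"
    using has_measure_differentiable_image[OF _ der injF, of "measure lebesgue (F ` (?u -` A))"] A' lm by auto
  hence "((\<lambda>x. (cmod (deriv \<phi> (?u x)))\<^sup>2) has_integral measure lebesgue (F ` (?u -` A))) (?u -` A)"
    by (simp add: det_complex_mult)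
  hence "(\<integral>\<^sup>+x. ennreal ((cmod (deriv \<phi> (?u x)))\<^sup>2) * indicator (?u -` A) x \<partial>lborel)
     = ennreal (measure lebesgue (F ` (?u -` A)))"
    by (intro nn_integral_has_integral_lebesgue') auto
  also have "\<dots> = emeasure lebesgue (F ` (?u -` A))"
    using lm by (metis emeasure_eq_measure2 fmeasurableD2 ennreal_enn2real measure_def top.not_eq_extremum)
  also have "\<dots> = emeasure lborel (?u -` (\<phi> ` S \<inter> E))"
    unfolding FA using meas by simp
  also have "\<dots> = emeasure (distr lborel borel ?u) (\<phi> ` S \<inter> E)"
    by (subst emeasure_distr) auto
  also have "\<dots> = emeasure lborel (\<phi> ` S \<inter> E)"
    by (simp add: distr_cart2_complex)
  also have "(\<integral>\<^sup>+x. ennreal ((cmod (deriv \<phi> (?u x)))\<^sup>2) * indicator (?u -` A) x \<partial>lborel)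
    = (\<integral>\<^sup>+z. ennreal ((cmod (deriv \<phi> z))\<^sup>2) * indicator A z \<partial>distr lborel borel ?u)"
  proof -
    have "(\<lambda>z. ennreal ((cmod (deriv \<phi> z))\<^sup>2) * indicator A z) \<in> borel_measurable borel"
      by (rule borel_measurable_cont_indicator[of S])
         (use S hol \<open>A \<in> sets borel\<close> in \<open>auto simp: A_def intro!: continuous_intros holomorphic_on_imp_continuous_on holomorphic_deriv\<close>)
    thus ?thesis by (simp add: nn_integral_distr indicator_def)
  qed
  finally show ?thesis
    by (simp add: distr_cart2_complex A_def)
qed

text \<open>
  The preceding lemma says that \<open>\<phi>\<close> transports the measure with density \<open>|\<phi>'|\<^sup>2\<close> on \<open>S\<close> to area
  measure on \<open>\<phi>(S)\<close>; the formula for functions follows from this identity of measures.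
\<close>

lemma nn_integral_univalent_substitution:
  fixes \<phi> :: "complex \<Rightarrow> complex"
  assumes S: "open S" and hol: "\<phi> holomorphic_on S" and inj: "inj_on \<phi> S"
    and bdd: "bounded (\<phi> ` S)" and h [measurable]: "h \<in> borel_measurable borel"
  shows "(\<integral>\<^sup>+z\<in>S. h (\<phi> z) * ennreal ((cmod (deriv \<phi> z))\<^sup>2) \<partial>lborel) = (\<integral>\<^sup>+w\<in>\<phi> ` S. h w \<partial>lborel)"
proof -
  define J where "J = (\<lambda>z. ennreal ((cmod (deriv \<phi> z))\<^sup>2) * indicator S z)"
  \<comment> \<open>A push-forward needs a globally measurable map; the density vanishes where the value 0 is put in.\<close>
  define \<Phi> where "\<Phi> = (\<lambda>z. if z \<in> S then \<phi> z else 0)"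
  have [measurable]: "J \<in> borel_measurable borel"
    unfolding J_def by (rule borel_measurable_cont_indicator[of S])
         (use S hol in \<open>auto intro!: continuous_intros holomorphic_on_imp_continuous_on holomorphic_deriv\<close>)
  have [measurable]: "\<Phi> \<in> borel_measurable borel"
    unfolding \<Phi>_def using S by (intro borel_measurable_continuous_on_if)
      (auto intro!: holomorphic_on_imp_continuous_on hol)
  have [measurable]: "S \<in> sets borel" "\<phi> ` S \<in> sets borel"
    using S open_mapping_thm3[OF hol S inj] by auto
  have eq: "distr (density lborel J) borel \<Phi> = density lborel (indicator (\<phi> ` S))"
  proof (rule measure_eqI)
    fix E assume "E \<in> sets (distr (density lborel J) borel \<Phi>)"
    hence E[measurable]: "E \<in> sets borel" by simp
    have "emeasure (distr (density lborel J) borel \<Phi>) E = (\<integral>\<^sup>+z. J z * indicator (\<Phi> -` E) z \<partial>lborel)"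
      using measurable_sets[OF \<open>\<Phi> \<in> borel_measurable borel\<close> E]
      by (simp add: emeasure_distr emeasure_density)
    also have "\<dots> = (\<integral>\<^sup>+z\<in>S \<inter> \<phi> -` E. ennreal ((cmod (deriv \<phi> z))\<^sup>2) \<partial>lborel)"
      by (intro nn_integral_cong) (auto simp: J_def \<Phi>_def indicator_def)
    also have "\<dots> = emeasure lborel (\<phi> ` S \<inter> E)"
      by (rule emeasure_univalent_image[OF S hol inj bdd E])
    also have "\<dots> = emeasure (density lborel (indicator (\<phi> ` S))) E"
      by (simp add: emeasure_density indicator_inter_arith[symmetric])
    finally show "emeasure (distr (density lborel J) borel \<Phi>) E = \<dots>" .
  qed simp
  have "(\<integral>\<^sup>+z\<in>S. h (\<phi> z) * ennreal ((cmod (deriv \<phi> z))\<^sup>2) \<partial>lborel) = (\<integral>\<^sup>+z. J z * h (\<Phi> z) \<partial>lborel)"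
    by (intro nn_integral_cong) (auto simp: J_def \<Phi>_def indicator_def mult.commute)
  also have "\<dots> = (\<integral>\<^sup>+w. h w \<partial>distr (density lborel J) borel \<Phi>)"
    by (simp add: nn_integral_distr nn_integral_density)
  also have "\<dots> = (\<integral>\<^sup>+w\<in>\<phi> ` S. h w \<partial>lborel)"
    unfolding eq by (simp add: nn_integral_density mult.commute)
  finally show ?thesis .
qed

section \<open>Parseval's identity and area integrals over the disc\<close>

lemma nn_integral_disc_rotate:
  assumes c: "cmod c = 1" and h [measurable]: "h \<in> borel_measurable borel"
  shows "(\<integral>\<^sup>+z\<in>unit_disc. h (c * z) \<partial>lborel) = (\<integral>\<^sup>+z\<in>unit_disc. h z \<partial>lborel)"
proof -
  have c0: "c \<noteq> 0" using c by auto
  have img: "(*) c ` unit_disc = unit_disc"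
  proof safe
    fix z :: complex assume "z \<in> unit_disc"
    thus "c * z \<in> unit_disc" using c by (simp add: norm_mult)
  next
    fix z :: complex assume "z \<in> unit_disc"
    hence "z / c \<in> unit_disc" "z = c * (z / c)" using c c0 by (auto simp: norm_divide)
    thus "z \<in> (*) c ` unit_disc" by blast
  qed
  have "(\<integral>\<^sup>+z\<in>unit_disc. h (c * z) * ennreal ((cmod (deriv ((*) c) z))\<^sup>2) \<partial>lborel)
      = (\<integral>\<^sup>+w\<in>(*) c ` unit_disc. h w \<partial>lborel)"
    by (rule nn_integral_univalent_substitution)
       (use c0 img in \<open>auto intro!: holomorphic_intros inj_onI\<close>)
  moreover have "deriv ((*) c) z = c" for z
    by (rule DERIV_imp_deriv) (auto intro!: derivative_eq_intros)
  ultimately show ?thesis using c by (simp add: img)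
qed

lemma emeasure_disc_norm_sq_gt:
  "emeasure lborel {z \<in> unit_disc. x < (cmod z)\<^sup>2} = ennreal (pi * (if x < 0 then 1 else if x < 1 then 1 - x else 0))"
proof -
  have D: "emeasure lborel unit_disc = ennreal pi"
    by (simp add: emeasure_ball unit_ball_vol_2)
  consider "x < 0" | "0 \<le> x" "x < 1" | "1 \<le> x" by linarith
  thus ?thesis
  proof cases
    case 1
    have "{z \<in> unit_disc. x < (cmod z)\<^sup>2} = unit_disc"
      using 1 by (auto intro: less_le_trans)
    thus ?thesis using 1 D by simp
  next
    case 2
    have iff: "x < (cmod z)\<^sup>2 \<longleftrightarrow> sqrt x < cmod z" for z :: complex
      by (metis real_sqrt_less_iff real_sqrt_abs abs_norm_cancel)
    have "sqrt x < 1" using 2 by simp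
    have "{z \<in> unit_disc. x < (cmod z)\<^sup>2} = unit_disc - cball 0 (sqrt x)"
      by (auto simp: iff not_le)
    moreover have "emeasure lborel (unit_disc - cball 0 (sqrt x)) = 
        emeasure lborel unit_disc - emeasure lborel (cball (0::complex) (sqrt x))"
      using 2 \<open>sqrt x < 1\<close> by (intro emeasure_Diff) (auto simp: emeasure_cball simp del: real_sqrt_lt_1_iff)
    moreover have "emeasure lborel (cball (0::complex) (sqrt x)) = ennreal (pi * x)"
      using 2 by (simp add: emeasure_cball unit_ball_vol_2)
    ultimately show ?thesis using 2 D by (simp add: ennreal_minus right_diff_distrib)
  next
    case 3
    have "{z \<in> unit_disc. x < (cmod z)\<^sup>2} = {}"
    proof -
      have "(cmod z)\<^sup>2 < 1" if "z \<in> unit_disc" for z :: complex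
        using that by (simp add: abs_square_less_1)
      thus ?thesis using 3 by force
    qed
    thus ?thesis unfolding \<open>_ = {}\<close> using 3 by simp
  qed
qed

lemma borel_measurable_indicator_disc [measurable, simp]:
  "(indicator unit_disc :: complex \<Rightarrow> ennreal) \<in> borel_measurable borel"
  by (rule borel_measurable_indicator) simp

text \<open>
  The disc of radius \<open>sqrt t\<close> has area \<open>\<pi> t\<close>, so \<open>|z|\<^sup>2\<close> is distributed on \<open>[0,1]\<close> with constant
  density \<open>\<pi>\<close>. Together with rotation invariance this replaces polar coordinates.
\<close>

lemma nn_integral_disc_radial:
  assumes g [measurable]: "g \<in> borel_measurable borel"
  shows "(\<integral>\<^sup>+z\<in>unit_disc. g ((cmod z)\<^sup>2) \<partial>lborel) = ennreal pi * (\<integral>\<^sup>+t\<in>{0..1}. g t \<partial>lborel)"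
proof -
  define M where "M = distr (density lborel (indicator unit_disc)) borel (\<lambda>z::complex. (cmod z)\<^sup>2)"
  define N where "N = density lborel (\<lambda>t::real. ennreal pi * indicator {0..1} t)"
  have M: "emeasure M {x<..} = ennreal (pi * (if x < 0 then 1 else if x < 1 then 1 - x else 0))" for x
  proof -
    have "emeasure M {x<..} = emeasure (density lborel (indicator unit_disc)) {z::complex. x < (cmod z)\<^sup>2}"
      unfolding M_def by (subst emeasure_distr) (auto simp: vimage_def)
    also have "\<dots> = emeasure lborel (unit_disc \<inter> {z. x < (cmod z)\<^sup>2})"
      by (subst emeasure_density) (auto simp: borel_measurable_indicator simp flip: indicator_inter_arith)
    also have "unit_disc \<inter> {z. x < (cmod z)\<^sup>2} = {z \<in> unit_disc. x < (cmod z)\<^sup>2}" by blast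
    finally have "emeasure M {x<..} = emeasure lborel {z \<in> unit_disc. x < (cmod z)\<^sup>2}" .
    thus ?thesis using emeasure_disc_norm_sq_gt[of x] by simp
  qed
  have N: "emeasure N {x<..} = ennreal (pi * (if x < 0 then 1 else if x < 1 then 1 - x else 0))" for x
  proof -
    have "emeasure N {x<..} = (\<integral>\<^sup>+t. ennreal pi * indicator ({0..1} \<inter> {x<..}) t \<partial>lborel)"
      unfolding N_def
      by (simp add: emeasure_density indicator_inter_arith mult.assoc)
    also have "\<dots> = ennreal pi * emeasure lborel ({0..1} \<inter> {x<..})"
      by (simp add: nn_integral_cmult)
    also have "{0..1} \<inter> {x<..} = (if x < 0 then {0..1} else if x < 1 then {x<..1} else {})"
      by auto
    also have "ennreal pi * emeasure lborel \<dots> = ennreal (pi * (if x < 0 then 1 else if x < 1 then 1 - x else 0))"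
      by (auto simp: ennreal_mult)
    finally show ?thesis .
  qed
  have "M = N"
    by (rule measure_eqI_lessThan) (simp_all only: M N, simp_all add: M_def N_def)
  have "(\<integral>\<^sup>+z\<in>unit_disc. g ((cmod z)\<^sup>2) \<partial>lborel) = (\<integral>\<^sup>+t. g t \<partial>M)"
    unfolding M_def by (simp add: nn_integral_distr nn_integral_density mult.commute)
  also have "\<dots> = ennreal pi * (\<integral>\<^sup>+t\<in>{0..1}. g t \<partial>lborel)"
    unfolding \<open>M = N\<close> N_def
    by (simp add: nn_integral_density nn_integral_cmult[symmetric] mult_ac)
  finally show ?thesis .
qed

lemma has_integral_cis_int:
  "((\<lambda>t. cis (of_int k * t)) has_integral (if k = 0 then of_real (2 * pi) else 0)) {0..2*pi}"
proof (cases "k = 0")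
  case True
  have "((\<lambda>t. 1 :: complex) has_integral (2*pi) *\<^sub>R 1) {0..2*pi}"
    using has_integral_const_real[of "1::complex" 0 "2*pi"] by simp
  thus ?thesis using True by (simp add: scaleR_conv_of_real)
next
  case False
  define F where "F = (\<lambda>t. cis (of_int k * t) / (\<i> * of_int k))"
  have "((\<lambda>t. cis (of_int k * t)) has_integral F (2 * pi) - F 0) {0..2*pi}"
  proof (rule fundamental_theorem_of_calculus)
    fix t assume "t \<in> {0..2*pi}"
    have "((\<lambda>z. exp (\<i> * (of_int k * z)) / (\<i> * of_int k)) has_field_derivative 
            exp (\<i> * (of_int k * of_real t))) (at (of_real t))"
      using False by (auto intro!: derivative_eq_intros simp: algebra_simps)
    hence "((\<lambda>t. exp (\<i> * (of_int k * of_real t)) / (\<i> * of_int k)) has_vector_derivative 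
            exp (\<i> * (of_int k * of_real t))) (at t)"
      using has_vector_derivative_real_field by blast
    thus "(F has_vector_derivative cis (of_int k * t)) (at t within {0..2*pi})"
      unfolding F_def by (auto simp: cis_conv_exp mult_ac intro: has_vector_derivative_at_within)
  qed simp
  moreover have "F (2 * pi) = F 0"
    using cis_multiple_2pi[of "of_int k"] by (simp add: F_def mult_ac)
  ultimately show ?thesis using False by simp
qed

lemma has_integral_trig_poly_norm_sq:
  "((\<lambda>t. (cmod (\<Sum>n<N. c n * cis (real n * t)))\<^sup>2) has_integral 2 * pi * (\<Sum>n<N. (cmod (c n))\<^sup>2)) {0..2*pi}"
proof -
  have eq: "complex_of_real ((cmod (\<Sum>n<N. c n * cis (real n * t)))\<^sup>2) =
      (\<Sum>n<N. \<Sum>m<N. c n * cnj (c m) * cis (of_int (int n - int m) * t))" for t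
  proof -
    have "complex_of_real ((cmod (\<Sum>n<N. c n * cis (real n * t)))\<^sup>2) =
       (\<Sum>n<N. c n * cis (real n * t)) * (\<Sum>m<N. cnj (c m) * cis (- (real m * t)))"
      by (subst complex_norm_square) (simp add: cis_cnj)
    also have "\<dots> = (\<Sum>n<N. \<Sum>m<N. c n * cnj (c m) * (cis (real n * t) * cis (- (real m * t))))"
      by (subst sum_product) (simp add: mult_ac)
    finally show ?thesis by (simp add: cis_mult algebra_simps)
  qed
  have "((\<lambda>t. \<Sum>n<N. \<Sum>m<N. c n * cnj (c m) * cis (of_int (int n - int m) * t)) has_integral
      (\<Sum>n<N. \<Sum>m<N. c n * cnj (c m) * (if int n - int m = 0 then of_real (2*pi) else 0))) {0..2*pi}"
    by (intro has_integral_sum has_integral_mult_right has_integral_cis_int) auto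
  also have "(\<Sum>n<N. \<Sum>m<N. c n * cnj (c m) * (if int n - int m = 0 then of_real (2*pi) else 0)) = 
      complex_of_real (2 * pi * (\<Sum>n<N. (cmod (c n))\<^sup>2))"
    by (simp add: if_distrib sum.delta' complex_norm_square sum_distrib_left mult_ac del: of_real_power cong: if_cong)
  finally have "((\<lambda>t. complex_of_real ((cmod (\<Sum>n<N. c n * cis (real n * t)))\<^sup>2)) has_integral
      complex_of_real (2 * pi * (\<Sum>n<N. (cmod (c n))\<^sup>2))) {0..2*pi}"
    unfolding eq .
  from has_integral_linear[OF this bounded_linear_Re] show ?thesis by (simp add: o_def)
qed

text \<open>
  Absolute summability makes the trigonometric polynomials of degree below \<open>N\<close> converge to the sum within a
  fixed bound, so the identity passes from polynomials to the limit by dominated convergence.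
\<close>

lemma parseval_circle:
  assumes c: "summable (\<lambda>n. cmod (c n))"
  shows "(\<integral>\<^sup>+t\<in>{0..2*pi}. ennreal ((cmod (\<Sum>n. c n * cis (real n * t)))\<^sup>2) \<partial>lborel)
     = ennreal (2 * pi) * (\<Sum>n. ennreal ((cmod (c n))\<^sup>2))"
proof -
  define u where "u = (\<lambda>N t. \<Sum>n<N. c n * cis (real n * t))"
  define S where "S = (\<Sum>n. cmod (c n))"
  have sm: "summable (\<lambda>n. c n * cis (real n * t))" for t
    by (rule summable_norm_cancel) (use c in \<open>simp add: norm_mult\<close>)
  have bd: "cmod (u N t) \<le> S" for N t
  proof -
    have "cmod (u N t) \<le> (\<Sum>n<N. cmod (c n))"
      unfolding u_def by (rule order_trans[OF norm_sum]) (simp add: norm_mult)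
    also have "\<dots> \<le> S" unfolding S_def by (rule sum_le_suminf[OF c]) auto
    finally show ?thesis .
  qed
  have lim: "(\<lambda>N. (cmod (u N t))\<^sup>2) \<longlonglongrightarrow> (cmod (\<Sum>n. c n * cis (real n * t)))\<^sup>2" for t
    unfolding u_def by (intro tendsto_intros summable_LIMSEQ sm)
  have fin: "((\<lambda>t. (cmod (u N t))\<^sup>2) has_integral 2 * pi * (\<Sum>n<N. (cmod (c n))\<^sup>2)) {0..2*pi}" for N
    unfolding u_def by (rule has_integral_trig_poly_norm_sq)
  have DC: "(\<lambda>t. (cmod (\<Sum>n. c n * cis (real n * t)))\<^sup>2) integrable_on {0..2*pi}"
       "(\<lambda>N. integral {0..2*pi} (\<lambda>t. (cmod (u N t))\<^sup>2)) \<longlonglongrightarrow>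
          integral {0..2*pi} (\<lambda>t. (cmod (\<Sum>n. c n * cis (real n * t)))\<^sup>2)"
    using dominated_convergence[of "\<lambda>N t. (cmod (u N t))\<^sup>2" "{0..2*pi}" "\<lambda>t. S\<^sup>2"
        "\<lambda>t. (cmod (\<Sum>n. c n * cis (real n * t)))\<^sup>2"] fin lim bd
    by (auto simp: has_integral_integrable_integral power_mono)
  define I where "I = integral {0..2*pi} (\<lambda>t. (cmod (\<Sum>n. c n * cis (real n * t)))\<^sup>2)"
  have "(\<lambda>N. 2 * pi * (\<Sum>n<N. (cmod (c n))\<^sup>2)) \<longlonglongrightarrow> I"
    using DC(2) fin by (simp add: has_integral_integrable_integral I_def)
  hence "(\<lambda>n. 2 * pi * (cmod (c n))\<^sup>2) sums I"
    by (simp add: sums_def sum_distrib_left)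
  hence "ennreal I = (\<Sum>n. ennreal (2 * pi * (cmod (c n))\<^sup>2))"
    by (simp add: suminf_ennreal2 sums_iff)
  also have "\<dots> = ennreal (2 * pi) * (\<Sum>n. ennreal ((cmod (c n))\<^sup>2))"
    by (simp add: ennreal_mult ennreal_suminf_cmult)
  finally have "ennreal I = \<dots>" .
  moreover have "((\<lambda>t. (cmod (\<Sum>n. c n * cis (real n * t)))\<^sup>2) has_integral I) {0..2*pi}"
    using DC(1) by (simp add: I_def has_integral_integrable_integral)
  hence "(\<integral>\<^sup>+t\<in>{0..2*pi}. ennreal ((cmod (\<Sum>n. c n * cis (real n * t)))\<^sup>2) \<partial>lborel) = ennreal I"
    by (intro nn_integral_has_integral_lebesgue') auto
  ultimately show ?thesis by simp
qed


lemma disc_power_series: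
  assumes "f holomorphic_on unit_disc" "z \<in> unit_disc"
  shows "(\<lambda>n. fps_nth (fps_expansion f 0) n * z ^ n) sums f z"
    and "summable (\<lambda>n. cmod (fps_nth (fps_expansion f 0) n * z ^ n))"
proof -
  have hol: "f holomorphic_on eball 0 1" using assms by (simp add: one_ereal_def)
  have rad: "fps_conv_radius (fps_expansion f 0) \<ge> 1"
    by (rule conv_radius_fps_expansion[OF hol])
  hence z: "norm z < fps_conv_radius (fps_expansion f 0)"
    using assms by (intro less_le_trans[OF _ rad]) (simp add: one_ereal_def)
  have "eval_fps (fps_expansion f 0) z = f (0 + z)"
    by (rule eval_fps_expansion'[OF hol]) (use assms in \<open>auto simp: one_ereal_def\<close>)
  with summable_fps[OF z] show "(\<lambda>n. fps_nth (fps_expansion f 0) n * z ^ n) sums f z"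
    by (simp add: eval_fps_def sums_iff)
  show "summable (\<lambda>n. cmod (fps_nth (fps_expansion f 0) n * z ^ n))"
    by (rule abs_summable_in_conv_radius) (use z in \<open>simp add: fps_conv_radius_def\<close>)
qed

text \<open>
  The integral does not change when \<open>z\<close> is replaced by \<open>e\<^bsup>it\<^esup> z\<close>. Averaging over \<open>t\<close> and exchanging
  the integrals turns \<open>|f(z)|\<^sup>2\<close> into its mean over the circle of radius \<open>|z|\<close>, which is
  \<open>\<Sum>n. |a\<^sub>n|\<^sup>2 |z|\<^bsup>2n\<^esup>\<close> by Parseval. Each term is now radial. All integrands are nonnegative, so
  the formula also holds when both sides are infinite.
\<close>

lemma area_formula:
  assumes f: "f holomorphic_on unit_disc" and w [measurable]: "w \<in> borel_measurable borel"
  shows "(\<integral>\<^sup>+z\<in>unit_disc. ennreal ((cmod (f z))\<^sup>2) * w ((cmod z)\<^sup>2) \<partial>lborel) =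
    ennreal pi * (\<Sum>n. ennreal ((cmod (fps_nth (fps_expansion f 0) n))\<^sup>2) *
        (\<integral>\<^sup>+t\<in>{0..1}. ennreal (t ^ n) * w t \<partial>lborel))"
proof -
  define a where "a = fps_nth (fps_expansion f 0)"
  define F where "F = (\<lambda>z. if z \<in> unit_disc then f z else 0)"
  define A where "A = (\<integral>\<^sup>+z\<in>unit_disc. ennreal ((cmod (F z))\<^sup>2) * w ((cmod z)\<^sup>2) \<partial>lborel)"
  have [measurable]: "F \<in> borel_measurable borel"
    unfolding F_def using f by (intro borel_measurable_continuous_on_if)
      (auto intro!: holomorphic_on_imp_continuous_on)
  have cis[measurable]: "cis \<in> borel_measurable borel"
    by (intro borel_measurable_continuous_onI continuous_intros)
  have rot: "(\<integral>\<^sup>+z\<in>unit_disc. ennreal ((cmod (F (cis t * z)))\<^sup>2) * w ((cmod z)\<^sup>2) \<partial>lborel) = A" for t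
    using nn_integral_disc_rotate[of "cis t" "\<lambda>z. ennreal ((cmod (F z))\<^sup>2) * w ((cmod z)\<^sup>2)"]
    by (simp add: A_def norm_mult)
  have circ: "(\<integral>\<^sup>+t\<in>{0..2*pi}. ennreal ((cmod (F (cis t * z)))\<^sup>2) \<partial>lborel) =
      ennreal (2 * pi) * (\<Sum>n. ennreal ((cmod (a n))\<^sup>2) * ennreal (((cmod z)\<^sup>2) ^ n))" if z: "z \<in> unit_disc" for z
  proof -
    have "F (cis t * z) = (\<Sum>n. (a n * z ^ n) * cis (real n * t))" for t
    proof -
      have "cis t * z \<in> unit_disc" using z by (simp add: norm_mult)
      moreover have "(\<lambda>n. a n * (z ^ n * cis (real n * t))) sums f (cis t * z)"
      proof -
        have "(\<lambda>n. a n * (cis t * z) ^ n) = (\<lambda>n. a n * (z ^ n * cis (real n * t)))"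
          by (simp only: power_mult_distrib Complex.DeMoivre mult_ac)
        with disc_power_series(1)[OF f \<open>cis t * z \<in> unit_disc\<close>] show ?thesis
          by (simp flip: a_def)
      qed
      ultimately show ?thesis by (simp add: F_def sums_iff mult.assoc)
    qed
    hence "(\<integral>\<^sup>+t\<in>{0..2*pi}. ennreal ((cmod (F (cis t * z)))\<^sup>2) \<partial>lborel) =
       ennreal (2 * pi) * (\<Sum>n. ennreal ((cmod (a n * z ^ n))\<^sup>2))"
      using parseval_circle[OF disc_power_series(2)[OF f z]] by (simp add: a_def)
    also have "(\<lambda>n. ennreal ((cmod (a n * z ^ n))\<^sup>2)) = (\<lambda>n. ennreal ((cmod (a n))\<^sup>2) * ennreal (((cmod z)\<^sup>2) ^ n))"
      by (intro ext) (simp add: norm_mult norm_power power_mult_distrib ennreal_mult power_mult[symmetric] mult.commute)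
    finally show ?thesis .
  qed
  have "ennreal (2 * pi) * A = (\<integral>\<^sup>+t\<in>{0..2*pi}. A \<partial>(lborel :: real measure))"
    by (simp add: nn_integral_cmult_indicator mult.commute)
  also have "\<dots> = (\<integral>\<^sup>+t. (\<integral>\<^sup>+z. ennreal ((cmod (F (cis t * z)))\<^sup>2) * indicator {0..2*pi} t * 
        (w ((cmod z)\<^sup>2) * indicator unit_disc z) \<partial>lborel) \<partial>lborel)"
  proof (intro nn_integral_cong)
    fix t :: real
    have "A * indicator {0..2*pi} t =
       (\<integral>\<^sup>+z. ennreal ((cmod (F (cis t * z)))\<^sup>2) * w ((cmod z)\<^sup>2) * indicator unit_disc z * indicator {0..2*pi} t \<partial>lborel)"
      by (subst nn_integral_multc) (auto simp: rot)
    thus "A * indicator {0..2*pi} t = (\<integral>\<^sup>+z. ennreal ((cmod (F (cis t * z)))\<^sup>2) * indicator {0..2*pi} t * 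
        (w ((cmod z)\<^sup>2) * indicator unit_disc z) \<partial>lborel)"
      by (simp add: mult_ac)
  qed
  also have "\<dots> = (\<integral>\<^sup>+z. (\<integral>\<^sup>+t. ennreal ((cmod (F (cis t * z)))\<^sup>2) * indicator {0..2*pi} t * 
        (w ((cmod z)\<^sup>2) * indicator unit_disc z) \<partial>lborel) \<partial>lborel)"
    by (rule lborel_pair.Fubini') measurable
  also have "\<dots> = (\<integral>\<^sup>+z. (\<integral>\<^sup>+t\<in>{0..2*pi}. ennreal ((cmod (F (cis t * z)))\<^sup>2) \<partial>lborel) * 
        (w ((cmod z)\<^sup>2) * indicator unit_disc z) \<partial>lborel)"
    by (subst nn_integral_multc) auto
  also have "\<dots> = (\<integral>\<^sup>+z. ennreal (2 * pi) * (\<Sum>n. ennreal ((cmod (a n))\<^sup>2) * ennreal (((cmod z)\<^sup>2) ^ n)) * 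
        (w ((cmod z)\<^sup>2) * indicator unit_disc z) \<partial>lborel)"
  proof (intro nn_integral_cong)
    fix z :: complex
    show "(\<integral>\<^sup>+t\<in>{0..2*pi}. ennreal ((cmod (F (cis t * z)))\<^sup>2) \<partial>lborel) * 
        (w ((cmod z)\<^sup>2) * indicator unit_disc z) =
      ennreal (2 * pi) * (\<Sum>n. ennreal ((cmod (a n))\<^sup>2) * ennreal (((cmod z)\<^sup>2) ^ n)) * 
        (w ((cmod z)\<^sup>2) * indicator unit_disc z)"
      by (cases "z \<in> unit_disc") (simp_all only: circ, simp)
  qed
  also have "\<dots> = ennreal (2 * pi) * (\<integral>\<^sup>+z\<in>unit_disc. (\<Sum>n. ennreal ((cmod (a n))\<^sup>2) * 
      (ennreal (((cmod z)\<^sup>2) ^ n) * w ((cmod z)\<^sup>2))) \<partial>lborel)"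
    by (subst nn_integral_cmult[symmetric])
      (auto simp: ennreal_suminf_multc mult_ac intro!: nn_integral_cong)
  also have "\<dots> = ennreal (2 * pi) * (\<integral>\<^sup>+z. (\<Sum>n. ennreal ((cmod (a n))\<^sup>2) * 
      (ennreal (((cmod z)\<^sup>2) ^ n) * w ((cmod z)\<^sup>2) * indicator unit_disc z)) \<partial>lborel)"
    by (auto simp: ennreal_suminf_multc mult_ac intro!: nn_integral_cong)
  also have "\<dots> = ennreal (2 * pi) * (\<Sum>n. ennreal ((cmod (a n))\<^sup>2) * 
      (\<integral>\<^sup>+z\<in>unit_disc. (ennreal (((cmod z)\<^sup>2) ^ n) * w ((cmod z)\<^sup>2)) \<partial>lborel))"
    by (subst nn_integral_suminf) (auto simp: nn_integral_cmult)
  also have "\<dots> = ennreal (2 * pi) * (ennreal pi * (\<Sum>n. ennreal ((cmod (a n))\<^sup>2) *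
        (\<integral>\<^sup>+t\<in>{0..1}. ennreal (t ^ n) * w t \<partial>lborel)))"
    by (subst nn_integral_disc_radial) (auto simp: mult.left_commute ennreal_suminf_cmult)
  finally have "A = ennreal pi * (\<Sum>n. ennreal ((cmod (a n))\<^sup>2) *
        (\<integral>\<^sup>+t\<in>{0..1}. ennreal (t ^ n) * w t \<partial>lborel))"
    by (simp add: ennreal_mult_cancel_left)
  moreover have "A = (\<integral>\<^sup>+z\<in>unit_disc. ennreal ((cmod (f z))\<^sup>2) * w ((cmod z)\<^sup>2) \<partial>lborel)"
    unfolding A_def by (intro nn_integral_cong) (auto simp: F_def indicator_def)
  ultimately show ?thesis by (simp add: a_def)
qed

section \<open>Asymptotics of Beta values and of the kernel series\<close>

abbreviation taylor_coeff :: "(complex \<Rightarrow> complex) \<Rightarrow> nat \<Rightarrow> complex" where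
  "taylor_coeff f n \<equiv> fps_nth (fps_expansion f 0) n"

text \<open>
  Turns an asymptotic equivalence into bounds with one constant that hold for every index.
\<close>

lemma two_sided_bounds_of_limit:
  fixes x :: "nat \<Rightarrow> real"
  assumes lim: "x \<longlonglongrightarrow> L" and L: "L > 0" and pos: "\<And>n. x n > 0"
  shows "\<exists>C>0. \<forall>n. x n \<le> C \<and> 1 \<le> C * x n"
proof -
  have "Bseq x" using lim by (intro convergent_imp_Bseq) (auto simp: convergent_def)
  then obtain K1 where K1: "K1 > 0" "\<And>n. norm (x n) \<le> K1" by (auto elim: BseqE)
  have "Bseq (\<lambda>n. inverse (x n))"
    by (intro convergent_imp_Bseq) (use tendsto_inverse[OF lim] L in \<open>auto simp: convergent_def\<close>)
  then obtain K2 where K2: "K2 > 0" "\<And>n. norm (inverse (x n)) \<le> K2" by (auto elim: BseqE)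
  show ?thesis
  proof (intro exI[of _ "max K1 K2"] conjI allI)
    fix n
    show "x n \<le> max K1 K2" using K1(2)[of n] by auto
    have "inverse (x n) \<le> max K1 K2" using K2(2)[of n] pos[of n] by auto
    thus "1 \<le> max K1 K2 * x n" using pos[of n] by (simp add: field_simps)
  qed (use K1 in auto)
qed

lemma Beta_nat_eq_pochhammer:
  assumes "s > (-1::real)"
  shows "Beta (real n + 1) (s + 1) = fact n / pochhammer (s + 1) (n + 1)"
proof -
  have nz: "s + 1 \<notin> \<int>\<^sub>\<le>\<^sub>0" using assms by (auto elim!: nonpos_Ints_cases)
  have "pochhammer (s + 1) (n + 1) = Gamma (s + 1 + real (n + 1)) / Gamma (s + 1)"
    using pochhammer_Gamma[OF nz] by simp
  moreover have "Gamma (s + 1) > 0" using assms by simp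
  moreover have "Gamma (real n + 1) = fact n"
    using Gamma_fact[of n, where 'a=real] by (simp add: add.commute)
  ultimately show ?thesis by (simp add: Beta_def add_ac)
qed

text \<open>
  \<open>B(n + 1, s + 1) (n + 1)\<^bsup>s+1\<^esup>\<close> is the sequence in Euler's limit formula for \<open>\<Gamma>(s + 1)\<close>,
  up to a factor tending to 1. Thus the
  moments of the weight \<open>(1 - t)\<^sup>s\<close> decay like \<open>(n + 1)\<^bsup>-1-s\<^esup>\<close>.
\<close>

lemma Beta_nat_asymptotics:
  assumes s: "s > (-1::real)"
  shows "\<exists>C>0. \<forall>n. Beta (real n + 1) (s + 1) * real (n + 1) powr (s + 1) \<le> C \<and>
           1 \<le> C * (Beta (real n + 1) (s + 1) * real (n + 1) powr (s + 1))"
proof (rule two_sided_bounds_of_limit)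
  have "(\<lambda>n. Gamma_series (s + 1) n * ((real n + 1) / real n) powr (s + 1)) \<longlonglongrightarrow> Gamma (s + 1) * 1"
    by (intro tendsto_mult Gamma_series_LIMSEQ) real_asymp
  moreover have "eventually (\<lambda>n. Gamma_series (s + 1) n * ((real n + 1) / real n) powr (s + 1) =
       Beta (real n + 1) (s + 1) * real (n + 1) powr (s + 1)) sequentially"
    using eventually_gt_at_top[of 0]
  proof eventually_elim
    case (elim n)
    have "exp ((s + 1) * ln (real n)) = real n powr (s + 1)"
      using elim by (simp add: powr_def)
    thus ?case using elim Beta_nat_eq_pochhammer[OF s, of n]
      by (simp add: Gamma_series_def powr_divide add.commute)
  qed
  ultimately show "(\<lambda>n. Beta (real n + 1) (s + 1) * real (n + 1) powr (s + 1)) \<longlonglongrightarrow> Gamma (s + 1)"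
    by (simp add: filterlim_cong)
  show "Beta (real n + 1) (s + 1) * real (n + 1) powr (s + 1) > 0" for n
    using s by (simp add: Beta_def)
qed (use s in auto)

text \<open>
  The Taylor coefficients of \<open>(1 - x)\<^bsup>-\<alpha>\<^esup>\<close> behave like \<open>(n + 1)\<^bsup>\<alpha>-1\<^esup>\<close>, again by Euler's limit formula, which
  makes the kernel series below comparable to this function.
\<close>

lemma pochhammer_asymptotics:
  assumes a: "(\<alpha>::real) > 0"
  shows "\<exists>C>0. \<forall>n. pochhammer \<alpha> n / fact n * real (n + 1) powr (1 - \<alpha>) \<le> C \<and>
           1 \<le> C * (pochhammer \<alpha> n / fact n * real (n + 1) powr (1 - \<alpha>))"
proof (rule two_sided_bounds_of_limit)
  have nz: "\<alpha> \<notin> \<int>\<^sub>\<le>\<^sub>0" using a by (auto elim!: nonpos_Ints_cases)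
  have G: "Gamma \<alpha> > 0" using a by simp
  have "(\<lambda>n. ((real n + 1) / real n) powr (1 - \<alpha>) / Gamma_series' \<alpha> n) \<longlonglongrightarrow> 1 / Gamma \<alpha>"
    by (intro tendsto_divide Gamma_series'_LIMSEQ) (use G in real_asymp, use G in auto)
  moreover have "eventually (\<lambda>n. ((real n + 1) / real n) powr (1 - \<alpha>) / Gamma_series' \<alpha> n =
       pochhammer \<alpha> n / fact n * real (n + 1) powr (1 - \<alpha>)) sequentially"
    using eventually_gt_at_top[of 0]
  proof eventually_elim
    case (elim n)
    have e: "exp (\<alpha> * ln (real n)) = real n powr \<alpha>"
      using elim by (simp add: powr_def)
    have "fact n = real n * fact (n - 1)" using elim by (simp add: fact_reduce)
    thus ?case using elim e
      by (simp add: Gamma_series'_def powr_divide powr_diff add.commute mult_ac)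
  qed
  ultimately show "(\<lambda>n. pochhammer \<alpha> n / fact n * real (n + 1) powr (1 - \<alpha>)) \<longlonglongrightarrow> 1 / Gamma \<alpha>"
    by (simp add: filterlim_cong)
  show "pochhammer \<alpha> n / fact n * real (n + 1) powr (1 - \<alpha>) > 0" for n
    using a by (simp add: pochhammer_pos)
qed (use a in auto)

text \<open>
  The reproducing kernel of \<open>D\<^sub>\<alpha>\<close> at \<open>z\<close>, evaluated at \<open>z\<close>, with \<open>x = |z|\<^sup>2\<close>; equivalently, the
  squared norm of that kernel.
\<close>

definition kernel_sum :: "real \<Rightarrow> real \<Rightarrow> real" where
  "kernel_sum \<alpha> x = (\<Sum>n. real (n + 1) powr (\<alpha> - 1) * x ^ n)"

lemma binomial_series_neg_power:
  assumes "0 \<le> x" "x < (1::real)"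
  shows "(\<lambda>n. pochhammer \<alpha> n / fact n * x ^ n) sums (1 - x) powr (-\<alpha>)"
proof -
  have "(\<lambda>n. ((-\<alpha>) gchoose n) * (-x) ^ n) sums (1 + (-x)) powr (-\<alpha>)"
    by (rule gen_binomial_real) (use assms in auto)
  moreover have "((-\<alpha>) gchoose n) * (-x) ^ n = pochhammer \<alpha> n / fact n * x ^ n" for n
  proof -
    have "(-x) ^ n = (-1) ^ n * x ^ n" by (metis mult_minus1 power_mult_distrib)
    thus ?thesis by (simp add: gbinomial_pochhammer flip: power_add)
  qed
  ultimately show ?thesis by simp
qed

lemma kernel_sum_bounds:
  assumes a: "(\<alpha>::real) > 0"
  shows "\<exists>C>0. \<forall>x. 0 \<le> x \<and> x < 1 \<longrightarrow> summable (\<lambda>n. real (n + 1) powr (\<alpha> - 1) * x ^ n) \<and>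
     kernel_sum \<alpha> x \<le> C * (1 - x) powr (-\<alpha>) \<and> (1 - x) powr (-\<alpha>) \<le> C * kernel_sum \<alpha> x"
proof -
  obtain C where C: "C > 0" "\<And>n. pochhammer \<alpha> n / fact n * real (n + 1) powr (1 - \<alpha>) \<le> C"
    "\<And>n. 1 \<le> C * (pochhammer \<alpha> n / fact n * real (n + 1) powr (1 - \<alpha>))"
    using pochhammer_asymptotics[OF a] by blast
  have inv: "real (n + 1) powr (1 - \<alpha>) * real (n + 1) powr (\<alpha> - 1) = 1" for n
    by (simp flip: powr_add)
  have up: "pochhammer \<alpha> n / fact n \<le> C * real (n + 1) powr (\<alpha> - 1)" for n
    using mult_right_mono[OF C(2)[of n], of "real (n + 1) powr (\<alpha> - 1)"] inv[of n]
    by (simp only: mult.assoc) simp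
  have lo: "real (n + 1) powr (\<alpha> - 1) \<le> C * (pochhammer \<alpha> n / fact n)" for n
    using mult_right_mono[OF C(3)[of n], of "real (n + 1) powr (\<alpha> - 1)"] inv[of n]
    by (simp only: mult.assoc) simp
  show ?thesis
  proof (intro exI[of _ C] conjI allI impI C(1); elim conjE)
    fix x :: real assume x: "0 \<le> x" "x < 1"
    have b: "(\<lambda>n. C * (pochhammer \<alpha> n / fact n * x ^ n)) sums (C * (1 - x) powr (-\<alpha>))"
      by (intro sums_mult binomial_series_neg_power x)
    have le1: "real (n + 1) powr (\<alpha> - 1) * x ^ n \<le> C * (pochhammer \<alpha> n / fact n * x ^ n)" for n
      using mult_right_mono[OF lo[of n], of "x ^ n"] x by (simp add: mult.assoc)
    show sm: "summable (\<lambda>n. real (n + 1) powr (\<alpha> - 1) * x ^ n)"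
      by (rule summable_comparison_test'[OF sums_summable[OF b]]) (use x le1 in auto)
    show "kernel_sum \<alpha> x \<le> C * (1 - x) powr (-\<alpha>)"
      using suminf_le[OF le1 sm sums_summable[OF b]] b by (simp add: kernel_sum_def sums_iff)
    have le2: "pochhammer \<alpha> n / fact n * x ^ n \<le> C * (real (n + 1) powr (\<alpha> - 1) * x ^ n)" for n
      using mult_right_mono[OF up[of n], of "x ^ n"] x by (simp add: mult.assoc)
    show "(1 - x) powr (-\<alpha>) \<le> C * kernel_sum \<alpha> x"
      using sums_le[OF le2 binomial_series_neg_power[OF x] sums_mult[OF summable_sums[OF sm]]]
      by (simp add: kernel_sum_def)
  qed
qed

section \<open>The Dirichlet norm as an area integral\<close>

definition weighted_area :: "real \<Rightarrow> (complex \<Rightarrow> complex) \<Rightarrow> ennreal" where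
  "weighted_area s g = (\<integral>\<^sup>+z\<in>unit_disc. ennreal ((cmod (g z))\<^sup>2 * (1 - (cmod z)\<^sup>2) powr s) \<partial>lborel)"

text \<open>
  The two integrands differ at \<open>t = 0\<close> when \<open>n = 0\<close>, because \<open>0 powr 0 = 0\<close> but \<open>0 ^ 0 = 1\<close>; a single point
  does not change the integral.
\<close>

lemma nn_integral_beta_moment:
  assumes s: "s > (-1::real)"
  shows "(\<integral>\<^sup>+t\<in>{0..1}. ennreal (t ^ n) * ennreal ((1 - t) powr s) \<partial>lborel) = ennreal (Beta (real n + 1) (s + 1))"
proof -
  have "((\<lambda>t. t powr (real n + 1 - 1) * (1 - t) powr (s + 1 - 1)) has_integral Beta (real n + 1) (s + 1)) {0..1}"
    by (rule has_integral_Beta_real) (use s in auto)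
  hence "(\<integral>\<^sup>+t\<in>{0..1}. ennreal (t powr (real n + 1 - 1) * (1 - t) powr (s + 1 - 1)) \<partial>lborel) = ennreal (Beta (real n + 1) (s + 1))"
    by (intro nn_integral_has_integral_lebesgue') auto
  moreover have "(\<integral>\<^sup>+t\<in>{0..1}. ennreal (t powr (real n + 1 - 1) * (1 - t) powr (s + 1 - 1)) \<partial>lborel) =
     (\<integral>\<^sup>+t\<in>{0..1}. ennreal (t ^ n) * ennreal ((1 - t) powr s) \<partial>lborel)"
  proof (rule nn_integral_cong_AE)
    have "AE t in lborel. t \<noteq> (0::real)" by (rule AE_lborel_singleton)
    thus "AE t in lborel. ennreal (t powr (real n + 1 - 1) * (1 - t) powr (s + 1 - 1)) * indicator {0..1} t =
       ennreal (t ^ n) * ennreal ((1 - t) powr s) * indicator {0..1} t"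
      by eventually_elim (auto simp: indicator_def powr_realpow ennreal_mult)
  qed
  ultimately show ?thesis by simp
qed

lemma weighted_area_eq_suminf:
  assumes f: "f holomorphic_on unit_disc" and s: "s > -1"
  shows "weighted_area s f =
    (\<Sum>n. ennreal (pi * ((cmod (taylor_coeff f n))\<^sup>2 * Beta (real n + 1) (s + 1))))"
proof -
  have "weighted_area s f =
     (\<integral>\<^sup>+z\<in>unit_disc. ennreal ((cmod (f z))\<^sup>2) * ennreal ((1 - (cmod z)\<^sup>2) powr s) \<partial>lborel)"
    unfolding weighted_area_def by (simp add: ennreal_mult)
  also have "\<dots> = ennreal pi * (\<Sum>n. ennreal ((cmod (taylor_coeff f n))\<^sup>2) * ennreal (Beta (real n + 1) (s + 1)))"
    by (subst area_formula[OF f, of "\<lambda>t. ennreal ((1 - t) powr s)"]) (use s in \<open>auto simp: nn_integral_beta_moment\<close>)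
  also have "\<dots> = (\<Sum>n. ennreal (pi * ((cmod (taylor_coeff f n))\<^sup>2 * Beta (real n + 1) (s + 1))))"
  proof -
    have "Beta (real n + 1) (s + 1) \<ge> 0" for n using s by (simp add: Beta_def)
    thus ?thesis by (simp add: ennreal_mult ennreal_suminf_cmult)
  qed
  finally show ?thesis .
qed

lemma taylor_coeff_deriv:
  "taylor_coeff (deriv f) n = of_nat (n + 1) * taylor_coeff f (n + 1)"
proof -
  have "(deriv ^^ n) (deriv f) 0 = (deriv ^^ (Suc n)) f 0"
    by (simp only: funpow_Suc_right o_apply)
  moreover have "1 + complex_of_nat n \<noteq> 0" by (metis of_nat_Suc of_nat_neq_0)
  ultimately show ?thesis by (simp add: fps_expansion_def)
qed

lemma dirichlet_term_nonneg [simp]: "0 \<le> dirichlet_term \<alpha> f n"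
  by (simp add: dirichlet_term_def)

text \<open>
  The \<open>n\<close>-th term of the area integral of \<open>f'\<close> is \<open>\<pi> (n + 1)\<^sup>2 |a\<^sub>n\<^sub>+\<^sub>1|\<^sup>2 B(n + 1, \<alpha> + 1)\<close>, and the Beta value is
  of order \<open>(n + 1)\<^bsup>-1-\<alpha>\<^esup>\<close>; this leaves \<open>(n + 1)\<^bsup>1-\<alpha>\<^esup> |a\<^sub>n\<^sub>+\<^sub>1|\<^sup>2\<close>, the Dirichlet term of index
  \<open>n + 1\<close> up to replacing \<open>n + 1\<close> by \<open>n + 2\<close>. The term of index 0 is not seen by the derivative.
\<close>

lemma dirichlet_term_deriv_comparison:
  assumes a: "0 < \<alpha>" "\<alpha> < 1"
  shows "\<exists>C>0. \<forall>f n. 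
     pi * ((cmod (taylor_coeff (deriv f) n))\<^sup>2 * Beta (real n + 1) (\<alpha> + 1)) \<le> C * dirichlet_term \<alpha> f (n + 1) \<and>
     dirichlet_term \<alpha> f (n + 1) \<le> C * (pi * ((cmod (taylor_coeff (deriv f) n))\<^sup>2 * Beta (real n + 1) (\<alpha> + 1)))"
proof -
  obtain C where C: "C > 0" "\<And>n. Beta (real n + 1) (\<alpha> + 1) * real (n + 1) powr (\<alpha> + 1) \<le> C"
    "\<And>n. 1 \<le> C * (Beta (real n + 1) (\<alpha> + 1) * real (n + 1) powr (\<alpha> + 1))"
    using Beta_nat_asymptotics[of \<alpha>] a by auto
  have B0: "Beta (real n + 1) (\<alpha> + 1) > 0" for n using a by (simp add: Beta_def)
  show ?thesis
  \<comment> \<open>The summand \<open>pi * C\<close> serves the first bound; the 2 in the other comes from \<open>(m + 1) powr (1 - \<alpha>) \<le> 2 * m powr (1 - \<alpha>)\<close>.\<close>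
  proof (rule exI[of _ "pi * C + 2 * C"], intro conjI allI)
    show "pi * C + 2 * C > 0" using C(1) by (simp add: add_pos_pos)
  next
    fix f n
    define m where "m = real (n + 1)"
    define b where "b = (cmod (taylor_coeff f (n + 1)))\<^sup>2"
    define B where "B = Beta (real n + 1) (\<alpha> + 1)"
    have m: "m > 0" "m \<ge> 1" by (auto simp: m_def)
    have b: "b \<ge> 0" by (simp add: b_def)
    have d: "dirichlet_term \<alpha> f (n + 1) = (m + 1) powr (1 - \<alpha>) * b"
      by (simp add: dirichlet_term_def m_def b_def add.commute)
    have e: "(cmod (taylor_coeff (deriv f) n))\<^sup>2 * B = m powr (1 - \<alpha>) * b * (B * m powr (\<alpha> + 1))"
    proof -
      have "m powr (1 - \<alpha>) * m powr (\<alpha> + 1) = m\<^sup>2"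
        using m by (simp add: powr_add[symmetric] powr_numeral)
      hence "m powr (1 - \<alpha>) * b * (B * m powr (\<alpha> + 1)) = m\<^sup>2 * b * B" by (simp add: mult_ac)
      moreover have "(cmod (taylor_coeff (deriv f) n))\<^sup>2 = m\<^sup>2 * b"
        by (simp only: taylor_coeff_deriv norm_mult power_mult_distrib norm_of_nat b_def m_def)
      ultimately show ?thesis by (simp only:)
    qed
    have CB: "B * m powr (\<alpha> + 1) \<le> C" "1 \<le> C * (B * m powr (\<alpha> + 1))"
      using C(2,3)[of n] by (auto simp: B_def m_def)
    have pm: "m powr (1 - \<alpha>) \<le> (m + 1) powr (1 - \<alpha>)" using m a by (intro powr_mono2) auto
    have pm2: "(m + 1) powr (1 - \<alpha>) \<le> 2 * m powr (1 - \<alpha>)"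
    proof -
      have "(m + 1) powr (1 - \<alpha>) \<le> (2 * m) powr (1 - \<alpha>)" using m a by (intro powr_mono2) auto
      also have "\<dots> = 2 powr (1 - \<alpha>) * m powr (1 - \<alpha>)" using m by (simp add: powr_mult)
      also have "\<dots> \<le> 2 powr 1 * m powr (1 - \<alpha>)" using a by (intro mult_right_mono powr_mono) auto
      finally show ?thesis by simp
    qed
    have "m powr (1 - \<alpha>) * b * (B * m powr (\<alpha> + 1)) \<le> (m + 1) powr (1 - \<alpha>) * b * C"
      using pm CB b C(1) B0[of n] by (intro mult_mono) (auto simp: B_def)
    hence "pi * (m powr (1 - \<alpha>) * b * (B * m powr (\<alpha> + 1))) \<le> pi * ((m + 1) powr (1 - \<alpha>) * b * C)"
      by (intro mult_left_mono) auto
    also have "\<dots> \<le> (pi * C + 2 * C) * ((m + 1) powr (1 - \<alpha>) * b)"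
      using C(1) b by (simp add: algebra_simps)
    finally show "pi * ((cmod (taylor_coeff (deriv f) n))\<^sup>2 * Beta (real n + 1) (\<alpha> + 1)) 
       \<le> (pi * C + 2 * C) * dirichlet_term \<alpha> f (n + 1)"
      unfolding B_def[symmetric] e d .
    have "(m + 1) powr (1 - \<alpha>) * b \<le> 2 * m powr (1 - \<alpha>) * b * 1"
      using pm2 b by (simp add: mult_right_mono)
    also have "\<dots> \<le> 2 * m powr (1 - \<alpha>) * b * (C * (B * m powr (\<alpha> + 1)))"
      using CB b by (intro mult_left_mono) auto
    also have "\<dots> = 2 * C * 1 * (m powr (1 - \<alpha>) * b * (B * m powr (\<alpha> + 1)))" by (simp add: mult_ac)
    also have "\<dots> \<le> (pi * C + 2 * C) * pi * (m powr (1 - \<alpha>) * b * (B * m powr (\<alpha> + 1)))"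
    proof (intro mult_right_mono mult_mono)
      show "1 \<le> pi" using pi_ge_two by linarith
    qed (use C(1) b B0[of n] in \<open>auto simp: B_def intro!: mult_nonneg_nonneg\<close>)
    finally show "dirichlet_term \<alpha> f (n + 1) \<le> (pi * C + 2 * C) *
       (pi * ((cmod (taylor_coeff (deriv f) n))\<^sup>2 * Beta (real n + 1) (\<alpha> + 1)))"
      unfolding B_def[symmetric] e d by (simp add: mult_ac)
  qed
qed


lemma dirichlet_norm_sq:
  assumes "f \<in> dirichlet_space \<alpha>"
  shows "(dirichlet_norm \<alpha> f)\<^sup>2 = (\<Sum>n. dirichlet_term \<alpha> f n)"
  using assms by (auto simp: dirichlet_norm_def dirichlet_space_def intro!: suminf_nonneg)

lemma dirichlet_norm_nonneg:
  assumes "f \<in> dirichlet_space \<alpha>"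
  shows "0 \<le> dirichlet_norm \<alpha> f"
  using assms by (auto simp: dirichlet_norm_def dirichlet_space_def intro!: suminf_nonneg)

lemma weighted_area_deriv_le_dirichlet_norm:
  assumes a: "0 < \<alpha>" "\<alpha> < 1"
  shows "\<exists>C>0. \<forall>f \<in> dirichlet_space \<alpha>. weighted_area \<alpha> (deriv f) \<le> ennreal (C * (dirichlet_norm \<alpha> f)\<^sup>2)"
proof -
  obtain C where C: "C > 0" "\<And>f n. pi * ((cmod (taylor_coeff (deriv f) n))\<^sup>2 * Beta (real n + 1) (\<alpha> + 1))
      \<le> C * dirichlet_term \<alpha> f (n + 1)"
    using dirichlet_term_deriv_comparison[OF a] by blast
  have "weighted_area \<alpha> (deriv f) \<le> ennreal (C * (dirichlet_norm \<alpha> f)\<^sup>2)" if f: "f \<in> dirichlet_space \<alpha>" for f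
  proof -
    have hol: "f holomorphic_on unit_disc" and sm: "summable (dirichlet_term \<alpha> f)"
      using f by (auto simp: dirichlet_space_def)
    have sm1: "summable (\<lambda>n. dirichlet_term \<alpha> f (n + 1))"
      using sm by (simp add: summable_Suc_iff)
    have "weighted_area \<alpha> (deriv f) =
       (\<Sum>n. ennreal (pi * ((cmod (taylor_coeff (deriv f) n))\<^sup>2 * Beta (real n + 1) (\<alpha> + 1))))"
      by (rule weighted_area_eq_suminf) (use hol a in \<open>auto intro: holomorphic_deriv\<close>)
    also have "\<dots> \<le> (\<Sum>n. ennreal (C * dirichlet_term \<alpha> f (n + 1)))"
      by (intro suminf_le ennreal_leI C(2)) auto
    also have "\<dots> = ennreal (C * (\<Sum>n. dirichlet_term \<alpha> f (n + 1)))"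
      using C(1) sm1 by (subst suminf_ennreal2) (auto simp: suminf_mult)
    also have "\<dots> \<le> ennreal (C * (dirichlet_norm \<alpha> f)\<^sup>2)"
      unfolding dirichlet_norm_sq[OF f] using suminf_split_head[OF sm] C(1)
      by (intro ennreal_leI mult_left_mono) auto
    finally show ?thesis .
  qed
  thus ?thesis using C(1) by blast
qed

lemma dirichlet_norm_le_weighted_area_deriv:
  assumes a: "0 < \<alpha>" "\<alpha> < 1"
  shows "\<exists>C>0. \<forall>f E. f holomorphic_on unit_disc \<longrightarrow> 0 \<le> E \<longrightarrow> weighted_area \<alpha> (deriv f) \<le> ennreal E \<longrightarrow>
     f \<in> dirichlet_space \<alpha> \<and> (dirichlet_norm \<alpha> f)\<^sup>2 \<le> (cmod (f 0))\<^sup>2 + C * E"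
proof -
  obtain C where C: "C > 0" "\<And>f n. dirichlet_term \<alpha> f (n + 1) \<le>
      C * (pi * ((cmod (taylor_coeff (deriv f) n))\<^sup>2 * Beta (real n + 1) (\<alpha> + 1)))"
    using dirichlet_term_deriv_comparison[OF a] by blast
  have "f \<in> dirichlet_space \<alpha> \<and> (dirichlet_norm \<alpha> f)\<^sup>2 \<le> (cmod (f 0))\<^sup>2 + C * E"
    if hol: "f holomorphic_on unit_disc" and E: "0 \<le> E" "weighted_area \<alpha> (deriv f) \<le> ennreal E" for f E
  proof -
    define u where "u = (\<lambda>n. pi * ((cmod (taylor_coeff (deriv f) n))\<^sup>2 * Beta (real n + 1) (\<alpha> + 1)))"
    have u0: "u n \<ge> 0" for n using a by (auto simp: u_def Beta_def intro!: mult_nonneg_nonneg divide_nonneg_nonneg)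
    have "weighted_area \<alpha> (deriv f) = (\<Sum>n. ennreal (u n))"
      unfolding u_def by (rule weighted_area_eq_suminf) (use hol a in \<open>auto intro: holomorphic_deriv\<close>)
    hence le: "(\<Sum>n. ennreal (u n)) \<le> ennreal E" using E by simp
    hence smu: "summable u" 
      using u0 by (intro summable_suminf_not_top) (auto simp: top_unique)
    have "ennreal (suminf u) \<le> ennreal E" using le suminf_ennreal2[OF u0 smu] by simp
    hence uE: "suminf u \<le> E" using E by simp
    have sm1: "summable (\<lambda>n. dirichlet_term \<alpha> f (n + 1))"
      by (rule summable_comparison_test'[OF summable_mult[OF smu, of C]]) (use C(2) in \<open>auto simp: u_def\<close>)
    hence sm: "summable (dirichlet_term \<alpha> f)" by (simp add: summable_Suc_iff)
    hence f: "f \<in> dirichlet_space \<alpha>" using hol by (simp add: dirichlet_space_def)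
    have "(\<Sum>n. dirichlet_term \<alpha> f (n + 1)) \<le> (\<Sum>n. C * u n)"
      by (rule suminf_le[OF _ sm1 summable_mult[OF smu]]) (use C(2) in \<open>auto simp: u_def\<close>)
    also have "\<dots> = C * suminf u" using smu by (rule suminf_mult)
    also have "\<dots> \<le> C * E" using uE C(1) by simp
    finally have "(\<Sum>n. dirichlet_term \<alpha> f (n + 1)) \<le> C * E" .
    moreover have "dirichlet_term \<alpha> f 0 = (cmod (f 0))\<^sup>2"
      by (simp add: dirichlet_term_def fps_expansion_def)
    ultimately have "(dirichlet_norm \<alpha> f)\<^sup>2 \<le> (cmod (f 0))\<^sup>2 + C * E"
      unfolding dirichlet_norm_sq[OF f] using suminf_split_head[OF sm] by simp
    thus ?thesis using f by blast
  qed
  thus ?thesis using C(1) by blast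
qed

text \<open>
  The bound makes \<open>|g'|\<^sup>2 (1 - |z|\<^sup>2)\<^sup>2\<close> bounded, hence integrable, so that
  \<open>\<Sum>n. (n + 1)\<^sup>2 |b\<^sub>n\<^sub>+\<^sub>1|\<^sup>2 B(n + 1, 3)\<close> converges, where \<open>b\<^sub>n\<close> are the Taylor coefficients of \<open>g\<close>. Since
  \<open>(n + 1)\<^sup>2 B(n + 1, 3)\<close> and \<open>B(n + 2, 1)\<close> are both of order \<open>1 / (n + 1)\<close>, this is the same as convergence of the
  series for the unweighted area integral of \<open>|g|\<^sup>2\<close>.
\<close>

lemma area_finite_of_deriv_bound:
  assumes hol: "g holomorphic_on unit_disc"
    and M: "\<And>z. z \<in> unit_disc \<Longrightarrow> cmod (deriv g z) * (1 - (cmod z)\<^sup>2) \<le> M"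
  shows "weighted_area 0 g < \<infinity>"
proof -
  have "weighted_area 2 (deriv g) \<le> (\<integral>\<^sup>+z\<in>unit_disc. ennreal (M\<^sup>2) \<partial>lborel)"
    unfolding weighted_area_def
  proof (intro nn_integral_mono)
    fix z :: complex
    show "ennreal ((cmod (deriv g z))\<^sup>2 * (1 - (cmod z)\<^sup>2) powr 2) * indicator unit_disc z \<le> ennreal (M\<^sup>2) * indicator unit_disc z"
    proof (cases "z \<in> unit_disc")
      case True
      hence p: "1 - (cmod z)\<^sup>2 > 0" by (simp add: abs_square_less_1)
      have "(cmod (deriv g z))\<^sup>2 * (1 - (cmod z)\<^sup>2) powr 2 = (cmod (deriv g z) * (1 - (cmod z)\<^sup>2))\<^sup>2"
        using p by (simp add: powr_numeral power_mult_distrib)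
      also have "\<dots> \<le> M\<^sup>2" using M[OF True] p by (intro power_mono) auto
      finally show ?thesis using True by (simp add: ennreal_leI)
    qed simp
  qed
  also have "\<dots> = ennreal (M\<^sup>2) * ennreal pi"
    by (simp add: nn_integral_cmult_indicator emeasure_ball unit_ball_vol_2)
  finally have fin2: "weighted_area 2 (deriv g) < \<infinity>"
    by (auto simp: ennreal_mult[symmetric] intro: le_less_trans)
  obtain C where C: "C > 0" "\<And>n. 1 \<le> C * (Beta (real n + 1) (2 + 1) * real (n + 1) powr (2 + 1))"
    using Beta_nat_asymptotics[of 2] by auto
  obtain K where K: "K > 0" "\<And>n. Beta (real n + 1) (0 + 1) * real (n + 1) powr (0 + 1) \<le> K"
    using Beta_nat_asymptotics[of 0] by auto
  define b where "b = (\<lambda>n. (cmod (taylor_coeff g n))\<^sup>2)"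
  define v where "v = (\<lambda>n. pi * ((cmod (taylor_coeff (deriv g) n))\<^sup>2 * Beta (real n + 1) (2 + 1)))"
  define u where "u = (\<lambda>n. pi * ((cmod (taylor_coeff g n))\<^sup>2 * Beta (real n + 1) (0 + 1)))"
  have v0: "v n \<ge> 0" for n by (auto simp: v_def Beta_def intro!: mult_nonneg_nonneg divide_nonneg_nonneg)
  have u0: "u n \<ge> 0" for n by (auto simp: u_def Beta_def intro!: mult_nonneg_nonneg divide_nonneg_nonneg)
  have "weighted_area 2 (deriv g) = (\<Sum>n. ennreal (v n))"
    unfolding v_def by (rule weighted_area_eq_suminf) (use hol in \<open>auto intro: holomorphic_deriv\<close>)
  hence smv: "summable v" using fin2 v0 by (intro summable_suminf_not_top) auto
  have uv: "u (n + 1) \<le> K * C * v n" for n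
  proof -
    define m where "m = real (n + 1)"
    have m: "m > 0" by (simp add: m_def)
    have B1: "Beta (real (n + 1) + 1) (0 + 1) \<le> K / m"
    proof -
      have B: "Beta (real (n + 1) + 1) (0 + 1) \<ge> 0" by (simp add: Beta_def)
      have "Beta (real (n + 1) + 1) (0 + 1) * m \<le> Beta (real (n + 1) + 1) (0 + 1) * (real (n + 1 + 1) powr (0 + 1))"
        by (intro mult_left_mono B) (simp add: m_def)
      also have "\<dots> \<le> K" by (rule K(2))
      finally show ?thesis using m by (simp add: field_simps)
    qed
    have B3: "1 / m ^ 3 \<le> C * Beta (real n + 1) (2 + 1)"
      using C(2)[of n] m unfolding m_def[symmetric] by (simp add: powr_numeral field_simps)
    have "u (n + 1) = pi * (b (n + 1) * Beta (real (n + 1) + 1) (0 + 1))"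
      by (simp add: u_def b_def)
    also have "\<dots> \<le> pi * (b (n + 1) * (K / m))"
      using B1 by (intro mult_left_mono) (auto simp: b_def)
    also have "\<dots> = pi * (K * (m\<^sup>2 * b (n + 1) * (1 / m ^ 3)))"
      using m by (simp add: field_simps power2_eq_square power3_eq_cube)
    also have "\<dots> \<le> pi * (K * (m\<^sup>2 * b (n + 1) * (C * Beta (real n + 1) (2 + 1))))"
      using B3 K(1) by (intro mult_left_mono) (auto simp: b_def)
    also have "\<dots> = K * C * v n"
    proof -
      have "(cmod (taylor_coeff (deriv g) n))\<^sup>2 = m\<^sup>2 * b (n + 1)"
        by (simp only: taylor_coeff_deriv norm_mult power_mult_distrib norm_of_nat b_def m_def)
      thus ?thesis by (simp add: v_def mult_ac)
    qed
    finally show ?thesis .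
  qed
  have "summable (\<lambda>n. u (n + 1))"
    by (rule summable_comparison_test'[OF summable_mult[OF smv, of "K * C"]]) (use uv u0 in auto)
  hence smu: "summable u" by (simp add: summable_Suc_iff)
  have "weighted_area 0 g = (\<Sum>n. ennreal (u n))"
    unfolding u_def by (rule weighted_area_eq_suminf) (use hol in auto)
  also have "\<dots> = ennreal (suminf u)" by (rule suminf_ennreal2[OF u0 smu])
  finally show ?thesis by simp
qed

section \<open>Point evaluations and normalised kernels\<close>

lemma cauchy_schwarz_suminf:
  fixes x y :: "nat \<Rightarrow> real"
  assumes x: "summable (\<lambda>n. (x n)\<^sup>2)" and y: "summable (\<lambda>n. (y n)\<^sup>2)"
  shows "summable (\<lambda>n. \<bar>x n * y n\<bar>)"
    and "(\<Sum>n. \<bar>x n * y n\<bar>)\<^sup>2 \<le> (\<Sum>n. (x n)\<^sup>2) * (\<Sum>n. (y n)\<^sup>2)"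
proof -
  show sm: "summable (\<lambda>n. \<bar>x n * y n\<bar>)"
  proof (rule summable_comparison_test'[OF summable_add[OF x y]])
    fix n show "norm \<bar>x n * y n\<bar> \<le> (x n)\<^sup>2 + (y n)\<^sup>2"
    proof -
      have "2 * \<bar>x n\<bar> * \<bar>y n\<bar> \<le> \<bar>x n\<bar>\<^sup>2 + \<bar>y n\<bar>\<^sup>2" by (rule sum_squares_bound)
      moreover have "0 \<le> \<bar>x n\<bar> * \<bar>y n\<bar>" by simp
      ultimately have "\<bar>x n\<bar> * \<bar>y n\<bar> \<le> (x n)\<^sup>2 + (y n)\<^sup>2" unfolding power2_abs by linarith
      thus ?thesis by (simp add: abs_mult)
    qed
  qed
  show "(\<Sum>n. \<bar>x n * y n\<bar>)\<^sup>2 \<le> (\<Sum>n. (x n)\<^sup>2) * (\<Sum>n. (y n)\<^sup>2)"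
  proof (rule LIMSEQ_le_const2)
    show "(\<lambda>N. (\<Sum>n<N. \<bar>x n * y n\<bar>)\<^sup>2) \<longlonglongrightarrow> (\<Sum>n. \<bar>x n * y n\<bar>)\<^sup>2"
      by (intro tendsto_intros summable_LIMSEQ sm)
    have "(\<Sum>n<N. \<bar>x n * y n\<bar>)\<^sup>2 \<le> (\<Sum>n. (x n)\<^sup>2) * (\<Sum>n. (y n)\<^sup>2)" for N
    proof -
      have "(\<Sum>n<N. \<bar>x n\<bar> * \<bar>y n\<bar>)\<^sup>2 \<le> (\<Sum>n<N. \<bar>x n\<bar>\<^sup>2) * (\<Sum>n<N. \<bar>y n\<bar>\<^sup>2)"
        by (rule Cauchy_Schwarz_ineq_sum)
      also have "\<dots> \<le> (\<Sum>n. (x n)\<^sup>2) * (\<Sum>n. (y n)\<^sup>2)"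
        by (intro mult_mono) (auto intro!: sum_le_suminf sum_nonneg suminf_nonneg x y)
      finally show ?thesis by (simp add: abs_mult)
    qed
    thus "\<exists>M. \<forall>N\<ge>M. (\<Sum>n<N. \<bar>x n * y n\<bar>)\<^sup>2 \<le> (\<Sum>n. (x n)\<^sup>2) * (\<Sum>n. (y n)\<^sup>2)" by blast
  qed
qed

lemma one_minus_norm_sq_pos: "z \<in> unit_disc \<Longrightarrow> 0 < 1 - (cmod z)\<^sup>2"
  by (simp add: abs_square_less_1)

lemma kernel_sum_summable:
  assumes "\<alpha> > 0" "z \<in> unit_disc"
  shows "summable (\<lambda>n. real (n + 1) powr (\<alpha> - 1) * ((cmod z)\<^sup>2) ^ n)"
  using kernel_sum_bounds[OF assms(1)] one_minus_norm_sq_pos[OF assms(2)] by auto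

lemma kernel_sum_pos:
  assumes "\<alpha> > 0" "z \<in> unit_disc"
  shows "kernel_sum \<alpha> ((cmod z)\<^sup>2) > 0"
proof -
  have "0 < real (0 + 1) powr (\<alpha> - 1) * ((cmod z)\<^sup>2) ^ 0" by simp
  thus ?thesis unfolding kernel_sum_def
    by (intro suminf_pos2[OF kernel_sum_summable[OF assms], of 0]) auto
qed

text \<open>
  Cauchy--Schwarz with the weights \<open>(n + 1)\<^bsup>(1-\<alpha>)/2\<^esup>\<close> and \<open>(n + 1)\<^bsup>(\<alpha>-1)/2\<^esup>\<close> on the tail of the Taylor
  series. For \<open>N = 0\<close> this bounds point evaluations; for large \<open>N\<close> the first factor is small, which gives the
  little-o growth.
\<close>

lemma dirichlet_taylor_remainder_bound:
  assumes a: "\<alpha> > 0" and f: "f \<in> dirichlet_space \<alpha>" and z: "z \<in> unit_disc"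
  shows "(cmod (f z - (\<Sum>n<N. taylor_coeff f n * z ^ n)))\<^sup>2
     \<le> (\<Sum>n. dirichlet_term \<alpha> f (n + N)) * kernel_sum \<alpha> ((cmod z)\<^sup>2)"
proof -
  have hol: "f holomorphic_on unit_disc" and sm: "summable (dirichlet_term \<alpha> f)"
    using f by (auto simp: dirichlet_space_def)
  define x where "x = (\<lambda>n. sqrt (dirichlet_term \<alpha> f (n + N)))"
  define y where "y = (\<lambda>n. real (n + N + 1) powr ((\<alpha> - 1) / 2) * cmod z ^ (n + N))"
  have x2: "(x n)\<^sup>2 = dirichlet_term \<alpha> f (n + N)" for n by (simp add: x_def)
  have y2: "(y n)\<^sup>2 = real (n + N + 1) powr (\<alpha> - 1) * ((cmod z)\<^sup>2) ^ (n + N)" for n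
  proof -
    have "(real (n + N + 1) powr ((\<alpha> - 1) / 2))\<^sup>2 = real (n + N + 1) powr (\<alpha> - 1)"
      by (simp add: power2_eq_square flip: powr_add)
    thus ?thesis by (simp add: y_def power_mult_distrib power_mult[symmetric] mult.commute)
  qed
  have xy: "\<bar>x n * y n\<bar> = cmod (taylor_coeff f (n + N) * z ^ (n + N))" for n
  proof -
    have "x n = real (n + N + 1) powr ((1 - \<alpha>) / 2) * cmod (taylor_coeff f (n + N))"
    proof -
      have "sqrt (real (n + N + 1) powr (1 - \<alpha>)) = real (n + N + 1) powr ((1 - \<alpha>) / 2)"
        by (simp add: powr_half_sqrt[symmetric] powr_powr)
      thus ?thesis by (simp add: x_def dirichlet_term_def real_sqrt_mult)
    qed
    moreover have "real (n + N + 1) powr ((1 - \<alpha>) / 2) * real (n + N + 1) powr ((\<alpha> - 1) / 2) = 1"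
      by (simp flip: powr_add add: field_simps)
    ultimately have "x n * y n = cmod (taylor_coeff f (n + N)) * cmod z ^ (n + N)"
      by (simp add: y_def mult_ac)
    thus ?thesis by (simp add: norm_mult norm_power)
  qed
  have ks: "summable (\<lambda>n. real (n + 1) powr (\<alpha> - 1) * ((cmod z)\<^sup>2) ^ n)"
    by (rule kernel_sum_summable[OF a z])
  have sx: "summable (\<lambda>n. (x n)\<^sup>2)" unfolding x2 using sm by (simp add: summable_iff_shift)
  have sy: "summable (\<lambda>n. (y n)\<^sup>2)" unfolding y2
    using summable_ignore_initial_segment[OF ks, of N] by simp
  have "cmod (f z - (\<Sum>n<N. taylor_coeff f n * z ^ n)) = cmod (\<Sum>n. taylor_coeff f (n + N) * z ^ (n + N))"
    using suminf_minus_initial_segment[OF sums_summable[OF disc_power_series(1)[OF hol z]], of N]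
      disc_power_series(1)[OF hol z] by (simp add: sums_iff)
  also have "\<dots> \<le> (\<Sum>n. \<bar>x n * y n\<bar>)"
    using cauchy_schwarz_suminf(1)[OF sx sy] unfolding xy by (rule summable_norm)
  finally have "(cmod (f z - (\<Sum>n<N. taylor_coeff f n * z ^ n)))\<^sup>2 \<le> (\<Sum>n. \<bar>x n * y n\<bar>)\<^sup>2"
    by (intro power_mono) auto
  also have "\<dots> \<le> (\<Sum>n. (x n)\<^sup>2) * (\<Sum>n. (y n)\<^sup>2)" by (rule cauchy_schwarz_suminf(2)[OF sx sy])
  also have "\<dots> \<le> (\<Sum>n. (x n)\<^sup>2) * kernel_sum \<alpha> ((cmod z)\<^sup>2)"
  proof (intro mult_left_mono)
    have "(\<Sum>n. real (n + 1) powr (\<alpha> - 1) * ((cmod z)\<^sup>2) ^ n) = 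
       (\<Sum>n. real (n + N + 1) powr (\<alpha> - 1) * ((cmod z)\<^sup>2) ^ (n + N)) + 
       (\<Sum>n<N. real (n + 1) powr (\<alpha> - 1) * ((cmod z)\<^sup>2) ^ n)"
      by (rule suminf_split_initial_segment[OF ks])
    thus "(\<Sum>n. (y n)\<^sup>2) \<le> kernel_sum \<alpha> ((cmod z)\<^sup>2)"
      unfolding y2 kernel_sum_def by (simp add: sum_nonneg)
  qed (auto intro!: suminf_nonneg sx)
  finally show ?thesis by (simp add: x2)
qed

lemma dirichlet_point_evaluation:
  assumes a: "\<alpha> > 0" and f: "f \<in> dirichlet_space \<alpha>" and z: "z \<in> unit_disc"
  shows "(cmod (f z))\<^sup>2 \<le> (dirichlet_norm \<alpha> f)\<^sup>2 * kernel_sum \<alpha> ((cmod z)\<^sup>2)"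
  using dirichlet_taylor_remainder_bound[OF assms, of 0] by (simp add: dirichlet_norm_sq[OF f])

text \<open>
  Split \<open>g\<close> into a Taylor polynomial and a remainder of small norm: the polynomial is bounded on the disc and
  killed by the weight, and the remainder has size at most a small multiple of \<open>(1 - |z|\<^sup>2)\<^bsup>-\<alpha>/2\<^esup>\<close>.
\<close>

lemma dirichlet_growth_little_o:
  assumes a: "\<alpha> > 0" and g: "g \<in> dirichlet_space \<alpha>" and e: "\<epsilon> > 0"
  shows "\<exists>r<1. \<forall>z. r < cmod z \<and> cmod z < 1 \<longrightarrow> (cmod (g z))\<^sup>2 * (1 - (cmod z)\<^sup>2) powr \<alpha> < \<epsilon>"
proof -
  have sm: "summable (dirichlet_term \<alpha> g)" using g by (auto simp: dirichlet_space_def)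
  obtain C where C: "C > 0" "\<And>x. 0 \<le> x \<Longrightarrow> x < 1 \<Longrightarrow> kernel_sum \<alpha> x \<le> C * (1 - x) powr (-\<alpha>)"
    using kernel_sum_bounds[OF a] by blast
  define \<delta> where "\<delta> = \<epsilon> / (8 * C)"
  have d: "\<delta> > 0" using e C by (simp add: \<delta>_def)
  have "(\<lambda>N. \<Sum>n. dirichlet_term \<alpha> g (n + N)) \<longlonglongrightarrow> 0"
    by (rule suminf_exist_split2[OF sm])
  hence "eventually (\<lambda>N. (\<Sum>n. dirichlet_term \<alpha> g (n + N)) < \<delta>) sequentially"
    using d by (rule order_tendstoD)
  then obtain N where N: "(\<Sum>n. dirichlet_term \<alpha> g (n + N)) < \<delta>"
    by (auto simp: eventually_sequentially)
  define P where "P = (\<Sum>n<N. cmod (taylor_coeff g n))"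
  have "((\<lambda>x. 2 * P\<^sup>2 * (1 - x\<^sup>2) powr \<alpha>) \<longlongrightarrow> 2 * P\<^sup>2 * (1 - 1\<^sup>2) powr \<alpha>) (at_left 1)"
  proof (intro tendsto_intros tendsto_powr')
    have "eventually (\<lambda>x::real. x \<in> {0<..<1}) (at_left 1)" by (rule eventually_at_left_real) simp
    thus "1 - 1\<^sup>2 \<noteq> (0::real) \<or> 0 < \<alpha> \<and> (\<forall>\<^sub>F x::real in at_left 1. 0 \<le> 1 - x\<^sup>2)"
      using a by (auto simp: abs_square_le_1 elim!: eventually_mono)
  qed
  hence "eventually (\<lambda>x. 2 * P\<^sup>2 * (1 - x\<^sup>2) powr \<alpha> < \<epsilon> / 2) (at_left (1::real))"
    using e a by (intro order_tendstoD(2)) auto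
  then obtain r where r: "r < 1" "\<And>x. r < x \<Longrightarrow> x < 1 \<Longrightarrow> 2 * P\<^sup>2 * (1 - x\<^sup>2) powr \<alpha> < \<epsilon> / 2"
    unfolding eventually_at_left[OF zero_less_one] by blast
  show ?thesis
  proof (intro exI[of _ r] conjI allI impI r(1); elim conjE)
    fix z assume rz: "r < cmod z" "cmod z < 1"
    hence z: "z \<in> unit_disc" by simp
    define t where "t = 1 - (cmod z)\<^sup>2"
    have t: "t > 0" using one_minus_norm_sq_pos[OF z] by (simp add: t_def)
    define p where "p = (\<Sum>n<N. taylor_coeff g n * z ^ n)"
    have "cmod p \<le> P" unfolding p_def P_def
    proof (rule order_trans[OF norm_sum sum_mono])
      fix n show "cmod (taylor_coeff g n * z ^ n) \<le> cmod (taylor_coeff g n)"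
        using rz by (simp add: norm_mult norm_power mult_left_le power_le_one)
    qed
    hence p2: "(cmod p)\<^sup>2 \<le> P\<^sup>2" by (intro power_mono) auto
    have "(cmod (g z - p))\<^sup>2 \<le> (\<Sum>n. dirichlet_term \<alpha> g (n + N)) * kernel_sum \<alpha> ((cmod z)\<^sup>2)"
      unfolding p_def by (rule dirichlet_taylor_remainder_bound[OF a g z])
    also have "\<dots> \<le> \<delta> * (C * t powr (-\<alpha>))"
      using N C(2)[of "(cmod z)\<^sup>2"] kernel_sum_pos[OF a z] t d by (intro mult_mono) (auto simp: t_def)
    finally have q2: "(cmod (g z - p))\<^sup>2 * t powr \<alpha> \<le> \<epsilon> / 8"
    proof -
      assume "(cmod (g z - p))\<^sup>2 \<le> \<delta> * (C * t powr (-\<alpha>))"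
      hence "(cmod (g z - p))\<^sup>2 * t powr \<alpha> \<le> \<delta> * (C * t powr (-\<alpha>)) * t powr \<alpha>"
        by (intro mult_right_mono) auto
      also have "\<dots> = \<delta> * C * (t powr (-\<alpha>) * t powr \<alpha>)" by (simp only: mult_ac)
      also have "\<dots> = \<epsilon> / 8" using t C(1) by (simp add: \<delta>_def flip: powr_add)
      finally show ?thesis .
    qed
    have "(cmod (g z))\<^sup>2 \<le> 2 * (cmod p)\<^sup>2 + 2 * (cmod (g z - p))\<^sup>2"
    proof -
      have "cmod (g z) \<le> cmod p + cmod (g z - p)" using norm_triangle_ineq[of p "g z - p"] by simp
      hence "(cmod (g z))\<^sup>2 \<le> (cmod p + cmod (g z - p))\<^sup>2" by (intro power_mono) auto
      also have "\<dots> \<le> 2 * (cmod p)\<^sup>2 + 2 * (cmod (g z - p))\<^sup>2"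
        using sum_squares_bound[of "cmod p" "cmod (g z - p)"] by (simp add: power2_sum)
      finally show ?thesis .
    qed
    hence "(cmod (g z))\<^sup>2 * t powr \<alpha> \<le> (2 * (cmod p)\<^sup>2 + 2 * (cmod (g z - p))\<^sup>2) * t powr \<alpha>"
      by (intro mult_right_mono) auto
    also have "\<dots> = 2 * (cmod p)\<^sup>2 * t powr \<alpha> + 2 * ((cmod (g z - p))\<^sup>2 * t powr \<alpha>)"
      by (simp add: algebra_simps)
    also have "\<dots> \<le> 2 * P\<^sup>2 * t powr \<alpha> + 2 * (\<epsilon> / 8)"
      using p2 q2 by (intro add_mono mult_left_mono mult_right_mono) auto
    also have "\<dots> < \<epsilon>" using r(2)[OF rz] e by (simp add: t_def)
    finally show "(cmod (g z))\<^sup>2 * (1 - (cmod z)\<^sup>2) powr \<alpha> < \<epsilon>" by (simp add: t_def)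
  qed
qed

lemma dirichlet_space_diff:
  assumes f: "f \<in> dirichlet_space \<alpha>" and g: "g \<in> dirichlet_space \<alpha>"
  shows "(\<lambda>z. f z - g z) \<in> dirichlet_space \<alpha>"
    and "(dirichlet_norm \<alpha> (\<lambda>z. f z - g z))\<^sup>2 \<le> 2 * (dirichlet_norm \<alpha> f)\<^sup>2 + 2 * (dirichlet_norm \<alpha> g)\<^sup>2"
proof -
  have hf: "f holomorphic_on unit_disc" "summable (dirichlet_term \<alpha> f)"
    and hg: "g holomorphic_on unit_disc" "summable (dirichlet_term \<alpha> g)"
    using f g by (auto simp: dirichlet_space_def)
  have le: "dirichlet_term \<alpha> (\<lambda>z. f z - g z) n \<le> 2 * dirichlet_term \<alpha> f n + 2 * dirichlet_term \<alpha> g n" for n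
  proof -
    have eq: "taylor_coeff (\<lambda>z. f z - g z) n = taylor_coeff f n - taylor_coeff g n"
      using higher_deriv_diff[OF hf(1) hg(1), of 0 n] by (simp add: fps_expansion_def diff_divide_distrib)
    have "(cmod (taylor_coeff f n - taylor_coeff g n))\<^sup>2 \<le> (cmod (taylor_coeff f n) + cmod (taylor_coeff g n))\<^sup>2"
      by (intro power_mono norm_triangle_ineq4) auto
    also have "\<dots> \<le> 2 * (cmod (taylor_coeff f n))\<^sup>2 + 2 * (cmod (taylor_coeff g n))\<^sup>2"
      using sum_squares_bound[of "cmod (taylor_coeff f n)" "cmod (taylor_coeff g n)"] by (simp add: power2_sum)
    finally have "real (n + 1) powr (1 - \<alpha>) * (cmod (taylor_coeff f n - taylor_coeff g n))\<^sup>2 \<le>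
       real (n + 1) powr (1 - \<alpha>) * (2 * (cmod (taylor_coeff f n))\<^sup>2 + 2 * (cmod (taylor_coeff g n))\<^sup>2)"
      by (intro mult_left_mono) auto
    thus ?thesis unfolding dirichlet_term_def eq by (simp add: algebra_simps)
  qed
  have smr: "summable (\<lambda>n. 2 * dirichlet_term \<alpha> f n + 2 * dirichlet_term \<alpha> g n)"
    by (intro summable_add summable_mult hf hg)
  have sm: "summable (dirichlet_term \<alpha> (\<lambda>z. f z - g z))"
    by (rule summable_comparison_test'[OF smr]) (use le in auto)
  show mem: "(\<lambda>z. f z - g z) \<in> dirichlet_space \<alpha>"
    using sm hf hg by (auto simp: dirichlet_space_def intro!: holomorphic_intros)
  have "suminf (dirichlet_term \<alpha> (\<lambda>z. f z - g z)) \<le> (\<Sum>n. 2 * dirichlet_term \<alpha> f n + 2 * dirichlet_term \<alpha> g n)"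
    by (rule suminf_le[OF le sm smr])
  also have "\<dots> = 2 * suminf (dirichlet_term \<alpha> f) + 2 * suminf (dirichlet_term \<alpha> g)"
    using hf hg by (subst suminf_add[symmetric]) (auto intro: summable_mult simp: suminf_mult)
  finally show "(dirichlet_norm \<alpha> (\<lambda>z. f z - g z))\<^sup>2 \<le> 2 * (dirichlet_norm \<alpha> f)\<^sup>2 + 2 * (dirichlet_norm \<alpha> g)\<^sup>2"
    using dirichlet_norm_sq[OF mem] dirichlet_norm_sq[OF f] dirichlet_norm_sq[OF g] by simp
qed

text \<open>
  The reproducing kernel of \<open>D\<^sub>\<alpha>\<close> at \<open>w\<close>, divided by its norm.
\<close>

definition kernel_fun :: "real \<Rightarrow> complex \<Rightarrow> complex \<Rightarrow> complex" where
  "kernel_fun \<alpha> w = eval_fps (Abs_fps (\<lambda>n. of_real (real (n + 1) powr (\<alpha> - 1) / sqrt (kernel_sum \<alpha> ((cmod w)\<^sup>2))) * cnj w ^ n))"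

lemma kernel_fun:
  assumes a: "0 < \<alpha>" "\<alpha> < 1" and w: "w \<in> unit_disc"
  shows "kernel_fun \<alpha> w \<in> dirichlet_space \<alpha>"
    and "dirichlet_norm \<alpha> (kernel_fun \<alpha> w) = 1"
    and "kernel_fun \<alpha> w w = of_real (sqrt (kernel_sum \<alpha> ((cmod w)\<^sup>2)))"
proof -
  define k where "k = kernel_sum \<alpha> ((cmod w)\<^sup>2)"
  define F where "F = Abs_fps (\<lambda>n. of_real (real (n + 1) powr (\<alpha> - 1) / sqrt k) * cnj w ^ n)"
  have k: "k > 0" unfolding k_def by (rule kernel_sum_pos[OF a(1) w])
  have ks: "(\<lambda>n. real (n + 1) powr (\<alpha> - 1) * ((cmod w)\<^sup>2) ^ n) sums k"
    unfolding k_def kernel_sum_def using kernel_sum_summable[OF a(1) w] by (rule summable_sums)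
  have K: "kernel_fun \<alpha> w = eval_fps F" by (simp add: kernel_fun_def F_def k_def)
  have rad: "fps_conv_radius F \<ge> 1"
    unfolding fps_conv_radius_def
  proof (rule conv_radius_geI_ex')
    fix r :: real assume r: "0 < r" "ereal r < 1"
    have r1: "r < 1" using r by (simp add: one_ereal_def)
    show "summable (\<lambda>n. fps_nth F n * of_real r ^ n)"
    proof (rule summable_comparison_test')
      show "summable (\<lambda>n. r ^ n / sqrt k)" using r r1 by (intro summable_divide summable_geometric) auto
      fix n
      have "real (n + 1) powr (\<alpha> - 1) \<le> real (n + 1) powr 0" using a by (intro powr_mono) auto
      hence "real (n + 1) powr (\<alpha> - 1) \<le> 1" by simp
      moreover have "cmod w ^ n \<le> 1" using w by (intro power_le_one) auto
      ultimately have "real (n + 1) powr (\<alpha> - 1) * cmod w ^ n \<le> 1" by (intro mult_le_one) auto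
      hence "(real (n + 1) powr (\<alpha> - 1) * cmod w ^ n) * (r ^ n / sqrt k) \<le> 1 * (r ^ n / sqrt k)"
        using r k by (intro mult_right_mono) auto
      thus "norm (fps_nth F n * of_real r ^ n) \<le> r ^ n / sqrt k"
        using r k by (simp add: F_def norm_mult norm_power norm_divide mult_ac)
    qed
  qed
  have hol: "kernel_fun \<alpha> w holomorphic_on unit_disc"
    unfolding K
  proof (intro holomorphic_on_eval_fps subsetI)
    fix x :: complex assume "x \<in> unit_disc"
    hence "ereal (cmod x) < 1" by (simp add: one_ereal_def)
    thus "x \<in> eball 0 (fps_conv_radius F)" using less_le_trans[OF _ rad] by (simp add: in_eball_iff)
  qed
  have "fps_expansion (kernel_fun \<alpha> w) 0 = F"
    unfolding K by (intro fps_expansion_eqI eval_fps_has_fps_expansion) (rule less_le_trans[OF _ rad], simp)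
  hence coeff: "taylor_coeff (kernel_fun \<alpha> w) n = of_real (real (n + 1) powr (\<alpha> - 1) / sqrt k) * cnj w ^ n" for n
    by (simp add: F_def)
  have dt: "dirichlet_term \<alpha> (kernel_fun \<alpha> w) n = real (n + 1) powr (\<alpha> - 1) * ((cmod w)\<^sup>2) ^ n / k" for n
  proof -
    have "real (n + 1) powr (1 - \<alpha>) * (real (n + 1) powr (\<alpha> - 1))\<^sup>2 = real (n + 1) powr (\<alpha> - 1)"
      by (simp add: power2_eq_square flip: powr_add)
    moreover have "(cmod (taylor_coeff (kernel_fun \<alpha> w) n))\<^sup>2 = (real (n + 1) powr (\<alpha> - 1))\<^sup>2 * ((cmod w)\<^sup>2) ^ n / k"
      unfolding coeff using k
      by (simp add: norm_mult norm_power norm_divide power_divide power_mult_distrib power_mult[symmetric] mult.commute del: of_nat_add)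
    ultimately show ?thesis by (simp add: dirichlet_term_def)
  qed
  have "(\<lambda>n. dirichlet_term \<alpha> (kernel_fun \<alpha> w) n) sums (k / k)"
    unfolding dt by (rule sums_divide[OF ks])
  hence s1: "dirichlet_term \<alpha> (kernel_fun \<alpha> w) sums 1" using k by simp
  show "kernel_fun \<alpha> w \<in> dirichlet_space \<alpha>"
    using hol s1 by (auto simp: dirichlet_space_def sums_iff)
  show "dirichlet_norm \<alpha> (kernel_fun \<alpha> w) = 1"
    using s1 by (simp add: dirichlet_norm_def sums_iff)
  have "(\<lambda>n. complex_of_real (real (n + 1) powr (\<alpha> - 1) * ((cmod w)\<^sup>2) ^ n / sqrt k)) sums complex_of_real (k / sqrt k)"
    by (intro sums_of_real sums_divide ks)
  moreover have "complex_of_real (real (n + 1) powr (\<alpha> - 1) * ((cmod w)\<^sup>2) ^ n / sqrt k) = fps_nth F n * w ^ n" for n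
  proof -
    have "complex_of_real (((cmod w)\<^sup>2) ^ n) = cnj w ^ n * w ^ n"
      by (subst of_real_power, subst complex_norm_square) (simp add: power_mult_distrib mult.commute)
    thus ?thesis by (simp add: F_def)
  qed
  ultimately have "kernel_fun \<alpha> w w = complex_of_real (k / sqrt k)"
    by (simp add: K eval_fps_def sums_iff)
  also have "k / sqrt k = sqrt k" using k by (simp add: real_div_sqrt)
  finally show "kernel_fun \<alpha> w w = of_real (sqrt (kernel_sum \<alpha> ((cmod w)\<^sup>2)))" by (simp add: k_def)
qed

text \<open>
  The Moebius map \<open>m\<close> that sends \<open>a = \<phi>(0)\<close> to 0 makes Schwarz's lemma applicable to \<open>m \<circ> \<phi>\<close>, and
  \<open>1 - |m(b)|\<^sup>2 = (1 - |a|\<^sup>2) (1 - |b|\<^sup>2) / |1 - cnj a b|\<^sup>2\<close> converts the result to a bound for \<open>\<phi>\<close>.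
\<close>

lemma schwarz_pick_boundary_distance:
  assumes hol: "\<phi> holomorphic_on unit_disc" and self: "\<phi> ` unit_disc \<subseteq> unit_disc"
  shows "\<exists>K>0. \<forall>z\<in>unit_disc. 1 - (cmod z)\<^sup>2 \<le> K * (1 - (cmod (\<phi> z))\<^sup>2)"
proof -
  define a where "a = \<phi> 0"
  have a: "cmod a < 1" using self by (auto simp: a_def image_subset_iff)
  define g where "g = Moebius_function 0 a \<circ> \<phi>"
  have ghol: "g holomorphic_on ball 0 1" unfolding g_def
    by (rule holomorphic_on_compose_gen[OF hol Moebius_function_holomorphic[OF a] self])
  have g0: "g 0 = 0" by (simp add: g_def a_def Moebius_function_eq_zero)
  have g1: "cmod (g z) < 1" if "cmod z < 1" for z
    using that self by (auto simp: g_def image_subset_iff intro!: Moebius_function_norm_lt_1 a)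
  define K where "K = (1 - (cmod a)\<^sup>2) / (1 - cmod a)\<^sup>2"
  have a2: "1 - (cmod a)\<^sup>2 > 0" using a by (simp add: abs_square_less_1)
  have K: "K > 0" using a a2 by (simp add: K_def)
  show ?thesis
  proof (intro exI[of _ K] conjI K ballI)
    fix z :: complex assume z: "z \<in> unit_disc"
    define b where "b = \<phi> z"
    have b: "cmod b < 1" using z self by (auto simp: b_def image_subset_iff)
    have b2: "1 - (cmod b)\<^sup>2 > 0" using b by (simp add: abs_square_less_1)
    have "cmod (g z) \<le> cmod z" using Schwarz_Lemma(1)[OF ghol g0 g1] z by simp
    hence "1 - (cmod z)\<^sup>2 \<le> 1 - (cmod (g z))\<^sup>2" by (simp add: power_mono)
    have id: "(cmod (1 - cnj a * b))\<^sup>2 - (cmod (b - a))\<^sup>2 = (1 - (cmod a)\<^sup>2) * (1 - (cmod b)\<^sup>2)"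
      by (simp add: cmod_power2) (simp add: power2_eq_square algebra_simps)
    have low: "1 - cmod a \<le> cmod (1 - cnj a * b)"
    proof -
      have "cmod (cnj a * b) \<le> cmod a" using b by (simp add: norm_mult mult_left_le)
      thus ?thesis using norm_triangle_ineq2[of 1 "cnj a * b"] by simp
    qed
    have nz: "cmod (1 - cnj a * b) > 0" by (rule less_le_trans[OF _ low]) (use a in simp)
    have "g z = (b - a) / (1 - cnj a * b)" by (simp add: g_def Moebius_function_simple b_def)
    hence "(cmod (g z))\<^sup>2 = (cmod (b - a))\<^sup>2 / (cmod (1 - cnj a * b))\<^sup>2"
      by (simp add: norm_divide power_divide)
    hence "1 - (cmod (g z))\<^sup>2 = (1 - (cmod a)\<^sup>2) * (1 - (cmod b)\<^sup>2) / (cmod (1 - cnj a * b))\<^sup>2"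
      using nz unfolding id[symmetric] by (simp add: diff_divide_distrib)
    also have "\<dots> \<le> (1 - (cmod a)\<^sup>2) * (1 - (cmod b)\<^sup>2) / (1 - cmod a)\<^sup>2"
      using low a a2 b2 nz by (intro divide_left_mono power_mono) auto
    finally show "1 - (cmod z)\<^sup>2 \<le> K * (1 - (cmod (\<phi> z))\<^sup>2)"
      using order_trans[OF \<open>1 - (cmod z)\<^sup>2 \<le> 1 - (cmod (g z))\<^sup>2\<close>] by (simp add: K_def b_def)
  qed
qed

section \<open>Necessity of the boundary conditions\<close>

definition boundary_ratio :: "real \<Rightarrow> (complex \<Rightarrow> complex) \<Rightarrow> (complex \<Rightarrow> complex) \<Rightarrow> complex \<Rightarrow> real" where
  "boundary_ratio \<alpha> \<psi> \<phi> z = cmod (\<psi> z) * ((1 - (cmod z)\<^sup>2) / (1 - (cmod (\<phi> z))\<^sup>2)) powr (\<alpha> / 2)"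

text \<open>
  Energies and growth bounds involve squared moduli, so \<open>q\<^sup>2\<close> is what enters the estimates: it trades the
  weight at \<open>z\<close> for the weight at \<open>\<phi>(z)\<close>.
\<close>

lemma boundary_ratio_sq:
  assumes "z \<in> unit_disc" "\<phi> z \<in> unit_disc"
  shows "(boundary_ratio \<alpha> \<psi> \<phi> z)\<^sup>2 * (1 - (cmod (\<phi> z))\<^sup>2) powr \<alpha> = (cmod (\<psi> z))\<^sup>2 * (1 - (cmod z)\<^sup>2) powr \<alpha>"
proof -
  define s t where "s = 1 - (cmod z)\<^sup>2" and "t = 1 - (cmod (\<phi> z))\<^sup>2"
  have st: "s > 0" "t > 0" using assms one_minus_norm_sq_pos by (auto simp: s_def t_def)
  have "((s / t) powr (\<alpha> / 2))\<^sup>2 = (s / t) powr \<alpha>"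
    by (simp add: power2_eq_square flip: powr_add)
  also have "\<dots> * t powr \<alpha> = s powr \<alpha>" using st by (simp add: powr_divide)
  finally show ?thesis
    by (simp add: boundary_ratio_def power_mult_distrib flip: s_def t_def)
qed

lemma eventually_going_to_unit_circle:
  "eventually P (cmod going_to at_left 1) \<longleftrightarrow> (\<exists>r<1. \<forall>z. r < cmod z \<and> cmod z < 1 \<longrightarrow> P z)"
proof
  assume "eventually P (cmod going_to at_left 1)"
  then obtain Q where Q: "eventually Q (at_left (1::real))" "\<And>z. Q (cmod z) \<Longrightarrow> P z"
    by (auto simp: going_to_within_def eventually_filtercomap)
  from Q(1) obtain r where "r < 1" "\<And>x. r < x \<Longrightarrow> x < 1 \<Longrightarrow> Q x"
    unfolding eventually_at_left[OF zero_less_one] by blast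
  thus "\<exists>r<1. \<forall>z. r < cmod z \<and> cmod z < 1 \<longrightarrow> P z" using Q(2) by blast
next
  assume "\<exists>r<1. \<forall>z. r < cmod z \<and> cmod z < 1 \<longrightarrow> P z"
  then obtain r where r: "r < 1" "\<And>z. r < cmod z \<Longrightarrow> cmod z < 1 \<Longrightarrow> P z" by blast
  have "eventually (\<lambda>x. r < x \<and> x < 1) (at_left 1)"
    unfolding eventually_at_left[OF zero_less_one] using r(1) by blast
  thus "eventually P (cmod going_to at_left 1)"
    unfolding going_to_within_def using r(2) by (auto simp: eventually_filtercomap)
qed

text \<open>
  The normalised kernel at \<open>\<phi>(z)\<close> takes at \<open>\<phi>(z)\<close> the value \<open>kernel_sum \<alpha> (|\<phi>(z)|\<^sup>2)\<^bsup>1/2\<^esup>\<close>, which is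
  at least a constant times \<open>(1 - |\<phi>(z)|\<^sup>2)\<^bsup>-\<alpha>/2\<^esup>\<close>.
\<close>

lemma boundary_ratio_le_kernel_image:
  assumes a: "0 < \<alpha>" "\<alpha> < 1" and self: "\<phi> ` unit_disc \<subseteq> unit_disc"
  shows "\<exists>C>0. \<forall>z\<in>unit_disc. (boundary_ratio \<alpha> \<psi> \<phi> z)\<^sup>2 \<le>
     C * ((cmod (weighted_comp_op \<psi> \<phi> (kernel_fun \<alpha> (\<phi> z)) z))\<^sup>2 * (1 - (cmod z)\<^sup>2) powr \<alpha>)"
proof -
  obtain C where C: "C > 0" "\<And>x. 0 \<le> x \<Longrightarrow> x < 1 \<Longrightarrow> (1 - x) powr (-\<alpha>) \<le> C * kernel_sum \<alpha> x"
    using kernel_sum_bounds[OF a(1)] by blast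
  show ?thesis
  proof (intro exI[of _ C] conjI C(1) ballI)
    fix z :: complex assume z: "z \<in> unit_disc"
    have w: "\<phi> z \<in> unit_disc" using self z by blast
    define t where "t = 1 - (cmod (\<phi> z))\<^sup>2"
    have t: "t > 0" using one_minus_norm_sq_pos[OF w] by (simp add: t_def)
    have val: "(cmod (weighted_comp_op \<psi> \<phi> (kernel_fun \<alpha> (\<phi> z)) z))\<^sup>2 = (cmod (\<psi> z))\<^sup>2 * kernel_sum \<alpha> ((cmod (\<phi> z))\<^sup>2)"
      using kernel_sum_pos[OF a(1) w]
      by (simp add: weighted_comp_op_def kernel_fun(3)[OF a w] norm_mult power_mult_distrib)
    have "(boundary_ratio \<alpha> \<psi> \<phi> z)\<^sup>2 = (boundary_ratio \<alpha> \<psi> \<phi> z)\<^sup>2 * t powr \<alpha> * t powr (-\<alpha>)"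
      using t by (simp add: mult.assoc flip: powr_add)
    also have "\<dots> = (cmod (\<psi> z))\<^sup>2 * (1 - (cmod z)\<^sup>2) powr \<alpha> * t powr (-\<alpha>)"
      unfolding t_def boundary_ratio_sq[of z \<phi>, OF z w] ..
    also have "\<dots> \<le> (cmod (\<psi> z))\<^sup>2 * (1 - (cmod z)\<^sup>2) powr \<alpha> * (C * kernel_sum \<alpha> ((cmod (\<phi> z))\<^sup>2))"
      using C(2)[of "(cmod (\<phi> z))\<^sup>2"] t by (intro mult_left_mono) (auto simp: t_def)
    also have "\<dots> = C * ((cmod (weighted_comp_op \<psi> \<phi> (kernel_fun \<alpha> (\<phi> z)) z))\<^sup>2 * (1 - (cmod z)\<^sup>2) powr \<alpha>)"
      unfolding val by (simp only: mult_ac)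
    finally show "(boundary_ratio \<alpha> \<psi> \<phi> z)\<^sup>2 \<le> \<dots>" .
  qed
qed

lemma dirichlet_growth:
  assumes a: "\<alpha> > 0"
  shows "\<exists>C>0. \<forall>f\<in>dirichlet_space \<alpha>. \<forall>z\<in>unit_disc.
     (cmod (f z))\<^sup>2 * (1 - (cmod z)\<^sup>2) powr \<alpha> \<le> C * (dirichlet_norm \<alpha> f)\<^sup>2"
proof -
  obtain C where C: "C > 0" "\<And>x. 0 \<le> x \<Longrightarrow> x < 1 \<Longrightarrow> kernel_sum \<alpha> x \<le> C * (1 - x) powr (-\<alpha>)"
    using kernel_sum_bounds[OF a] by blast
  have "(cmod (f z))\<^sup>2 * (1 - (cmod z)\<^sup>2) powr \<alpha> \<le> C * (dirichlet_norm \<alpha> f)\<^sup>2"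
    if f: "f \<in> dirichlet_space \<alpha>" and z: "z \<in> unit_disc" for f z
  proof -
    define t where "t = 1 - (cmod z)\<^sup>2"
    have t: "t > 0" using one_minus_norm_sq_pos[OF z] by (simp add: t_def)
    have "(cmod (f z))\<^sup>2 \<le> (dirichlet_norm \<alpha> f)\<^sup>2 * kernel_sum \<alpha> ((cmod z)\<^sup>2)"
      by (rule dirichlet_point_evaluation[OF a f z])
    also have "\<dots> \<le> (dirichlet_norm \<alpha> f)\<^sup>2 * (C * t powr (-\<alpha>))"
      using C(2)[of "(cmod z)\<^sup>2"] t by (intro mult_left_mono) (auto simp: t_def)
    finally have "(cmod (f z))\<^sup>2 * t powr \<alpha> \<le> (dirichlet_norm \<alpha> f)\<^sup>2 * (C * t powr (-\<alpha>)) * t powr \<alpha>"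
      by (intro mult_right_mono) auto
    also have "\<dots> = C * (dirichlet_norm \<alpha> f)\<^sup>2 * (t powr (-\<alpha>) * t powr \<alpha>)" by (simp only: mult_ac)
    also have "\<dots> = C * (dirichlet_norm \<alpha> f)\<^sup>2" using t by (simp flip: powr_add)
    finally show ?thesis by (simp add: t_def)
  qed
  thus ?thesis using C(1) by blast
qed

lemma bounded_imp_boundary_ratio_bounded:
  assumes a: "0 < \<alpha>" "\<alpha> < 1" and self: "\<phi> ` unit_disc \<subseteq> unit_disc"
    and bdd: "bounded_on_dirichlet \<alpha> (weighted_comp_op \<psi> \<phi>)"
  shows "bdd_above (boundary_ratio \<alpha> \<psi> \<phi> ` unit_disc)"
proof -
  let ?T = "weighted_comp_op \<psi> \<phi>"
  obtain C where C: "C > 0" "\<And>z. z \<in> unit_disc \<Longrightarrow> (boundary_ratio \<alpha> \<psi> \<phi> z)\<^sup>2 \<le>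
     C * ((cmod (?T (kernel_fun \<alpha> (\<phi> z)) z))\<^sup>2 * (1 - (cmod z)\<^sup>2) powr \<alpha>)"
    using boundary_ratio_le_kernel_image[OF a self] by blast
  obtain D where D: "D > 0" "\<And>f z. f \<in> dirichlet_space \<alpha> \<Longrightarrow> z \<in> unit_disc \<Longrightarrow>
     (cmod (f z))\<^sup>2 * (1 - (cmod z)\<^sup>2) powr \<alpha> \<le> D * (dirichlet_norm \<alpha> f)\<^sup>2"
    using dirichlet_growth[OF a(1)] by blast
  obtain N where N: "\<And>f. f \<in> dirichlet_space \<alpha> \<Longrightarrow> dirichlet_norm \<alpha> (?T f) \<le> N * dirichlet_norm \<alpha> f"
    using bdd unfolding bounded_on_dirichlet_def by blast
  have maps: "?T ` dirichlet_space \<alpha> \<subseteq> dirichlet_space \<alpha>"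
    using bdd by (auto simp: bounded_on_dirichlet_def linear_on_dirichlet_def)
  have "boundary_ratio \<alpha> \<psi> \<phi> z \<le> sqrt (C * (D * N\<^sup>2))" if z: "z \<in> unit_disc" for z
  proof (rule real_le_rsqrt)
    have w: "\<phi> z \<in> unit_disc" using self z by blast
    let ?f = "kernel_fun \<alpha> (\<phi> z)"
    have Tf: "?T ?f \<in> dirichlet_space \<alpha>" using kernel_fun(1)[OF a w] maps by blast
    have "dirichlet_norm \<alpha> (?T ?f) \<le> N"
      using N[OF kernel_fun(1)[OF a w]] kernel_fun(2)[OF a w] by simp
    hence N2: "(dirichlet_norm \<alpha> (?T ?f))\<^sup>2 \<le> N\<^sup>2"
      using dirichlet_norm_nonneg[OF Tf] by (intro power_mono)
    have "(boundary_ratio \<alpha> \<psi> \<phi> z)\<^sup>2 \<le> C * ((cmod (?T ?f z))\<^sup>2 * (1 - (cmod z)\<^sup>2) powr \<alpha>)" by (rule C(2)[OF z])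
    also have "\<dots> \<le> C * (D * (dirichlet_norm \<alpha> (?T ?f))\<^sup>2)"
      using D(2)[OF Tf z] C(1) by (intro mult_left_mono) auto
    also have "\<dots> \<le> C * (D * N\<^sup>2)"
      using N2 C(1) D(1) by (intro mult_left_mono) auto
    finally show "(boundary_ratio \<alpha> \<psi> \<phi> z)\<^sup>2 \<le> C * (D * N\<^sup>2)" .
  qed
  thus ?thesis by (auto intro!: bdd_aboveI2)
qed

text \<open>
  Along points \<open>z\<^sub>n\<close> with \<open>q(z\<^sub>n) \<ge> \<epsilon>\<close> and \<open>|z\<^sub>n| \<longlonglongrightarrow> 1\<close> the images \<open>T k\<^sub>n\<close> of the normalised kernels at
  \<open>\<phi>(z\<^sub>n)\<close> are large at \<open>z\<^sub>n\<close>. For a subsequence \<open>T k\<^sub>n = (T k\<^sub>n - g) + g\<close> with the first summand small in norm; by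
  the growth estimates neither summand is large at \<open>z\<^sub>n\<close>. The points \<open>\<phi>(z\<^sub>n)\<close> may stay inside
  the disc; only the \<open>z\<^sub>n\<close> have to approach the boundary.
\<close>

lemma compact_imp_boundary_ratio_tendsto_0:
  assumes a: "0 < \<alpha>" "\<alpha> < 1" and self: "\<phi> ` unit_disc \<subseteq> unit_disc"
    and cpt: "compact_on_dirichlet \<alpha> (weighted_comp_op \<psi> \<phi>)"
  shows "(boundary_ratio \<alpha> \<psi> \<phi> \<longlongrightarrow> 0) (cmod going_to at_left 1)"
proof (rule ccontr)
  let ?T = "weighted_comp_op \<psi> \<phi>" and ?q = "boundary_ratio \<alpha> \<psi> \<phi>"
  assume "\<not> ?thesis"
  then obtain \<epsilon> where e: "\<epsilon> > 0" and ne: "\<not> eventually (\<lambda>z. dist (?q z) 0 < \<epsilon>) (cmod going_to at_left 1)"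
    unfolding tendsto_iff by blast
  have q0: "?q z \<ge> 0" for z by (simp add: boundary_ratio_def)
  have "\<exists>z. r < cmod z \<and> cmod z < 1 \<and> \<epsilon> \<le> ?q z" if "r < 1" for r
  proof -
    from ne that obtain z where "r < cmod z" "cmod z < 1" "\<not> dist (?q z) 0 < \<epsilon>"
      unfolding eventually_going_to_unit_circle by blast
    thus ?thesis using q0[of z] by (intro exI[of _ z]) (auto simp: dist_real_def)
  qed
  hence "\<forall>n. \<exists>z. 1 - 1 / real (n + 1) < cmod z \<and> cmod z < 1 \<and> \<epsilon> \<le> ?q z" by simp
  then obtain z where zn: "\<And>n. 1 - 1 / real (n + 1) < cmod (z n)" and z1: "\<And>n. cmod (z n) < 1"
    and zq: "\<And>n. \<epsilon> \<le> ?q (z n)" by metis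
  have z: "z n \<in> unit_disc" for n using z1 by simp
  have w: "\<phi> (z n) \<in> unit_disc" for n using z self by blast
  define f where "f = (\<lambda>n. kernel_fun \<alpha> (\<phi> (z n)))"
  have f: "f n \<in> dirichlet_space \<alpha>" "dirichlet_norm \<alpha> (f n) = 1" for n
    unfolding f_def using kernel_fun(1,2)[OF a w] by auto
  have maps: "?T ` dirichlet_space \<alpha> \<subseteq> dirichlet_space \<alpha>"
    using cpt by (auto simp: compact_on_dirichlet_def linear_on_dirichlet_def)
  have "range f \<subseteq> dirichlet_space \<alpha> \<and> bdd_above (range (\<lambda>n. dirichlet_norm \<alpha> (f n)))"
    using f by auto
  then obtain r g where r: "strict_mono (r :: nat \<Rightarrow> nat)" and g: "g \<in> dirichlet_space \<alpha>"
    and lim: "(\<lambda>n. dirichlet_norm \<alpha> (\<lambda>z. ?T (f (r n)) z - g z)) \<longlonglongrightarrow> 0"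
    using cpt unfolding compact_on_dirichlet_def by blast
  obtain C where C: "C > 0" "\<And>z. z \<in> unit_disc \<Longrightarrow> (?q z)\<^sup>2 \<le>
     C * ((cmod (?T (kernel_fun \<alpha> (\<phi> z)) z))\<^sup>2 * (1 - (cmod z)\<^sup>2) powr \<alpha>)"
    using boundary_ratio_le_kernel_image[OF a self] by blast
  obtain D where D: "D > 0" "\<And>f z. f \<in> dirichlet_space \<alpha> \<Longrightarrow> z \<in> unit_disc \<Longrightarrow>
     (cmod (f z))\<^sup>2 * (1 - (cmod z)\<^sup>2) powr \<alpha> \<le> D * (dirichlet_norm \<alpha> f)\<^sup>2"
    using dirichlet_growth[OF a(1)] by blast
  \<comment> \<open>The thresholds are chosen so that each of the two summands contributes at most \<open>\<epsilon>\<^sup>2 / 4\<close> to \<open>q\<^sup>2\<close>.\<close>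
  have "(\<lambda>n. (dirichlet_norm \<alpha> (\<lambda>z. ?T (f (r n)) z - g z))\<^sup>2) \<longlonglongrightarrow> 0\<^sup>2"
    by (intro tendsto_power lim)
  hence ev1: "eventually (\<lambda>n. (dirichlet_norm \<alpha> (\<lambda>z. ?T (f (r n)) z - g z))\<^sup>2 < \<epsilon>\<^sup>2 / (8 * C * D)) sequentially"
    by (rule order_tendstoD) (use e C D in auto)
  obtain \<rho> where rho: "\<rho> < 1" "\<And>z. \<rho> < cmod z \<Longrightarrow> cmod z < 1 \<Longrightarrow>
      (cmod (g z))\<^sup>2 * (1 - (cmod z)\<^sup>2) powr \<alpha> < \<epsilon>\<^sup>2 / (8 * C)"
    using dirichlet_growth_little_o[OF a(1) g, of "\<epsilon>\<^sup>2 / (8 * C)"] e C(1) by auto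
  have "(\<lambda>n. 1 - 1 / real (n + 1)) \<longlonglongrightarrow> 1" by real_asymp
  hence "eventually (\<lambda>n. \<rho> < 1 - 1 / real (n + 1)) sequentially"
    using rho(1) by (rule order_tendstoD)
  hence "eventually (\<lambda>n. \<rho> < 1 - 1 / real (r n + 1)) sequentially"
    using eventually_subseq[OF r] by blast
  with ev1 have "eventually (\<lambda>n. False) sequentially"
  proof eventually_elim
    case (elim n)
    define h where "h = (\<lambda>z. ?T (f (r n)) z - g z)"
    define x where "x = z (r n)"
    define s where "s = (1 - (cmod x)\<^sup>2) powr \<alpha>"
    have x: "x \<in> unit_disc" using z by (simp add: x_def)
    have h: "h \<in> dirichlet_space \<alpha>" unfolding h_def
      by (rule dirichlet_space_diff(1)) (use f maps g in auto)
    have "(cmod (h x))\<^sup>2 * s \<le> D * (dirichlet_norm \<alpha> h)\<^sup>2" unfolding s_def by (rule D(2)[OF h x])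
    also have "\<dots> < D * (\<epsilon>\<^sup>2 / (8 * C * D))"
      using elim(1) D(1) unfolding h_def by (intro mult_strict_left_mono)
    finally have h1: "(cmod (h x))\<^sup>2 * s < \<epsilon>\<^sup>2 / (8 * C)" using D(1) by simp
    have g1: "(cmod (g x))\<^sup>2 * s < \<epsilon>\<^sup>2 / (8 * C)" unfolding s_def
      using elim(2) zn[of "r n"] x by (intro rho(2)) (auto simp: x_def)
    have "(cmod (?T (f (r n)) x))\<^sup>2 \<le> (cmod (h x) + cmod (g x))\<^sup>2"
      using norm_triangle_ineq[of "h x" "g x"] by (intro power_mono) (auto simp: h_def)
    also have "\<dots> \<le> 2 * (cmod (h x))\<^sup>2 + 2 * (cmod (g x))\<^sup>2"
      using sum_squares_bound[of "cmod (h x)" "cmod (g x)"] by (simp add: power2_sum)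
    finally have "(cmod (?T (f (r n)) x))\<^sup>2 * s \<le> (2 * (cmod (h x))\<^sup>2 + 2 * (cmod (g x))\<^sup>2) * s"
      by (intro mult_right_mono) (auto simp: s_def)
    also have "\<dots> = 2 * ((cmod (h x))\<^sup>2 * s) + 2 * ((cmod (g x))\<^sup>2 * s)" by (simp add: algebra_simps)
    also have "\<dots> < 2 * (\<epsilon>\<^sup>2 / (8 * C)) + 2 * (\<epsilon>\<^sup>2 / (8 * C))" using h1 g1 by linarith
    finally have "C * ((cmod (?T (f (r n)) x))\<^sup>2 * s) < C * (2 * (\<epsilon>\<^sup>2 / (8 * C)) + 2 * (\<epsilon>\<^sup>2 / (8 * C)))"
      using C(1) by (intro mult_strict_left_mono)
    also have "\<dots> = \<epsilon>\<^sup>2 / 2" using C(1) by (simp add: field_simps)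
    finally have "(?q x)\<^sup>2 < \<epsilon>\<^sup>2 / 2"
      using C(2)[OF x] by (simp add: s_def f_def x_def)
    moreover have "\<epsilon>\<^sup>2 \<le> (?q x)\<^sup>2" using zq[of "r n"] e by (intro power_mono) (auto simp: x_def)
    moreover have "\<epsilon>\<^sup>2 > 0" using e by simp
    ultimately show False by linarith
  qed
  thus False by simp
qed

section \<open>Energy estimates and boundedness\<close>

text \<open>
  The weighted area integrals of the two summands of \<open>(T f)' = \<psi>' (f \<circ> \<phi>) + \<psi> (f' \<circ> \<phi>) \<phi>'\<close>.
\<close>

definition derivative_energy :: "real \<Rightarrow> (complex \<Rightarrow> complex) \<Rightarrow> (complex \<Rightarrow> complex) \<Rightarrow> (complex \<Rightarrow> complex) \<Rightarrow> ennreal" where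
  "derivative_energy \<alpha> \<psi> \<phi> f = (\<integral>\<^sup>+z\<in>unit_disc. ennreal ((cmod (deriv \<psi> z * f (\<phi> z)))\<^sup>2 * (1 - (cmod z)\<^sup>2) powr \<alpha>) \<partial>lborel)"

definition composition_energy :: "real \<Rightarrow> (complex \<Rightarrow> complex) \<Rightarrow> (complex \<Rightarrow> complex) \<Rightarrow> (complex \<Rightarrow> complex) \<Rightarrow> ennreal" where
  "composition_energy \<alpha> \<psi> \<phi> f = (\<integral>\<^sup>+z\<in>unit_disc. ennreal ((cmod (\<psi> z * deriv f (\<phi> z) * deriv \<phi> z))\<^sup>2 * (1 - (cmod z)\<^sup>2) powr \<alpha>) \<partial>lborel)"

lemma weighted_comp_op_holomorphic:
  assumes "\<psi> holomorphic_on unit_disc" "\<phi> holomorphic_on unit_disc" "\<phi> ` unit_disc \<subseteq> unit_disc"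
    "f holomorphic_on unit_disc"
  shows "weighted_comp_op \<psi> \<phi> f holomorphic_on unit_disc"
  using holomorphic_on_compose_gen[OF assms(2,4,3)] assms(1)
  unfolding weighted_comp_op_def by (auto intro!: holomorphic_on_mult simp: o_def)

lemma deriv_weighted_comp_op:
  assumes hol: "\<psi> holomorphic_on unit_disc" "\<phi> holomorphic_on unit_disc" and self: "\<phi> ` unit_disc \<subseteq> unit_disc"
    and f: "f holomorphic_on unit_disc" and z: "z \<in> unit_disc"
  shows "deriv (weighted_comp_op \<psi> \<phi> f) z = deriv \<psi> z * f (\<phi> z) + \<psi> z * deriv f (\<phi> z) * deriv \<phi> z"
proof -
  have w: "\<phi> z \<in> unit_disc" using self z by blast
  have d1: "(\<psi> has_field_derivative deriv \<psi> z) (at z)" by (rule holomorphic_derivI[OF hol(1) open_ball z])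
  have d2: "(\<phi> has_field_derivative deriv \<phi> z) (at z)" by (rule holomorphic_derivI[OF hol(2) open_ball z])
  have d3: "(f has_field_derivative deriv f (\<phi> z)) (at (\<phi> z))" by (rule holomorphic_derivI[OF f open_ball w])
  have "((\<lambda>z. f (\<phi> z)) has_field_derivative deriv f (\<phi> z) * deriv \<phi> z) (at z)"
    by (rule DERIV_chain2[OF d3 d2])
  from DERIV_mult[OF d1 this] show ?thesis
    unfolding weighted_comp_op_def by (intro DERIV_imp_deriv) (simp add: algebra_simps)
qed

lemma continuous_on_one_minus_norm_sq_powr:
  "continuous_on unit_disc (\<lambda>z::complex. (1 - (cmod z)\<^sup>2) powr \<alpha>)"
  using one_minus_norm_sq_pos by (intro continuous_intros) force

lemma continuous_on_compose_disc:
  assumes "\<phi> holomorphic_on unit_disc" "\<phi> ` unit_disc \<subseteq> unit_disc" "f holomorphic_on unit_disc"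
  shows "continuous_on unit_disc (\<lambda>z. f (\<phi> z))"
  using continuous_on_compose2[OF holomorphic_on_imp_continuous_on[OF assms(3)] holomorphic_on_imp_continuous_on[OF assms(1)] assms(2)] .

lemma deriv_holomorphic_disc: "f holomorphic_on unit_disc \<Longrightarrow> deriv f holomorphic_on unit_disc"
  by (rule holomorphic_deriv) auto

lemma weighted_area_integrand_continuous:
  assumes "g holomorphic_on unit_disc"
  shows "continuous_on unit_disc (\<lambda>z. (cmod (g z))\<^sup>2 * (1 - (cmod z)\<^sup>2) powr s)"
  by (intro continuous_on_mult continuous_on_power continuous_on_norm continuous_on_one_minus_norm_sq_powr
      holomorphic_on_imp_continuous_on assms)

lemma energy_integrands_continuous:
  assumes "\<psi> holomorphic_on unit_disc" "\<phi> holomorphic_on unit_disc" "\<phi> ` unit_disc \<subseteq> unit_disc"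
    "f holomorphic_on unit_disc"
  shows "continuous_on unit_disc (\<lambda>z. (cmod (deriv \<psi> z * f (\<phi> z)))\<^sup>2 * (1 - (cmod z)\<^sup>2) powr \<alpha>)"
    and "continuous_on unit_disc (\<lambda>z. (cmod (\<psi> z * deriv f (\<phi> z) * deriv \<phi> z))\<^sup>2 * (1 - (cmod z)\<^sup>2) powr \<alpha>)"
proof -
  note [continuous_intros] = continuous_on_one_minus_norm_sq_powr holomorphic_on_imp_continuous_on[OF assms(1)]
    holomorphic_on_imp_continuous_on[OF deriv_holomorphic_disc[OF assms(1)]]
    holomorphic_on_imp_continuous_on[OF deriv_holomorphic_disc[OF assms(2)]]
    continuous_on_compose_disc[OF assms(2,3,4)]
    continuous_on_compose_disc[OF assms(2,3) deriv_holomorphic_disc[OF assms(4)]]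
  show "continuous_on unit_disc (\<lambda>z. (cmod (deriv \<psi> z * f (\<phi> z)))\<^sup>2 * (1 - (cmod z)\<^sup>2) powr \<alpha>)"
    by (intro continuous_intros)
  show "continuous_on unit_disc (\<lambda>z. (cmod (\<psi> z * deriv f (\<phi> z) * deriv \<phi> z))\<^sup>2 * (1 - (cmod z)\<^sup>2) powr \<alpha>)"
    by (intro continuous_intros)
qed

lemma weighted_area_deriv_weighted_comp_op_le:
  assumes hol: "\<psi> holomorphic_on unit_disc" "\<phi> holomorphic_on unit_disc" and self: "\<phi> ` unit_disc \<subseteq> unit_disc"
    and f: "f holomorphic_on unit_disc"
  shows "weighted_area \<alpha> (deriv (weighted_comp_op \<psi> \<phi> f)) \<le>
     2 * derivative_energy \<alpha> \<psi> \<phi> f + 2 * composition_energy \<alpha> \<psi> \<phi> f"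
proof -
  let ?A = "\<lambda>z. (cmod (deriv \<psi> z * f (\<phi> z)))\<^sup>2 * (1 - (cmod z)\<^sup>2) powr \<alpha>"
  let ?B = "\<lambda>z. (cmod (\<psi> z * deriv f (\<phi> z) * deriv \<phi> z))\<^sup>2 * (1 - (cmod z)\<^sup>2) powr \<alpha>"
  have [measurable]: "(\<lambda>z. ennreal (?A z) * indicator unit_disc z) \<in> borel_measurable borel"
      "(\<lambda>z. ennreal (?B z) * indicator unit_disc z) \<in> borel_measurable borel"
    by (rule borel_measurable_cont_indicator[OF energy_integrands_continuous(1)[OF hol self f]]; simp)
       (rule borel_measurable_cont_indicator[OF energy_integrands_continuous(2)[OF hol self f]]; simp)
  have "weighted_area \<alpha> (deriv (weighted_comp_op \<psi> \<phi> f)) \<le>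
    (\<integral>\<^sup>+z. 2 * (ennreal (?A z) * indicator unit_disc z) + 2 * (ennreal (?B z) * indicator unit_disc z) \<partial>lborel)"
    unfolding weighted_area_def
  proof (rule nn_integral_mono)
    fix z :: complex
    show "ennreal ((cmod (deriv (weighted_comp_op \<psi> \<phi> f) z))\<^sup>2 * (1 - (cmod z)\<^sup>2) powr \<alpha>) * indicator unit_disc z
      \<le> 2 * (ennreal (?A z) * indicator unit_disc z) + 2 * (ennreal (?B z) * indicator unit_disc z)"
    proof (cases "z \<in> unit_disc")
      case True
      define u v where "u = deriv \<psi> z * f (\<phi> z)" and "v = \<psi> z * deriv f (\<phi> z) * deriv \<phi> z"
      have "(cmod (u + v))\<^sup>2 \<le> (cmod u + cmod v)\<^sup>2" by (intro power_mono norm_triangle_ineq) auto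
      also have "\<dots> \<le> 2 * (cmod u)\<^sup>2 + 2 * (cmod v)\<^sup>2"
        using sum_squares_bound[of "cmod u" "cmod v"] by (simp add: power2_sum)
      finally have "(cmod (u + v))\<^sup>2 * (1 - (cmod z)\<^sup>2) powr \<alpha> \<le> (2 * (cmod u)\<^sup>2 + 2 * (cmod v)\<^sup>2) * (1 - (cmod z)\<^sup>2) powr \<alpha>"
        by (intro mult_right_mono) auto
      also have "\<dots> = 2 * ?A z + 2 * ?B z" by (simp add: u_def v_def algebra_simps)
      finally have "ennreal ((cmod (u + v))\<^sup>2 * (1 - (cmod z)\<^sup>2) powr \<alpha>) \<le> ennreal (2 * ?A z + 2 * ?B z)"
        by (rule ennreal_leI)
      also have "\<dots> = 2 * ennreal (?A z) + 2 * ennreal (?B z)"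
        by (simp add: ennreal_plus ennreal_mult)
      finally show ?thesis using True deriv_weighted_comp_op[OF hol self f True] by (simp add: u_def v_def)
    qed simp
  qed
  also have "\<dots> = 2 * derivative_energy \<alpha> \<psi> \<phi> f + 2 * composition_energy \<alpha> \<psi> \<phi> f"
    by (simp add: nn_integral_add nn_integral_cmult derivative_energy_def composition_energy_def)
  finally show ?thesis .
qed

text \<open>
  The growth bound at \<open>\<phi>(z)\<close> may be weighted with the distance of \<open>z\<close> to the boundary, because by
  Schwarz--Pick \<open>\<phi>(z)\<close> is not essentially closer to the boundary than \<open>z\<close>.
\<close>

lemma compose_growth:
  assumes a: "\<alpha> > 0" and hol: "\<phi> holomorphic_on unit_disc" and self: "\<phi> ` unit_disc \<subseteq> unit_disc"
  shows "\<exists>C>0. \<forall>f\<in>dirichlet_space \<alpha>. \<forall>z\<in>unit_disc.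
     (cmod (f (\<phi> z)))\<^sup>2 * (1 - (cmod z)\<^sup>2) powr \<alpha> \<le> C * (dirichlet_norm \<alpha> f)\<^sup>2"
proof -
  obtain C where C: "C > 0" "\<And>f z. f \<in> dirichlet_space \<alpha> \<Longrightarrow> z \<in> unit_disc \<Longrightarrow>
     (cmod (f z))\<^sup>2 * (1 - (cmod z)\<^sup>2) powr \<alpha> \<le> C * (dirichlet_norm \<alpha> f)\<^sup>2"
    using dirichlet_growth[OF a] by blast
  obtain K where K: "K > 0" "\<And>z. z \<in> unit_disc \<Longrightarrow> 1 - (cmod z)\<^sup>2 \<le> K * (1 - (cmod (\<phi> z))\<^sup>2)"
    using schwarz_pick_boundary_distance[OF hol self] by blast
  have "(cmod (f (\<phi> z)))\<^sup>2 * (1 - (cmod z)\<^sup>2) powr \<alpha> \<le> K powr \<alpha> * C * (dirichlet_norm \<alpha> f)\<^sup>2"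
    if f: "f \<in> dirichlet_space \<alpha>" and z: "z \<in> unit_disc" for f z
  proof -
    have w: "\<phi> z \<in> unit_disc" using self z by blast
    have "(1 - (cmod z)\<^sup>2) powr \<alpha> \<le> (K * (1 - (cmod (\<phi> z))\<^sup>2)) powr \<alpha>"
      using K(2)[OF z] one_minus_norm_sq_pos[OF z] a by (intro powr_mono2) auto
    also have "\<dots> = K powr \<alpha> * (1 - (cmod (\<phi> z))\<^sup>2) powr \<alpha>"
      using K(1) one_minus_norm_sq_pos[OF w] by (simp add: powr_mult)
    finally have "(cmod (f (\<phi> z)))\<^sup>2 * (1 - (cmod z)\<^sup>2) powr \<alpha> \<le>
       (cmod (f (\<phi> z)))\<^sup>2 * (K powr \<alpha> * (1 - (cmod (\<phi> z))\<^sup>2) powr \<alpha>)"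
      by (intro mult_left_mono) auto
    also have "\<dots> = K powr \<alpha> * ((cmod (f (\<phi> z)))\<^sup>2 * (1 - (cmod (\<phi> z))\<^sup>2) powr \<alpha>)" by (simp only: mult_ac)
    also have "\<dots> \<le> K powr \<alpha> * (C * (dirichlet_norm \<alpha> f)\<^sup>2)"
      by (intro mult_left_mono C(2)[OF f w]) auto
    finally show ?thesis by (simp only: mult_ac)
  qed
  moreover have "K powr \<alpha> * C > 0" using K(1) C(1) by simp
  ultimately show ?thesis by blast
qed

text \<open>
  The exponent 0 on the right is kept so that the bound is literally the integrand of the unweighted
  area integral of \<open>\<psi>'\<close>.
\<close>

lemma derivative_energy_integrand_le:
  assumes a: "\<alpha> > 0" and hol: "\<phi> holomorphic_on unit_disc" and self: "\<phi> ` unit_disc \<subseteq> unit_disc"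
  shows "\<exists>C>0. \<forall>f\<in>dirichlet_space \<alpha>. \<forall>z\<in>unit_disc.
     (cmod (deriv \<psi> z * f (\<phi> z)))\<^sup>2 * (1 - (cmod z)\<^sup>2) powr \<alpha> \<le>
     C * (dirichlet_norm \<alpha> f)\<^sup>2 * ((cmod (deriv \<psi> z))\<^sup>2 * (1 - (cmod z)\<^sup>2) powr 0)"
proof -
  obtain C where C: "C > 0" "\<And>f z. f \<in> dirichlet_space \<alpha> \<Longrightarrow> z \<in> unit_disc \<Longrightarrow>
     (cmod (f (\<phi> z)))\<^sup>2 * (1 - (cmod z)\<^sup>2) powr \<alpha> \<le> C * (dirichlet_norm \<alpha> f)\<^sup>2"
    using compose_growth[OF a hol self] by blast
  have "(cmod (deriv \<psi> z * f (\<phi> z)))\<^sup>2 * (1 - (cmod z)\<^sup>2) powr \<alpha> \<le>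
     C * (dirichlet_norm \<alpha> f)\<^sup>2 * ((cmod (deriv \<psi> z))\<^sup>2 * (1 - (cmod z)\<^sup>2) powr 0)"
    if "f \<in> dirichlet_space \<alpha>" "z \<in> unit_disc" for f z
    using mult_left_mono[OF C(2)[OF that], of "(cmod (deriv \<psi> z))\<^sup>2"] one_minus_norm_sq_pos[OF that(2)]
    by (simp add: norm_mult power_mult_distrib mult_ac)
  thus ?thesis using C(1) by blast
qed

lemma derivative_energy_le:
  assumes a: "\<alpha> > 0" and hol: "\<psi> holomorphic_on unit_disc" "\<phi> holomorphic_on unit_disc" and self: "\<phi> ` unit_disc \<subseteq> unit_disc"
  shows "\<exists>C>0. \<forall>f\<in>dirichlet_space \<alpha>.
     derivative_energy \<alpha> \<psi> \<phi> f \<le> ennreal (C * (dirichlet_norm \<alpha> f)\<^sup>2) * weighted_area 0 (deriv \<psi>)"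
proof -
  obtain C where C: "C > 0" "\<And>f z. f \<in> dirichlet_space \<alpha> \<Longrightarrow> z \<in> unit_disc \<Longrightarrow>
     (cmod (deriv \<psi> z * f (\<phi> z)))\<^sup>2 * (1 - (cmod z)\<^sup>2) powr \<alpha> \<le>
     C * (dirichlet_norm \<alpha> f)\<^sup>2 * ((cmod (deriv \<psi> z))\<^sup>2 * (1 - (cmod z)\<^sup>2) powr 0)"
    using derivative_energy_integrand_le[OF a hol(2) self] by blast
  have [measurable]: "(\<lambda>z. ennreal ((cmod (deriv \<psi> z))\<^sup>2 * (1 - (cmod z)\<^sup>2) powr 0) * indicator unit_disc z) \<in> borel_measurable borel"
    by (rule borel_measurable_cont_indicator[OF weighted_area_integrand_continuous[OF deriv_holomorphic_disc[OF hol(1)]]]) auto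
  have "derivative_energy \<alpha> \<psi> \<phi> f \<le> ennreal (C * (dirichlet_norm \<alpha> f)\<^sup>2) * weighted_area 0 (deriv \<psi>)"
    if f: "f \<in> dirichlet_space \<alpha>" for f
  proof -
    have "derivative_energy \<alpha> \<psi> \<phi> f \<le> (\<integral>\<^sup>+z. ennreal (C * (dirichlet_norm \<alpha> f)\<^sup>2) *
       (ennreal ((cmod (deriv \<psi> z))\<^sup>2 * (1 - (cmod z)\<^sup>2) powr 0) * indicator unit_disc z) \<partial>lborel)"
      unfolding derivative_energy_def
    proof (rule nn_integral_mono)
      fix z :: complex
      show "ennreal ((cmod (deriv \<psi> z * f (\<phi> z)))\<^sup>2 * (1 - (cmod z)\<^sup>2) powr \<alpha>) * indicator unit_disc z \<le>
        ennreal (C * (dirichlet_norm \<alpha> f)\<^sup>2) *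
       (ennreal ((cmod (deriv \<psi> z))\<^sup>2 * (1 - (cmod z)\<^sup>2) powr 0) * indicator unit_disc z)"
      proof (cases "z \<in> unit_disc")
        case True
        have "ennreal ((cmod (deriv \<psi> z * f (\<phi> z)))\<^sup>2 * (1 - (cmod z)\<^sup>2) powr \<alpha>) \<le>
          ennreal (C * (dirichlet_norm \<alpha> f)\<^sup>2 * ((cmod (deriv \<psi> z))\<^sup>2 * (1 - (cmod z)\<^sup>2) powr 0))"
          by (rule ennreal_leI[OF C(2)[OF f True]])
        also have "\<dots> = ennreal (C * (dirichlet_norm \<alpha> f)\<^sup>2) * ennreal ((cmod (deriv \<psi> z))\<^sup>2 * (1 - (cmod z)\<^sup>2) powr 0)"
          using C(1) by (intro ennreal_mult) auto
        finally show ?thesis using True by simp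
      qed simp
    qed
    also have "\<dots> = ennreal (C * (dirichlet_norm \<alpha> f)\<^sup>2) * weighted_area 0 (deriv \<psi>)"
      unfolding weighted_area_def by (rule nn_integral_cmult) measurable
    finally show ?thesis .
  qed
  thus ?thesis using C(1) by blast
qed

text \<open>
  Univalence makes the left-hand side the integral of \<open>|g|\<^sup>2 (1 - |w|\<^sup>2)\<^sup>\<alpha>\<close> over \<open>\<phi>(D)\<close>, a part of the disc.
\<close>

lemma weighted_area_univalent_substitution:
  assumes hol: "\<phi> holomorphic_on unit_disc" and self: "\<phi> ` unit_disc \<subseteq> unit_disc" and inj: "inj_on \<phi> unit_disc"
    and g: "g holomorphic_on unit_disc"
  shows "(\<integral>\<^sup>+z\<in>unit_disc. ennreal ((cmod (g (\<phi> z)))\<^sup>2 * (1 - (cmod (\<phi> z))\<^sup>2) powr \<alpha> * (cmod (deriv \<phi> z))\<^sup>2) \<partial>lborel)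
     \<le> weighted_area \<alpha> g"
proof -
  define h where "h = (\<lambda>w. ennreal ((cmod (g w))\<^sup>2 * (1 - (cmod w)\<^sup>2) powr \<alpha>) * indicator unit_disc w)"
  have [measurable]: "h \<in> borel_measurable borel" unfolding h_def
    by (rule borel_measurable_cont_indicator[OF weighted_area_integrand_continuous[OF g]]) auto
  have "(\<integral>\<^sup>+z\<in>unit_disc. ennreal ((cmod (g (\<phi> z)))\<^sup>2 * (1 - (cmod (\<phi> z))\<^sup>2) powr \<alpha> * (cmod (deriv \<phi> z))\<^sup>2) \<partial>lborel)
     = (\<integral>\<^sup>+z\<in>unit_disc. h (\<phi> z) * ennreal ((cmod (deriv \<phi> z))\<^sup>2) \<partial>lborel)"
    using self by (intro nn_integral_cong) (auto simp: h_def indicator_def image_subset_iff ennreal_mult)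
  also have "\<dots> = (\<integral>\<^sup>+w\<in>\<phi> ` unit_disc. h w \<partial>lborel)"
    by (rule nn_integral_univalent_substitution[OF open_ball hol inj bounded_subset[OF bounded_ball self]]) measurable
  also have "\<dots> \<le> (\<integral>\<^sup>+w. h w \<partial>lborel)"
    by (intro nn_integral_mono) (auto simp: indicator_def)
  finally show ?thesis by (simp add: weighted_area_def h_def)
qed

text \<open>
  The integrand is \<open>q\<^sup>2\<close> times an integrand to which the substitution \<open>w = \<phi>(z)\<close> applies. The set \<open>A\<close> is the
  whole disc in the proof of boundedness and an annulus at the boundary in that of compactness.
\<close>

lemma composition_energy_on_subset_le:
  assumes a: "0 < \<alpha>" "\<alpha> < 1" and hol: "\<phi> holomorphic_on unit_disc"
    and self: "\<phi> ` unit_disc \<subseteq> unit_disc" and inj: "inj_on \<phi> unit_disc"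
  shows "\<exists>C>0. \<forall>A M f. f \<in> dirichlet_space \<alpha> \<longrightarrow> A \<subseteq> unit_disc \<longrightarrow> (\<forall>z\<in>A. (boundary_ratio \<alpha> \<psi> \<phi> z)\<^sup>2 \<le> M) \<longrightarrow> 0 \<le> M \<longrightarrow>
     (\<integral>\<^sup>+z\<in>A. ennreal ((cmod (\<psi> z * deriv f (\<phi> z) * deriv \<phi> z))\<^sup>2 * (1 - (cmod z)\<^sup>2) powr \<alpha>) \<partial>lborel)
       \<le> ennreal (M * C * (dirichlet_norm \<alpha> f)\<^sup>2)"
proof -
  obtain C where C: "C > 0" "\<And>f. f \<in> dirichlet_space \<alpha> \<Longrightarrow> weighted_area \<alpha> (deriv f) \<le> ennreal (C * (dirichlet_norm \<alpha> f)\<^sup>2)"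
    using weighted_area_deriv_le_dirichlet_norm[OF a] by blast
  have "(\<integral>\<^sup>+z\<in>A. ennreal ((cmod (\<psi> z * deriv f (\<phi> z) * deriv \<phi> z))\<^sup>2 * (1 - (cmod z)\<^sup>2) powr \<alpha>) \<partial>lborel)
       \<le> ennreal (M * C * (dirichlet_norm \<alpha> f)\<^sup>2)"
    if f: "f \<in> dirichlet_space \<alpha>" and A: "A \<subseteq> unit_disc" and M: "\<And>z. z \<in> A \<Longrightarrow> (boundary_ratio \<alpha> \<psi> \<phi> z)\<^sup>2 \<le> M" "0 \<le> M" for f A M
  proof -
    have fh: "deriv f holomorphic_on unit_disc"
      using f by (auto simp: dirichlet_space_def intro: deriv_holomorphic_disc)
    define u where "u = (\<lambda>z. (cmod (deriv f (\<phi> z)))\<^sup>2 * (1 - (cmod (\<phi> z))\<^sup>2) powr \<alpha> * (cmod (deriv \<phi> z))\<^sup>2)"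
    have u0: "u z \<ge> 0" for z by (simp add: u_def)
    have [measurable]: "(\<lambda>z. ennreal (u z) * indicator unit_disc z) \<in> borel_measurable borel"
    proof (rule borel_measurable_cont_indicator[of unit_disc])
      show "continuous_on unit_disc u" unfolding u_def
        by (intro continuous_intros continuous_on_compose_disc[OF hol self fh] holomorphic_on_imp_continuous_on deriv_holomorphic_disc hol
              continuous_on_compose2[OF continuous_on_one_minus_norm_sq_powr holomorphic_on_imp_continuous_on[OF hol] self])
    qed auto
    have "(\<integral>\<^sup>+z\<in>A. ennreal ((cmod (\<psi> z * deriv f (\<phi> z) * deriv \<phi> z))\<^sup>2 * (1 - (cmod z)\<^sup>2) powr \<alpha>) \<partial>lborel)
      \<le> (\<integral>\<^sup>+z. ennreal M * (ennreal (u z) * indicator unit_disc z) \<partial>lborel)"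
    proof (rule nn_integral_mono)
      fix z :: complex
      show "ennreal ((cmod (\<psi> z * deriv f (\<phi> z) * deriv \<phi> z))\<^sup>2 * (1 - (cmod z)\<^sup>2) powr \<alpha>) * indicator A z \<le>
         ennreal M * (ennreal (u z) * indicator unit_disc z)"
      proof (cases "z \<in> A")
        case True
        hence z: "z \<in> unit_disc" using A by blast
        hence w: "\<phi> z \<in> unit_disc" using self by blast
        have "(cmod (\<psi> z * deriv f (\<phi> z) * deriv \<phi> z))\<^sup>2 * (1 - (cmod z)\<^sup>2) powr \<alpha> =
          ((cmod (\<psi> z))\<^sup>2 * (1 - (cmod z)\<^sup>2) powr \<alpha>) * ((cmod (deriv f (\<phi> z)))\<^sup>2 * (cmod (deriv \<phi> z))\<^sup>2)"
          by (simp only: norm_mult power_mult_distrib mult_ac)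
        also have "\<dots> = (boundary_ratio \<alpha> \<psi> \<phi> z)\<^sup>2 * u z"
          unfolding boundary_ratio_sq[of z \<phi>, OF z w, symmetric] u_def by (simp only: mult_ac)
        also have "\<dots> \<le> M * u z" by (intro mult_right_mono M(1)[OF True] u0)
        finally have "ennreal ((cmod (\<psi> z * deriv f (\<phi> z) * deriv \<phi> z))\<^sup>2 * (1 - (cmod z)\<^sup>2) powr \<alpha>) \<le> ennreal (M * u z)"
          by (rule ennreal_leI)
        thus ?thesis using True z M(2) u0[of z] by (simp add: ennreal_mult)
      qed simp
    qed
    also have "\<dots> = ennreal M * (\<integral>\<^sup>+z\<in>unit_disc. ennreal (u z) \<partial>lborel)"
      by (rule nn_integral_cmult) measurable
    also have "\<dots> \<le> ennreal M * weighted_area \<alpha> (deriv f)"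
      unfolding u_def by (intro mult_left_mono weighted_area_univalent_substitution hol self inj fh) auto
    also have "\<dots> \<le> ennreal M * ennreal (C * (dirichlet_norm \<alpha> f)\<^sup>2)"
      by (intro mult_left_mono C(2)[OF f]) auto
    also have "\<dots> = ennreal (M * C * (dirichlet_norm \<alpha> f)\<^sup>2)"
      using M(2) C(1) by (simp add: ennreal_mult[symmetric] mult.assoc)
    finally show ?thesis .
  qed
  thus ?thesis using C(1) by blast
qed

lemma boundary_ratio_bounded_imp_bounded:
  assumes a: "0 < \<alpha>" "\<alpha> < 1" and hol: "\<psi> holomorphic_on unit_disc" "\<phi> holomorphic_on unit_disc"
    and self: "\<phi> ` unit_disc \<subseteq> unit_disc" and inj: "inj_on \<phi> unit_disc"
    and fin: "weighted_area 0 (deriv \<psi>) < \<infinity>"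
    and bdd: "bdd_above (boundary_ratio \<alpha> \<psi> \<phi> ` unit_disc)"
  shows "bounded_on_dirichlet \<alpha> (weighted_comp_op \<psi> \<phi>)"
proof -
  let ?T = "weighted_comp_op \<psi> \<phi>"
  obtain q where q: "\<And>z. z \<in> unit_disc \<Longrightarrow> boundary_ratio \<alpha> \<psi> \<phi> z \<le> q"
    using bdd unfolding bdd_above_def by blast
  have q2: "(boundary_ratio \<alpha> \<psi> \<phi> z)\<^sup>2 \<le> q\<^sup>2" if "z \<in> unit_disc" for z
    using q[OF that] by (intro power_mono) (auto simp: boundary_ratio_def)
  obtain C1 where C1: "C1 > 0" "\<And>f. f \<in> dirichlet_space \<alpha> \<Longrightarrow>
     derivative_energy \<alpha> \<psi> \<phi> f \<le> ennreal (C1 * (dirichlet_norm \<alpha> f)\<^sup>2) * weighted_area 0 (deriv \<psi>)"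
    using derivative_energy_le[OF a(1) hol self] by blast
  obtain C2 where C2: "C2 > 0" and C2': "\<And>A M f. f \<in> dirichlet_space \<alpha> \<Longrightarrow> A \<subseteq> unit_disc \<Longrightarrow>
       (\<And>z. z \<in> A \<Longrightarrow> (boundary_ratio \<alpha> \<psi> \<phi> z)\<^sup>2 \<le> M) \<Longrightarrow> 0 \<le> M \<Longrightarrow>
     (\<integral>\<^sup>+z\<in>A. ennreal ((cmod (\<psi> z * deriv f (\<phi> z) * deriv \<phi> z))\<^sup>2 * (1 - (cmod z)\<^sup>2) powr \<alpha>) \<partial>lborel)
       \<le> ennreal (M * C2 * (dirichlet_norm \<alpha> f)\<^sup>2)"
    using composition_energy_on_subset_le[OF a hol(2) self inj, of \<psi>] by blast
  have C2'': "composition_energy \<alpha> \<psi> \<phi> f \<le> ennreal (q\<^sup>2 * C2 * (dirichlet_norm \<alpha> f)\<^sup>2)"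
    if "f \<in> dirichlet_space \<alpha>" for f
    unfolding composition_energy_def by (rule C2'[OF that order_refl q2]) auto
  obtain C3 where C3: "C3 > 0" "\<And>f E. f holomorphic_on unit_disc \<Longrightarrow> 0 \<le> E \<Longrightarrow> weighted_area \<alpha> (deriv f) \<le> ennreal E \<Longrightarrow>
     f \<in> dirichlet_space \<alpha> \<and> (dirichlet_norm \<alpha> f)\<^sup>2 \<le> (cmod (f 0))\<^sup>2 + C3 * E"
    using dirichlet_norm_le_weighted_area_deriv[OF a] by blast
  obtain C4 where C4: "C4 > 0" "\<And>f z. f \<in> dirichlet_space \<alpha> \<Longrightarrow> z \<in> unit_disc \<Longrightarrow>
     (cmod (f (\<phi> z)))\<^sup>2 * (1 - (cmod z)\<^sup>2) powr \<alpha> \<le> C4 * (dirichlet_norm \<alpha> f)\<^sup>2"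
    using compose_growth[OF a(1) hol(2) self] by blast
  define P where "P = enn2real (weighted_area 0 (deriv \<psi>))"
  have P: "weighted_area 0 (deriv \<psi>) = ennreal P" "P \<ge> 0" using fin by (auto simp: P_def)
  define E where "E = 2 * (C1 * P) + 2 * (q\<^sup>2 * C2)"
  have E: "E \<ge> 0" using C1(1) C2 P(2) by (simp add: E_def)
  define N where "N = (cmod (\<psi> 0))\<^sup>2 * C4 + C3 * E"
  have N: "N \<ge> 0" using C4(1) C3(1) E by (simp add: N_def)
  have main: "?T f \<in> dirichlet_space \<alpha> \<and> (dirichlet_norm \<alpha> (?T f))\<^sup>2 \<le> N * (dirichlet_norm \<alpha> f)\<^sup>2"
    if f: "f \<in> dirichlet_space \<alpha>" for f
  proof -
    have fh: "f holomorphic_on unit_disc" using f by (simp add: dirichlet_space_def)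
    define d where "d = (dirichlet_norm \<alpha> f)\<^sup>2"
    have d: "d \<ge> 0" by (simp add: d_def)
    have "weighted_area \<alpha> (deriv (?T f)) \<le> 2 * derivative_energy \<alpha> \<psi> \<phi> f + 2 * composition_energy \<alpha> \<psi> \<phi> f"
      by (rule weighted_area_deriv_weighted_comp_op_le[OF hol self fh])
    also have "\<dots> \<le> 2 * (ennreal (C1 * d) * ennreal P) + 2 * ennreal (q\<^sup>2 * C2 * d)"
      using C1(2)[OF f] C2''[OF f] unfolding d_def P(1) by (intro add_mono mult_left_mono) auto
    also have "\<dots> = ennreal (E * d)"
    proof -
      have "E * d = 2 * (C1 * d * P) + 2 * (q\<^sup>2 * C2 * d)" by (simp add: E_def algebra_simps)
      thus ?thesis using d P(2) C1(1) C2 by (simp add: ennreal_mult ennreal_plus)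
    qed
    finally have "weighted_area \<alpha> (deriv (?T f)) \<le> ennreal (E * d)" .
    with C3(2)[OF weighted_comp_op_holomorphic[OF hol self fh], of "E * d"] E d
    have *: "?T f \<in> dirichlet_space \<alpha>" "(dirichlet_norm \<alpha> (?T f))\<^sup>2 \<le> (cmod (?T f 0))\<^sup>2 + C3 * (E * d)" by auto
    have "(cmod (?T f 0))\<^sup>2 \<le> (cmod (\<psi> 0))\<^sup>2 * (C4 * d)"
      using C4(2)[OF f, of 0] by (simp add: weighted_comp_op_def norm_mult power_mult_distrib d_def mult_left_mono)
    with * show ?thesis by (simp add: N_def d_def algebra_simps)
  qed
  have "linear_on_dirichlet \<alpha> ?T"
    unfolding linear_on_dirichlet_def using main by (auto simp: weighted_comp_op_def algebra_simps)
  moreover have "dirichlet_norm \<alpha> (?T f) \<le> sqrt N * dirichlet_norm \<alpha> f" if f: "f \<in> dirichlet_space \<alpha>" for f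
  proof (rule power2_le_imp_le)
    show "(dirichlet_norm \<alpha> (?T f))\<^sup>2 \<le> (sqrt N * dirichlet_norm \<alpha> f)\<^sup>2"
      using main[OF f] N by (simp add: power_mult_distrib)
    show "0 \<le> sqrt N * dirichlet_norm \<alpha> f" using N dirichlet_norm_nonneg[OF f] by simp
  qed
  ultimately show ?thesis unfolding bounded_on_dirichlet_def by blast
qed

section \<open>Compactness\<close>

text \<open>
  Differentiation costs a factor \<open>n + 1\<close> in the coefficients, and raising the parameter by 2 pays for it. Point
  evaluation in the larger space then bounds \<open>f'\<close> locally by the norm of \<open>f\<close>.
\<close>

lemma deriv_in_dirichlet_space:
  assumes a: "\<alpha> \<le> 1" and f: "f \<in> dirichlet_space \<alpha>"
  shows "deriv f \<in> dirichlet_space (\<alpha> + 2)" "dirichlet_norm (\<alpha> + 2) (deriv f) \<le> dirichlet_norm \<alpha> f"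
proof -
  have hol: "f holomorphic_on unit_disc" and sm: "summable (dirichlet_term \<alpha> f)"
    using f by (auto simp: dirichlet_space_def)
  have sm1: "summable (\<lambda>n. dirichlet_term \<alpha> f (n + 1))" using sm by (simp add: summable_Suc_iff)
  have le: "dirichlet_term (\<alpha> + 2) (deriv f) n \<le> dirichlet_term \<alpha> f (n + 1)" for n
  proof -
    define m where "m = real (n + 1)"
    have m: "m \<ge> 1" by (simp add: m_def)
    have "dirichlet_term (\<alpha> + 2) (deriv f) n = (m powr (-1 - \<alpha>) * m\<^sup>2) * (cmod (taylor_coeff f (n + 1)))\<^sup>2"
      unfolding dirichlet_term_def taylor_coeff_deriv norm_mult power_mult_distrib norm_of_nat m_def[symmetric]
      by (simp add: mult_ac)
    also have "m powr (-1 - \<alpha>) * m\<^sup>2 = m powr (1 - \<alpha>)"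
      using m powr_add[of m "-1 - \<alpha>" 2] by (simp add: powr_numeral)
    also have "m powr (1 - \<alpha>) * (cmod (taylor_coeff f (n + 1)))\<^sup>2 \<le> (m + 1) powr (1 - \<alpha>) * (cmod (taylor_coeff f (n + 1)))\<^sup>2"
      using m a by (intro mult_right_mono powr_mono2) auto
    also have "\<dots> = dirichlet_term \<alpha> f (n + 1)" by (simp add: dirichlet_term_def m_def add.commute)
    finally show ?thesis .
  qed
  have sm2: "summable (dirichlet_term (\<alpha> + 2) (deriv f))"
    by (rule summable_comparison_test'[OF sm1]) (use le in auto)
  thus "deriv f \<in> dirichlet_space (\<alpha> + 2)"
    using hol by (simp add: dirichlet_space_def deriv_holomorphic_disc)
  have "suminf (dirichlet_term (\<alpha> + 2) (deriv f)) \<le> (\<Sum>n. dirichlet_term \<alpha> f (n + 1))"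
    by (rule suminf_le[OF le sm2 sm1])
  also have "\<dots> \<le> suminf (dirichlet_term \<alpha> f)"
    using suminf_split_head[OF sm] by simp
  finally show "dirichlet_norm (\<alpha> + 2) (deriv f) \<le> dirichlet_norm \<alpha> f"
    by (simp add: dirichlet_norm_def)
qed

text \<open>
  The integrands tend to 0 pointwise and are dominated by a multiple of the integrable function \<open>|\<psi>'|\<^sup>2\<close>.
\<close>

lemma derivative_energy_tendsto_0:
  assumes a: "\<alpha> > 0" and hol: "\<psi> holomorphic_on unit_disc" "\<phi> holomorphic_on unit_disc" and self: "\<phi> ` unit_disc \<subseteq> unit_disc"
    and fin: "weighted_area 0 (deriv \<psi>) < \<infinity>"
    and h: "\<And>n. h n \<in> dirichlet_space \<alpha>" and bd: "\<And>n. (dirichlet_norm \<alpha> (h n))\<^sup>2 \<le> B"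
    and lim: "\<And>z. z \<in> unit_disc \<Longrightarrow> (\<lambda>n. h n z) \<longlonglongrightarrow> 0"
  shows "(\<lambda>n. derivative_energy \<alpha> \<psi> \<phi> (h n)) \<longlonglongrightarrow> 0"
proof -
  have hh: "h n holomorphic_on unit_disc" for n using h[of n] by (simp add: dirichlet_space_def)
  have B: "B \<ge> 0" using order_trans[OF zero_le_power2 bd] .
  obtain C where C: "C > 0" "\<And>f z. f \<in> dirichlet_space \<alpha> \<Longrightarrow> z \<in> unit_disc \<Longrightarrow>
     (cmod (deriv \<psi> z * f (\<phi> z)))\<^sup>2 * (1 - (cmod z)\<^sup>2) powr \<alpha> \<le>
     C * (dirichlet_norm \<alpha> f)\<^sup>2 * ((cmod (deriv \<psi> z))\<^sup>2 * (1 - (cmod z)\<^sup>2) powr 0)"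
    using derivative_energy_integrand_le[OF a hol(2) self] by blast
  define G where "G = (\<lambda>z. ennreal ((cmod (deriv \<psi> z))\<^sup>2 * (1 - (cmod z)\<^sup>2) powr 0) * indicator unit_disc z)"
  have [measurable]: "G \<in> borel_measurable borel" unfolding G_def
    by (rule borel_measurable_cont_indicator[OF weighted_area_integrand_continuous[OF deriv_holomorphic_disc[OF hol(1)]]]) auto
  define F where "F = (\<lambda>n z. ennreal ((cmod (deriv \<psi> z * h n (\<phi> z)))\<^sup>2 * (1 - (cmod z)\<^sup>2) powr \<alpha>) * indicator unit_disc z)"
  have [measurable]: "F n \<in> borel_measurable borel" for n unfolding F_def
    by (rule borel_measurable_cont_indicator[OF energy_integrands_continuous(1)[OF hol self hh]]) auto
  have "(\<lambda>n. \<integral>\<^sup>+z. F n z \<partial>lborel) \<longlonglongrightarrow> (\<integral>\<^sup>+z. 0 \<partial>(lborel :: complex measure))"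
  proof (rule nn_integral_dominated_convergence[where w = "\<lambda>z. ennreal (C * B) * G z"])
    show "AE z in lborel. F n z \<le> ennreal (C * B) * G z" for n
    proof (intro AE_I2)
      fix z :: complex
      show "F n z \<le> ennreal (C * B) * G z"
      proof (cases "z \<in> unit_disc")
        case True
        have "(cmod (deriv \<psi> z * h n (\<phi> z)))\<^sup>2 * (1 - (cmod z)\<^sup>2) powr \<alpha> \<le>
           C * (dirichlet_norm \<alpha> (h n))\<^sup>2 * ((cmod (deriv \<psi> z))\<^sup>2 * (1 - (cmod z)\<^sup>2) powr 0)"
          by (rule C(2)[OF h True])
        also have "\<dots> \<le> C * B * ((cmod (deriv \<psi> z))\<^sup>2 * (1 - (cmod z)\<^sup>2) powr 0)"
          using C(1) bd[of n] by (intro mult_right_mono mult_left_mono) auto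
        finally have "F n z \<le> ennreal (C * B * ((cmod (deriv \<psi> z))\<^sup>2 * (1 - (cmod z)\<^sup>2) powr 0))"
          using True by (simp add: F_def ennreal_leI)
        also have "\<dots> = ennreal (C * B) * ennreal ((cmod (deriv \<psi> z))\<^sup>2 * (1 - (cmod z)\<^sup>2) powr 0)"
          using C(1) B by (intro ennreal_mult) auto
        finally show ?thesis using True by (simp add: G_def)
      qed (simp add: F_def)
    qed
    have "(\<integral>\<^sup>+z. ennreal (C * B) * G z \<partial>lborel) = ennreal (C * B) * weighted_area 0 (deriv \<psi>)"
      unfolding weighted_area_def G_def[symmetric] by (rule nn_integral_cmult) measurable
    also have "\<dots> < \<infinity>" using fin by (simp add: ennreal_mult_less_top)
    finally show "(\<integral>\<^sup>+z. ennreal (C * B) * G z \<partial>lborel) < \<infinity>" .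
    show "AE z in lborel. (\<lambda>n. F n z) \<longlonglongrightarrow> 0"
    proof (intro AE_I2)
      fix z :: complex
      show "(\<lambda>n. F n z) \<longlonglongrightarrow> 0"
      proof (cases "z \<in> unit_disc")
        case True
        hence w: "\<phi> z \<in> unit_disc" using self by blast
        have "(\<lambda>n. (cmod (deriv \<psi> z * h n (\<phi> z)))\<^sup>2 * (1 - (cmod z)\<^sup>2) powr \<alpha>) \<longlonglongrightarrow> (cmod (deriv \<psi> z * 0))\<^sup>2 * (1 - (cmod z)\<^sup>2) powr \<alpha>"
          by (intro tendsto_intros lim w)
        hence "(\<lambda>n. ennreal ((cmod (deriv \<psi> z * h n (\<phi> z)))\<^sup>2 * (1 - (cmod z)\<^sup>2) powr \<alpha>)) \<longlonglongrightarrow> ennreal ((cmod (deriv \<psi> z * 0))\<^sup>2 * (1 - (cmod z)\<^sup>2) powr \<alpha>)"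
          by (rule tendsto_ennrealI)
        thus ?thesis using True by (simp add: F_def)
      qed (simp add: F_def)
    qed
  qed measurable
  thus ?thesis by (simp add: derivative_energy_def F_def)
qed

text \<open>
  On a smaller disc the integrands are uniformly bounded: the derivatives \<open>h\<^sub>n'\<close> lie in a bounded subset of the
  space with parameter \<open>\<alpha> + 2\<close>, so \<open>|h\<^sub>n'(\<phi>(z))|\<^sup>2 (1 - |z|\<^sup>2)\<^bsup>\<alpha>+2\<^esup>\<close> is bounded. Pointwise convergence
  therefore suffices.
\<close>

lemma composition_energy_on_cball_tendsto_0:
  assumes a: "0 < \<alpha>" "\<alpha> < 1" and hol: "\<psi> holomorphic_on unit_disc" "\<phi> holomorphic_on unit_disc" and self: "\<phi> ` unit_disc \<subseteq> unit_disc"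
    and h: "\<And>n. h n \<in> dirichlet_space \<alpha>" and bd: "\<And>n. (dirichlet_norm \<alpha> (h n))\<^sup>2 \<le> B"
    and lim: "\<And>z. z \<in> unit_disc \<Longrightarrow> (\<lambda>n. deriv (h n) z) \<longlonglongrightarrow> 0" and r: "r < 1"
  shows "(\<lambda>n. \<integral>\<^sup>+z\<in>cball 0 r. ennreal ((cmod (\<psi> z * deriv (h n) (\<phi> z) * deriv \<phi> z))\<^sup>2 * (1 - (cmod z)\<^sup>2) powr \<alpha>) \<partial>lborel) \<longlonglongrightarrow> 0"
proof -
  have hh: "h n holomorphic_on unit_disc" for n using h[of n] by (simp add: dirichlet_space_def)
  have sub: "cball 0 r \<subseteq> unit_disc" using r by auto
  have [measurable]: "(indicator (cball 0 r) :: complex \<Rightarrow> ennreal) \<in> borel_measurable borel"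
    by (rule borel_measurable_indicator) simp
  have "\<alpha> + 2 > 0" using a by simp
  from compose_growth[OF this hol(2) self]
  obtain C where C: "C > 0" "\<And>f z. f \<in> dirichlet_space (\<alpha> + 2) \<Longrightarrow> z \<in> unit_disc \<Longrightarrow>
     (cmod (f (\<phi> z)))\<^sup>2 * (1 - (cmod z)\<^sup>2) powr (\<alpha> + 2) \<le> C * (dirichlet_norm (\<alpha> + 2) f)\<^sup>2"
    by blast
  define u where "u = (\<lambda>z. (cmod (\<psi> z))\<^sup>2 * (cmod (deriv \<phi> z))\<^sup>2 * (1 - (cmod z)\<^sup>2) powr (-2) * (C * B))"
  have "continuous_on (cball 0 r) u"
    unfolding u_def
    by (rule continuous_on_subset[OF _ sub])
       (intro continuous_intros continuous_on_one_minus_norm_sq_powr holomorphic_on_imp_continuous_on deriv_holomorphic_disc hol)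
  hence "compact (u ` cball 0 r)" by (intro compact_continuous_image compact_cball)
  hence "bdd_above (u ` cball 0 r)" by (intro bounded_imp_bdd_above compact_imp_bounded)
  then obtain M where M: "\<And>z. z \<in> cball 0 r \<Longrightarrow> u z \<le> M" unfolding bdd_above_def by blast
  define F where "F = (\<lambda>n z. ennreal ((cmod (\<psi> z * deriv (h n) (\<phi> z) * deriv \<phi> z))\<^sup>2 * (1 - (cmod z)\<^sup>2) powr \<alpha>) * indicator (cball 0 r) z)"
  have [measurable]: "F n \<in> borel_measurable borel" for n unfolding F_def
    by (rule borel_measurable_cont_indicator[OF energy_integrands_continuous(2)[OF hol self hh]]) (use sub in auto)
  have "(\<lambda>n. \<integral>\<^sup>+z. F n z \<partial>lborel) \<longlonglongrightarrow> (\<integral>\<^sup>+z. 0 \<partial>(lborel :: complex measure))"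
  proof (rule nn_integral_dominated_convergence[where w = "\<lambda>z. ennreal M * indicator (cball 0 r) z"])
    show "AE z in lborel. F n z \<le> ennreal M * indicator (cball 0 r) z" for n
    proof (intro AE_I2)
      fix z :: complex
      show "F n z \<le> ennreal M * indicator (cball 0 r) z"
      proof (cases "z \<in> cball 0 r")
        case True
        hence z: "z \<in> unit_disc" using sub by blast
        define t where "t = 1 - (cmod z)\<^sup>2"
        have t: "t > 0" using one_minus_norm_sq_pos[OF z] by (simp add: t_def)
        have "(cmod (deriv (h n) (\<phi> z)))\<^sup>2 * t powr (\<alpha> + 2) \<le> C * (dirichlet_norm (\<alpha> + 2) (deriv (h n)))\<^sup>2"
          unfolding t_def by (rule C(2)[OF deriv_in_dirichlet_space(1)[OF _ h] z]) (use a in simp)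
        also have "\<dots> \<le> C * B"
        proof (rule mult_left_mono)
          have "(dirichlet_norm (\<alpha> + 2) (deriv (h n)))\<^sup>2 \<le> (dirichlet_norm \<alpha> (h n))\<^sup>2"
            using deriv_in_dirichlet_space[of \<alpha>, OF _ h[of n]] a by (intro power_mono dirichlet_norm_nonneg) auto
          thus "(dirichlet_norm (\<alpha> + 2) (deriv (h n)))\<^sup>2 \<le> B" using bd[of n] by linarith
        qed (use C(1) in simp)
        finally have d: "(cmod (deriv (h n) (\<phi> z)))\<^sup>2 * t powr (\<alpha> + 2) \<le> C * B" .
        have tp: "t powr \<alpha> = t powr (\<alpha> + 2) * t powr (-2)" using t by (simp flip: powr_add)
        have "(cmod (\<psi> z * deriv (h n) (\<phi> z) * deriv \<phi> z))\<^sup>2 * t powr \<alpha> =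
           (cmod (\<psi> z))\<^sup>2 * (cmod (deriv \<phi> z))\<^sup>2 * t powr (-2) * ((cmod (deriv (h n) (\<phi> z)))\<^sup>2 * t powr (\<alpha> + 2))"
          unfolding tp norm_mult power_mult_distrib by (simp only: mult_ac)
        also have "\<dots> \<le> u z" unfolding u_def t_def[symmetric] by (intro mult_left_mono d) auto
        also have "\<dots> \<le> M" by (rule M[OF True])
        finally show ?thesis using True by (simp add: F_def t_def ennreal_leI)
      qed (simp add: F_def)
    qed
    show "(\<integral>\<^sup>+z. ennreal M * indicator (cball 0 r) z \<partial>(lborel :: complex measure)) < \<infinity>"
      using emeasure_lborel_cball_finite[of "0::complex" r] by (simp add: nn_integral_cmult_indicator ennreal_mult_less_top)
    show "AE z in lborel. (\<lambda>n. F n z) \<longlonglongrightarrow> 0"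
    proof (intro AE_I2)
      fix z :: complex
      show "(\<lambda>n. F n z) \<longlonglongrightarrow> 0"
      proof (cases "z \<in> cball 0 r")
        case True
        hence w: "\<phi> z \<in> unit_disc" using self sub by blast
        have "(\<lambda>n. (cmod (\<psi> z * deriv (h n) (\<phi> z) * deriv \<phi> z))\<^sup>2 * (1 - (cmod z)\<^sup>2) powr \<alpha>) \<longlonglongrightarrow>
            (cmod (\<psi> z * 0 * deriv \<phi> z))\<^sup>2 * (1 - (cmod z)\<^sup>2) powr \<alpha>"
          by (intro tendsto_intros lim w)
        hence "(\<lambda>n. ennreal ((cmod (\<psi> z * deriv (h n) (\<phi> z) * deriv \<phi> z))\<^sup>2 * (1 - (cmod z)\<^sup>2) powr \<alpha>)) \<longlonglongrightarrow>
           ennreal ((cmod (\<psi> z * 0 * deriv \<phi> z))\<^sup>2 * (1 - (cmod z)\<^sup>2) powr \<alpha>)"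
          by (rule tendsto_ennrealI)
        thus ?thesis using True by (simp add: F_def)
      qed (simp add: F_def)
    qed
  qed measurable
  thus ?thesis by (simp add: F_def)
qed

text \<open>
  Near the boundary \<open>q\<^sup>2 \<le> \<delta>\<close>, so the annulus contributes at most \<open>\<delta>\<close> times a bound for the norms; on the
  remaining disc the energy tends to 0.
\<close>

lemma composition_energy_tendsto_0:
  assumes a: "0 < \<alpha>" "\<alpha> < 1" and hol: "\<psi> holomorphic_on unit_disc" "\<phi> holomorphic_on unit_disc"
    and self: "\<phi> ` unit_disc \<subseteq> unit_disc" and inj: "inj_on \<phi> unit_disc"
    and q: "(boundary_ratio \<alpha> \<psi> \<phi> \<longlongrightarrow> 0) (cmod going_to at_left 1)"
    and h: "\<And>n. h n \<in> dirichlet_space \<alpha>" and bd: "\<And>n. (dirichlet_norm \<alpha> (h n))\<^sup>2 \<le> B"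
    and lim: "\<And>z. z \<in> unit_disc \<Longrightarrow> (\<lambda>n. deriv (h n) z) \<longlonglongrightarrow> 0"
  shows "(\<lambda>n. composition_energy \<alpha> \<psi> \<phi> (h n)) \<longlonglongrightarrow> 0"
proof (rule order_tendstoI)
  fix e :: ennreal assume "0 < e"
  then obtain \<epsilon> where e: "\<epsilon> > 0" "ennreal \<epsilon> < e"
    by (metis ennreal_0 ennreal_less_zero_iff ennreal_rat_dense ennreal_less_iff leD linorder_le_less_linear order_refl)
  have hh: "h n holomorphic_on unit_disc" for n using h[of n] by (simp add: dirichlet_space_def)
  have B: "B \<ge> 0" using order_trans[OF zero_le_power2 bd] .
  obtain C where C: "C > 0" and C': "\<And>A M f. f \<in> dirichlet_space \<alpha> \<Longrightarrow> A \<subseteq> unit_disc \<Longrightarrow>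
       (\<And>z. z \<in> A \<Longrightarrow> (boundary_ratio \<alpha> \<psi> \<phi> z)\<^sup>2 \<le> M) \<Longrightarrow> 0 \<le> M \<Longrightarrow>
     (\<integral>\<^sup>+z\<in>A. ennreal ((cmod (\<psi> z * deriv f (\<phi> z) * deriv \<phi> z))\<^sup>2 * (1 - (cmod z)\<^sup>2) powr \<alpha>) \<partial>lborel)
       \<le> ennreal (M * C * (dirichlet_norm \<alpha> f)\<^sup>2)"
    using composition_energy_on_subset_le[OF a hol(2) self inj, of \<psi>] by blast
  define \<delta> where "\<delta> = \<epsilon> / (2 * C * (B + 1))"
  have d: "\<delta> > 0" using e C B by (simp add: \<delta>_def)
  have dCB: "\<delta> * C * B \<le> \<epsilon> / 2"
  proof -
    have "\<delta> * C * B \<le> \<delta> * C * (B + 1)" using d C by (intro mult_left_mono) auto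
    also have "\<dots> = \<epsilon> / 2"
    proof -
      define b where "b = B + 1"
      have "b > 0" using B by (simp add: b_def)
      thus ?thesis using C by (simp add: \<delta>_def flip: b_def)
    qed
    finally show ?thesis .
  qed
  have "eventually (\<lambda>z. boundary_ratio \<alpha> \<psi> \<phi> z < sqrt \<delta>) (cmod going_to at_left 1)"
    using q d by (intro order_tendstoD) auto
  then obtain r where r: "r < 1" "\<And>z. r < cmod z \<Longrightarrow> cmod z < 1 \<Longrightarrow> boundary_ratio \<alpha> \<psi> \<phi> z < sqrt \<delta>"
    unfolding eventually_going_to_unit_circle by blast
  have sub: "cball 0 r \<subseteq> unit_disc" using r(1) by auto
  let ?I = "\<lambda>n z. ennreal ((cmod (\<psi> z * deriv (h n) (\<phi> z) * deriv \<phi> z))\<^sup>2 * (1 - (cmod z)\<^sup>2) powr \<alpha>)"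
  have outer: "(\<integral>\<^sup>+z\<in>unit_disc - cball 0 r. ?I n z \<partial>lborel) \<le> ennreal (\<epsilon> / 2)" for n
  proof -
    have "(\<integral>\<^sup>+z\<in>unit_disc - cball 0 r. ?I n z \<partial>lborel) \<le> ennreal (\<delta> * C * (dirichlet_norm \<alpha> (h n))\<^sup>2)"
    proof (rule C'[OF h])
      fix z assume "z \<in> unit_disc - cball 0 r"
      hence "boundary_ratio \<alpha> \<psi> \<phi> z < sqrt \<delta>" by (intro r(2)) auto
      hence "(boundary_ratio \<alpha> \<psi> \<phi> z)\<^sup>2 \<le> (sqrt \<delta>)\<^sup>2"
        by (intro power_mono) (auto simp: boundary_ratio_def)
      thus "(boundary_ratio \<alpha> \<psi> \<phi> z)\<^sup>2 \<le> \<delta>" using d by simp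
    qed (use d in auto)
    also have "\<dots> \<le> ennreal (\<epsilon> / 2)"
    proof (rule ennreal_leI)
      have "\<delta> * C * (dirichlet_norm \<alpha> (h n))\<^sup>2 \<le> \<delta> * C * B"
        using d C bd[of n] by (intro mult_left_mono) auto
      thus "\<delta> * C * (dirichlet_norm \<alpha> (h n))\<^sup>2 \<le> \<epsilon> / 2" using dCB by linarith
    qed
    finally show ?thesis .
  qed
  have "eventually (\<lambda>n. (\<integral>\<^sup>+z\<in>cball 0 r. ?I n z \<partial>lborel) < ennreal (\<epsilon> / 2)) sequentially"
    by (rule order_tendstoD(2)[OF composition_energy_on_cball_tendsto_0[OF a hol self h bd lim r(1)]]) (use e in auto)
  thus "eventually (\<lambda>n. composition_energy \<alpha> \<psi> \<phi> (h n) < e) sequentially"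
  proof eventually_elim
    case (elim n)
    have cm: "(\<lambda>z. ?I n z * indicator A z) \<in> borel_measurable borel" if "A \<subseteq> unit_disc" "A \<in> sets borel" for A
      using borel_measurable_cont_indicator[OF energy_integrands_continuous(2)[OF hol self hh] that(2,1)] .
    have "composition_energy \<alpha> \<psi> \<phi> (h n) = 
       (\<integral>\<^sup>+z. ?I n z * indicator (cball 0 r) z + ?I n z * indicator (unit_disc - cball 0 r) z \<partial>lborel)"
      unfolding composition_energy_def using r(1)
      by (intro nn_integral_cong) (auto simp: indicator_def)
    also have "\<dots> = (\<integral>\<^sup>+z\<in>cball 0 r. ?I n z \<partial>lborel) + (\<integral>\<^sup>+z\<in>unit_disc - cball 0 r. ?I n z \<partial>lborel)"
      by (rule nn_integral_add) (use cm[OF sub] cm[of "unit_disc - cball 0 r"] in auto)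
    also have "\<dots> \<le> ennreal (\<epsilon> / 2) + ennreal (\<epsilon> / 2)"
      using elim outer[of n] by (intro add_mono) auto
    also have "\<dots> = ennreal \<epsilon>" using e by (simp flip: ennreal_plus)
    finally show ?case using e(2) by (rule le_less_trans)
  qed
qed simp

lemma weighted_comp_op_norm_tendsto_0:
  assumes a: "0 < \<alpha>" "\<alpha> < 1" and hol: "\<psi> holomorphic_on unit_disc" "\<phi> holomorphic_on unit_disc"
    and self: "\<phi> ` unit_disc \<subseteq> unit_disc" and inj: "inj_on \<phi> unit_disc"
    and fin: "weighted_area 0 (deriv \<psi>) < \<infinity>"
    and q: "(boundary_ratio \<alpha> \<psi> \<phi> \<longlongrightarrow> 0) (cmod going_to at_left 1)"
    and h: "\<And>n. h n \<in> dirichlet_space \<alpha>" and bd: "\<And>n. (dirichlet_norm \<alpha> (h n))\<^sup>2 \<le> B"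
    and lim: "\<And>z. z \<in> unit_disc \<Longrightarrow> (\<lambda>n. h n z) \<longlonglongrightarrow> 0"
    and lim': "\<And>z. z \<in> unit_disc \<Longrightarrow> (\<lambda>n. deriv (h n) z) \<longlonglongrightarrow> 0"
  shows "(\<lambda>n. dirichlet_norm \<alpha> (weighted_comp_op \<psi> \<phi> (h n))) \<longlonglongrightarrow> 0"
proof -
  let ?T = "weighted_comp_op \<psi> \<phi>"
  have hh: "h n holomorphic_on unit_disc" for n using h[of n] by (simp add: dirichlet_space_def)
  obtain C where C: "C > 0" "\<And>f E. f holomorphic_on unit_disc \<Longrightarrow> 0 \<le> E \<Longrightarrow> weighted_area \<alpha> (deriv f) \<le> ennreal E \<Longrightarrow>
     f \<in> dirichlet_space \<alpha> \<and> (dirichlet_norm \<alpha> f)\<^sup>2 \<le> (cmod (f 0))\<^sup>2 + C * E"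
    using dirichlet_norm_le_weighted_area_deriv[OF a] by blast
  define W where "W = (\<lambda>n. 2 * derivative_energy \<alpha> \<psi> \<phi> (h n) + 2 * composition_energy \<alpha> \<psi> \<phi> (h n))"
  have "W \<longlonglongrightarrow> 2 * 0 + 2 * 0" unfolding W_def
    by (intro tendsto_add ennreal_tendsto_cmult derivative_energy_tendsto_0[OF a(1) hol self fin h bd lim]
      composition_energy_tendsto_0[OF a hol self inj q h bd lim']) auto
  hence W: "W \<longlonglongrightarrow> 0" by simp
  have W_fin: "eventually (\<lambda>n. W n < \<infinity>) sequentially" by (rule order_tendstoD(2)[OF W]) simp
  have W': "(\<lambda>n. enn2real (W n)) \<longlonglongrightarrow> 0" using tendsto_enn2real[of W 0 sequentially] W by simp
  have "0 \<in> unit_disc" by simp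
  hence p0: "\<phi> 0 \<in> unit_disc" using self by blast
  have "(\<lambda>n. (cmod (?T (h n) 0))\<^sup>2 + C * enn2real (W n)) \<longlonglongrightarrow> (cmod (\<psi> 0 * 0))\<^sup>2 + C * 0"
    unfolding weighted_comp_op_def by (intro tendsto_intros lim p0 W')
  hence up: "(\<lambda>n. (cmod (?T (h n) 0))\<^sup>2 + C * enn2real (W n)) \<longlonglongrightarrow> 0" by simp
  have "(\<lambda>n. (dirichlet_norm \<alpha> (?T (h n)))\<^sup>2) \<longlonglongrightarrow> 0"
  proof (rule tendsto_sandwich[OF _ _ tendsto_const up])
    show "eventually (\<lambda>n. (dirichlet_norm \<alpha> (?T (h n)))\<^sup>2 \<le> (cmod (?T (h n) 0))\<^sup>2 + C * enn2real (W n)) sequentially"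
      using W_fin
    proof eventually_elim
      case (elim n)
      have "weighted_area \<alpha> (deriv (?T (h n))) \<le> W n" unfolding W_def
        by (rule weighted_area_deriv_weighted_comp_op_le[OF hol self hh])
      also have "\<dots> = ennreal (enn2real (W n))" using elim by simp
      finally show ?case using C(2)[OF weighted_comp_op_holomorphic[OF hol self hh], of "enn2real (W n)" n] by simp
    qed
  qed auto
  hence "(\<lambda>n. sqrt ((dirichlet_norm \<alpha> (?T (h n)))\<^sup>2)) \<longlonglongrightarrow> sqrt 0" by (intro tendsto_real_sqrt)
  thus ?thesis by (simp add: tendsto_rabs_zero_iff)
qed

text \<open>
  Norm-bounded sets in \<open>D\<^sub>\<alpha>\<close> are locally bounded, so Montel's theorem applies. Locally uniform convergence
  implies convergence of each Taylor coefficient, and the bound on the partial sums of the norm series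
  passes to the limit function.
\<close>

lemma dirichlet_bounded_sequence_subsequence:
  fixes f :: "nat \<Rightarrow> complex \<Rightarrow> complex"
  assumes a: "\<alpha> > 0" and f: "\<And>n. f n \<in> dirichlet_space \<alpha>" and bd: "\<And>n. dirichlet_norm \<alpha> (f n) \<le> B"
  shows "\<exists>r g. strict_mono (r :: nat \<Rightarrow> nat) \<and> g \<in> dirichlet_space \<alpha> \<and>
     (\<forall>z\<in>unit_disc. (\<lambda>n. f (r n) z - g z) \<longlonglongrightarrow> 0) \<and>
     (\<forall>z\<in>unit_disc. (\<lambda>n. deriv (\<lambda>z. f (r n) z - g z) z) \<longlonglongrightarrow> 0)"
proof -
  have fh: "f n holomorphic_on unit_disc" for n using f[of n] by (simp add: dirichlet_space_def)
  have B2: "(dirichlet_norm \<alpha> (f n))\<^sup>2 \<le> B\<^sup>2" for n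
    using bd[of n] dirichlet_norm_nonneg[OF f[of n]] by (intro power_mono)
  obtain C where C: "C > 0" "\<And>f z. f \<in> dirichlet_space \<alpha> \<Longrightarrow> z \<in> unit_disc \<Longrightarrow>
     (cmod (f z))\<^sup>2 * (1 - (cmod z)\<^sup>2) powr \<alpha> \<le> C * (dirichlet_norm \<alpha> f)\<^sup>2"
    using dirichlet_growth[OF a] by blast
  obtain g r where g: "g holomorphic_on unit_disc" and r: "strict_mono (r :: nat \<Rightarrow> nat)"
    and ul: "\<And>K. compact K \<Longrightarrow> K \<subseteq> unit_disc \<Longrightarrow> uniform_limit K (f \<circ> r) g sequentially"
  proof (rule Montel[of unit_disc "range f" f])
    fix K :: "complex set" assume K: "compact K" "K \<subseteq> unit_disc"
    define u where "u = (\<lambda>z::complex. sqrt (C * B\<^sup>2 * (1 - (cmod z)\<^sup>2) powr (-\<alpha>)))"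
    have "continuous_on K u" unfolding u_def
      by (rule continuous_on_subset[OF _ K(2)]) (intro continuous_intros continuous_on_one_minus_norm_sq_powr)
    hence "bdd_above (u ` K)"
      by (intro bounded_imp_bdd_above compact_imp_bounded compact_continuous_image K)
    then obtain M where M: "\<And>z. z \<in> K \<Longrightarrow> u z \<le> M" unfolding bdd_above_def by blast
    have "cmod (f n z) \<le> M" if z: "z \<in> K" for n z
    proof -
      have zd: "z \<in> unit_disc" using z K by blast
      define t where "t = 1 - (cmod z)\<^sup>2"
      have t: "t > 0" using one_minus_norm_sq_pos[OF zd] by (simp add: t_def)
      have "(cmod (f n z))\<^sup>2 = (cmod (f n z))\<^sup>2 * t powr \<alpha> * t powr (-\<alpha>)"
        using t by (simp add: mult.assoc flip: powr_add)
      also have "\<dots> \<le> C * (dirichlet_norm \<alpha> (f n))\<^sup>2 * t powr (-\<alpha>)"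
        unfolding t_def by (intro mult_right_mono C(2)[OF f zd]) auto
      also have "\<dots> \<le> C * B\<^sup>2 * t powr (-\<alpha>)"
        using C(1) B2[of n] by (intro mult_right_mono mult_left_mono) auto
      finally have "cmod (f n z) \<le> u z" unfolding u_def t_def by (rule real_le_rsqrt)
      thus ?thesis using M[OF z] by linarith
    qed
    thus "\<exists>B. \<forall>h\<in>range f. \<forall>z\<in>K. cmod (h z) \<le> B" by blast
  qed (use fh in auto)
  have ulb: "uniform_limit (ball 0 \<rho>) (f \<circ> r) g sequentially" if "\<rho> < 1" for \<rho>
    by (rule uniform_limit_on_subset[OF ul[of "cball 0 \<rho>"]]) (use that in auto)
  have hd: "(\<lambda>n. (deriv ^^ m) (f (r n)) z) \<longlonglongrightarrow> (deriv ^^ m) g z" if "z \<in> unit_disc" for m z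
  proof -
    have "cmod z < 1" using that by simp
    then obtain \<rho> where rho: "cmod z < \<rho>" "\<rho> < 1" using dense by blast
    have "(\<lambda>n. (deriv ^^ m) ((f \<circ> r) n) z) \<longlonglongrightarrow> (deriv ^^ m) g z"
      by (rule higher_deriv_complex_uniform_limit[OF ulb[OF rho(2)]])
         (use rho in \<open>auto intro!: always_eventually holomorphic_on_subset[OF fh]\<close>)
    thus ?thesis by simp
  qed
  have dt: "(\<lambda>n. dirichlet_term \<alpha> (f (r n)) k) \<longlonglongrightarrow> dirichlet_term \<alpha> g k" for k
    unfolding dirichlet_term_def fps_expansion_def fps_nth_Abs_fps
    by (intro tendsto_intros hd) auto
  have partial: "(\<Sum>k<N. dirichlet_term \<alpha> g k) \<le> B\<^sup>2" for N
  proof (rule LIMSEQ_le_const2)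
    show "(\<lambda>n. \<Sum>k<N. dirichlet_term \<alpha> (f (r n)) k) \<longlonglongrightarrow> (\<Sum>k<N. dirichlet_term \<alpha> g k)"
      by (intro tendsto_sum dt)
    have "(\<Sum>k<N. dirichlet_term \<alpha> (f (r n)) k) \<le> B\<^sup>2" for n
    proof -
      have "(\<Sum>k<N. dirichlet_term \<alpha> (f (r n)) k) \<le> (dirichlet_norm \<alpha> (f (r n)))\<^sup>2"
        unfolding dirichlet_norm_sq[OF f]
        using f[of "r n"] by (intro sum_le_suminf) (auto simp: dirichlet_space_def)
      thus ?thesis using B2[of "r n"] by linarith
    qed
    thus "\<exists>M. \<forall>n\<ge>M. (\<Sum>k<N. dirichlet_term \<alpha> (f (r n)) k) \<le> B\<^sup>2" by blast
  qed
  have "summable (dirichlet_term \<alpha> g)"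
    by (rule bounded_imp_summable[where B = "B\<^sup>2"]) (use partial[of "Suc _"] in \<open>auto simp: lessThan_Suc_atMost\<close>)
  hence gd: "g \<in> dirichlet_space \<alpha>" using g by (simp add: dirichlet_space_def)
  have "(\<lambda>n. f (r n) z - g z) \<longlonglongrightarrow> 0" if "z \<in> unit_disc" for z
    using hd[OF that, of 0] by (simp add: LIM_zero)
  moreover have "(\<lambda>n. deriv (\<lambda>z. f (r n) z - g z) z) \<longlonglongrightarrow> 0" if z: "z \<in> unit_disc" for z
  proof -
    have "deriv (\<lambda>z. f (r n) z - g z) z = deriv (f (r n)) z - deriv g z" for n
      by (intro deriv_diff holomorphic_on_imp_differentiable_at[OF fh open_ball z]
          holomorphic_on_imp_differentiable_at[OF g open_ball z])
    thus ?thesis using hd[OF z, of 1] by (simp add: LIM_zero)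
  qed
  ultimately show ?thesis using r gd by blast
qed

lemma bdd_above_of_boundary_limit:
  fixes u :: "complex \<Rightarrow> real"
  assumes cont: "continuous_on unit_disc u" and lim: "(u \<longlongrightarrow> 0) (cmod going_to at_left 1)"
  shows "bdd_above (u ` unit_disc)"
proof -
  have "eventually (\<lambda>z. u z < 1) (cmod going_to at_left 1)"
    using lim by (intro order_tendstoD) auto
  then obtain r where r: "r < 1" "\<And>z. r < cmod z \<Longrightarrow> cmod z < 1 \<Longrightarrow> u z < 1"
    unfolding eventually_going_to_unit_circle by blast
  have "cball 0 r \<subseteq> unit_disc" using r(1) by auto
  hence "bdd_above (u ` cball 0 r)"
    using cont continuous_on_subset
    by (intro bounded_imp_bdd_above compact_imp_bounded compact_continuous_image compact_cball) blast
  then obtain M where M: "\<And>z. z \<in> cball 0 r \<Longrightarrow> u z \<le> M" unfolding bdd_above_def by blast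
  have "u z \<le> max M 1" if "z \<in> unit_disc" for z
    using M[of z] r(2)[of z] that by (cases "cmod z \<le> r") (auto simp: le_max_iff_disj)
  thus ?thesis by (auto intro!: bdd_aboveI2)
qed

lemma continuous_on_boundary_ratio:
  assumes hol: "\<psi> holomorphic_on unit_disc" "\<phi> holomorphic_on unit_disc" and self: "\<phi> ` unit_disc \<subseteq> unit_disc"
  shows "continuous_on unit_disc (boundary_ratio \<alpha> \<psi> \<phi>)"
proof -
  have p: "1 - (cmod z)\<^sup>2 \<noteq> 0" "1 - (cmod (\<phi> z))\<^sup>2 \<noteq> 0" if "z \<in> unit_disc" for z
    using one_minus_norm_sq_pos[OF that] one_minus_norm_sq_pos[of "\<phi> z"] self that by force+
  show "continuous_on unit_disc (boundary_ratio \<alpha> \<psi> \<phi>)"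
    unfolding boundary_ratio_def[abs_def]
    by (intro continuous_intros holomorphic_on_imp_continuous_on hol ballI) (use p in auto)
qed

text \<open>
  With \<open>g\<close> the locally uniform limit of a subsequence, \<open>T g\<close> is the norm limit of its images.
\<close>

lemma boundary_ratio_tendsto_0_imp_compact:
  assumes a: "0 < \<alpha>" "\<alpha> < 1" and hol: "\<psi> holomorphic_on unit_disc" "\<phi> holomorphic_on unit_disc"
    and self: "\<phi> ` unit_disc \<subseteq> unit_disc" and inj: "inj_on \<phi> unit_disc"
    and fin: "weighted_area 0 (deriv \<psi>) < \<infinity>"
    and q: "(boundary_ratio \<alpha> \<psi> \<phi> \<longlongrightarrow> 0) (cmod going_to at_left 1)"
  shows "compact_on_dirichlet \<alpha> (weighted_comp_op \<psi> \<phi>)"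
proof -
  let ?T = "weighted_comp_op \<psi> \<phi>"
  have lin: "linear_on_dirichlet \<alpha> ?T"
    using boundary_ratio_bounded_imp_bounded[OF a hol self inj fin bdd_above_of_boundary_limit[OF continuous_on_boundary_ratio[OF hol self] q]]
    by (simp add: bounded_on_dirichlet_def)
  have "\<exists>r g. strict_mono (r :: nat \<Rightarrow> nat) \<and> g \<in> dirichlet_space \<alpha> \<and>
           (\<lambda>n. dirichlet_norm \<alpha> (\<lambda>z. ?T (f (r n)) z - g z)) \<longlonglongrightarrow> 0"
    if f: "range f \<subseteq> dirichlet_space \<alpha>" and bd: "bdd_above (range (\<lambda>n. dirichlet_norm \<alpha> (f n)))" for f :: "nat \<Rightarrow> complex \<Rightarrow> complex"
  proof -
    obtain B where B: "\<And>n. dirichlet_norm \<alpha> (f n) \<le> B" using bd unfolding bdd_above_def by blast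
    have fn: "f n \<in> dirichlet_space \<alpha>" for n using f by blast
    obtain r g where r: "strict_mono (r :: nat \<Rightarrow> nat)" and g: "g \<in> dirichlet_space \<alpha>"
      and lim: "\<And>z. z \<in> unit_disc \<Longrightarrow> (\<lambda>n. f (r n) z - g z) \<longlonglongrightarrow> 0"
      and lim': "\<And>z. z \<in> unit_disc \<Longrightarrow> (\<lambda>n. deriv (\<lambda>z. f (r n) z - g z) z) \<longlonglongrightarrow> 0"
      using dirichlet_bounded_sequence_subsequence[of \<alpha> f B, OF a(1) fn B] by blast
    define h where "h = (\<lambda>n z. f (r n) z - g z)"
    have h: "h n \<in> dirichlet_space \<alpha>" for n unfolding h_def by (rule dirichlet_space_diff(1)[OF fn g])
    have hb: "(dirichlet_norm \<alpha> (h n))\<^sup>2 \<le> 2 * B\<^sup>2 + 2 * (dirichlet_norm \<alpha> g)\<^sup>2" for n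
    proof -
      have "(dirichlet_norm \<alpha> (h n))\<^sup>2 \<le> 2 * (dirichlet_norm \<alpha> (f (r n)))\<^sup>2 + 2 * (dirichlet_norm \<alpha> g)\<^sup>2"
        unfolding h_def by (rule dirichlet_space_diff(2)[OF fn g])
      moreover have "(dirichlet_norm \<alpha> (f (r n)))\<^sup>2 \<le> B\<^sup>2"
        using B dirichlet_norm_nonneg[OF fn] by (intro power_mono) auto
      ultimately show ?thesis by linarith
    qed
    have "(\<lambda>n. dirichlet_norm \<alpha> (?T (h n))) \<longlonglongrightarrow> 0"
      by (rule weighted_comp_op_norm_tendsto_0[OF a hol self inj fin q h hb]) (use lim lim' in \<open>auto simp: h_def\<close>)
    moreover have "?T (h n) = (\<lambda>z. ?T (f (r n)) z - ?T g z)" for n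
      by (simp add: weighted_comp_op_def h_def algebra_simps)
    moreover have "?T g \<in> dirichlet_space \<alpha>" using lin g by (auto simp: linear_on_dirichlet_def)
    ultimately show ?thesis using r by auto
  qed
  thus ?thesis using lin unfolding compact_on_dirichlet_def by blast
qed

section \<open>Bounded and compact weighted composition operators\<close>

theorem theorem1p3:
  fixes \<alpha> :: real and \<phi> \<psi> :: "complex \<Rightarrow> complex"
  assumes alpha: "0 < \<alpha>" "\<alpha> < 1"
    and phi_hol: "\<phi> holomorphic_on unit_disc"
    and phi_self: "\<phi> ` unit_disc \<subseteq> unit_disc"
    and phi_univalent: "inj_on \<phi> unit_disc"
    and phi_deriv2: "deriv (deriv \<phi>) \<in> Hinf"
    and psi_hol: "\<psi> holomorphic_on unit_disc"
  shows
    "(bdd_above ((\<lambda>z. cmod (deriv (deriv \<psi>) z) * (1 - (cmod z)\<^sup>2)) ` unit_disc) \<longrightarrow>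
       (bounded_on_dirichlet \<alpha> (weighted_comp_op \<psi> \<phi>) \<longleftrightarrow>
        bdd_above ((\<lambda>z. cmod (\<psi> z) *
          ((1 - (cmod z)\<^sup>2) / (1 - (cmod (\<phi> z))\<^sup>2)) powr (\<alpha> / 2)) ` unit_disc)))
     \<and>
     (((\<lambda>z. cmod (deriv (deriv \<psi>) z) * (1 - (cmod z)\<^sup>2)) \<longlongrightarrow> 0) (cmod going_to at_left 1) \<longrightarrow>
       (compact_on_dirichlet \<alpha> (weighted_comp_op \<psi> \<phi>) \<longleftrightarrow>
        ((\<lambda>z. cmod (\<psi> z) *
          ((1 - (cmod z)\<^sup>2) / (1 - (cmod (\<phi> z))\<^sup>2)) powr (\<alpha> / 2)) \<longlongrightarrow> 0) (cmod going_to at_left 1)))"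
proof -
  have dd: "deriv (deriv \<psi>) holomorphic_on unit_disc"
    by (intro deriv_holomorphic_disc psi_hol)
  have fin: "weighted_area 0 (deriv \<psi>) < \<infinity>"
    if ub: "bdd_above ((\<lambda>z. cmod (deriv (deriv \<psi>) z) * (1 - (cmod z)\<^sup>2)) ` unit_disc)"
  proof -
    obtain M where "\<And>z. z \<in> unit_disc \<Longrightarrow> cmod (deriv (deriv \<psi>) z) * (1 - (cmod z)\<^sup>2) \<le> M"
      using ub unfolding bdd_above_def by blast
    thus ?thesis by (rule area_finite_of_deriv_bound[OF deriv_holomorphic_disc[OF psi_hol]])
  qed
  have little_o: "bdd_above ((\<lambda>z. cmod (deriv (deriv \<psi>) z) * (1 - (cmod z)\<^sup>2)) ` unit_disc)"
    if "((\<lambda>z. cmod (deriv (deriv \<psi>) z) * (1 - (cmod z)\<^sup>2)) \<longlongrightarrow> 0) (cmod going_to at_left 1)"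
    using that by (intro bdd_above_of_boundary_limit continuous_intros holomorphic_on_imp_continuous_on[OF dd])
  have ratio: "(\<lambda>z. cmod (\<psi> z) * ((1 - (cmod z)\<^sup>2) / (1 - (cmod (\<phi> z))\<^sup>2)) powr (\<alpha> / 2)) = boundary_ratio \<alpha> \<psi> \<phi>"
    by (simp add: boundary_ratio_def fun_eq_iff)
  show ?thesis
    unfolding ratio
  proof (intro conjI impI iffI)
    show "bdd_above (boundary_ratio \<alpha> \<psi> \<phi> ` unit_disc)"
      if "bounded_on_dirichlet \<alpha> (weighted_comp_op \<psi> \<phi>)"
      by (rule bounded_imp_boundary_ratio_bounded[OF alpha phi_self that])
    show "(boundary_ratio \<alpha> \<psi> \<phi> \<longlongrightarrow> 0) (cmod going_to at_left 1)"
      if "compact_on_dirichlet \<alpha> (weighted_comp_op \<psi> \<phi>)"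
      by (rule compact_imp_boundary_ratio_tendsto_0[OF alpha phi_self that])
    show "bounded_on_dirichlet \<alpha> (weighted_comp_op \<psi> \<phi>)"
      if "bdd_above ((\<lambda>z. cmod (deriv (deriv \<psi>) z) * (1 - (cmod z)\<^sup>2)) ` unit_disc)"
        "bdd_above (boundary_ratio \<alpha> \<psi> \<phi> ` unit_disc)"
      by (rule boundary_ratio_bounded_imp_bounded[OF alpha psi_hol phi_hol phi_self phi_univalent fin[OF that(1)] that(2)])
    show "compact_on_dirichlet \<alpha> (weighted_comp_op \<psi> \<phi>)"
      if "((\<lambda>z. cmod (deriv (deriv \<psi>) z) * (1 - (cmod z)\<^sup>2)) \<longlongrightarrow> 0) (cmod going_to at_left 1)"
        "(boundary_ratio \<alpha> \<psi> \<phi> \<longlongrightarrow> 0) (cmod going_to at_left 1)"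
      by (rule boundary_ratio_tendsto_0_imp_compact[OF alpha psi_hol phi_hol phi_self phi_univalent fin[OF little_o[OF that(1)]] that(2)])
  qed
qed

end
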